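(* Let $U:\mathbb{R}^d\to\mathbb{R}$ be strongly convex and satisfy the growth assumption (with constants $L,m>0$) and the strong monotonicity assumption (with constant $\mu>0$) given in the context, and let the $\mathbb{R}^d$-valued random variable $\xi$ satisfy the initial condition assumption given in the context. Let $p\geq 1$ and $\beta>0$, and let $\pi_\beta$ be the probability measure on $\mathbb{R}^d$ with density proportional to $e^{-\beta U}$ (the invariant measure of the overdamped Langevin SDE $dY_t=-\nabla U(Y_t)dt+\sqrt{2/\beta}\,dW_t$). Let $\gamma_0\in(0,\frac{\mu}{2L^2})$. Then there exists $c>0$ such that for every $\gamma\in(0,\gamma_0)$ and every $n\in\mathbb{N}$ the unadjusted Langevin algorithm $$x_{n+1}=x_n-\gamma\nabla U(x_n)+\sqrt{\tfrac{2\gamma}{\beta}}\,z_{n+1},\qquad x_0=\xi,$$ where $(z_n)_{n\ge1}$ are i.i.d. standard Gaussians on $\mathbb{R}^d$ independent of $\xi$, satisfies $$W_p(\pi_\beta,\mathcal{L}(x_n))\leq W_p(\mathcal{L}(\xi),\pi_\beta)\,e^{-\mu\gamma n}+c\gamma^{1/4}.$$ The constant $c$ does not depend on $\gamma$ or $n$.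
   Context: $\mathcal{L}(Z)$ denotes the law of a random variable $Z$. $W_p(\nu_1,\nu_2)=\inf (E|Z_1-Z_2|^p)^{1/p}$ over all couplings with $\mathcal{L}(Z_i)=\nu_i$ is the Wasserstein-$p$ distance. Growth assumption: $\nabla U$ exists (Lebesgue) almost everywhere, and there exist $L,m>0$ such that $|\nabla U(x)|\le m+L|x|$ wherever $\nabla U(x)$ is well defined. Strong monotonicity assumption: there exists $\mu>0$ such that $\langle\nabla U(x)-\nabla U(y),x-y\rangle\ge\mu|x-y|^2$ for all $x,y\in\mathbb{R}^d$ at which $\nabla U$ is well defined. Initial condition assumption: $P(\xi\in\{x\in\mathbb{R}^d:\nabla U(x)\text{ well defined}\})=1$, and $E|\xi|^p<\infty$ for every $p>0$. Under these assumptions each $x_n$ almost surely lies in the set where $\nabla U$ is well defined, so the algorithm is almost surely well defined. *)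

theory Defs
  imports "HOL-Probability.Probability"
begin

definition strongly_convex :: "('a::real_normed_vector \<Rightarrow> real) \<Rightarrow> bool" where
  "strongly_convex U \<longleftrightarrow> (\<exists>\<kappa>>0. \<forall>x y. \<forall>t\<in>{0..1}.
     U (t *\<^sub>R x + (1 - t) *\<^sub>R y)
       \<le> t * U x + (1 - t) * U y - \<kappa> / 2 * t * (1 - t) * (norm (x - y))\<^sup>2)"

definition grad_dom :: "('a::real_inner \<Rightarrow> real) \<Rightarrow> 'a set" where
  "grad_dom U = {x. \<exists>g. GDERIV U x :> g}"

text \<open>The value 0 outside \<^term>\<open>grad_dom U\<close> is arbitrary; it makes the gradient of a
  convex function Borel measurable on the whole space.\<close>

definition grad :: "('a::real_inner \<Rightarrow> real) \<Rightarrow> 'a \<Rightarrow> 'a" where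
  "grad U x = (if x \<in> grad_dom U then THE g. GDERIV U x :> g else 0)"

lemma grad_eqI:
  assumes "GDERIV U x :> g"
  shows "grad U x = g"
proof -
  have "h = g" if "GDERIV U x :> h" for h
  proof -
    have "(\<lambda>v. inner v h) = (\<lambda>v. inner v g)"
      using that assms unfolding gderiv_def by (rule has_derivative_unique)
    then show ?thesis
      by (metis inner_commute vector_eq_rdot)
  qed
  then have "(THE h. GDERIV U x :> h) = g"
    using assms by (intro the_equality)
  then show ?thesis
    using assms by (auto simp: grad_def grad_dom_def)
qed

text \<open>The probability measure with Lebesgue density proportional to \<open>exp (- \<beta> U)\<close>.\<close>

definition gibbs :: "real \<Rightarrow> ('a::euclidean_space \<Rightarrow> real) \<Rightarrow> 'a measure" where
  "gibbs \<beta> U = density lborel (\<lambda>x. ennreal (exp (- \<beta> * U x)) /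
     (\<integral>\<^sup>+ y. ennreal (exp (- \<beta> * U y)) \<partial>lborel))"

definition couplings :: "'a::topological_space measure \<Rightarrow> 'a measure \<Rightarrow> ('a \<times> 'a) measure set" where
  "couplings \<nu>1 \<nu>2 = {\<rho>. prob_space \<rho> \<and> sets \<rho> = sets (borel \<Otimes>\<^sub>M borel) \<and>
     distr \<rho> borel fst = \<nu>1 \<and> distr \<rho> borel snd = \<nu>2}"

definition ennreal_powr :: "ennreal \<Rightarrow> real \<Rightarrow> ennreal" where
  "ennreal_powr a q = (if a = \<top> then \<top> else ennreal (enn2real a powr q))"

text \<open>Taken in \<^typ>\<open>ennreal\<close>, so that couplings of infinite cost (or an empty set of
  couplings) contribute \<open>\<top>\<close> instead of a default value of the Bochner integral.\<close>

definition wasserstein :: "real \<Rightarrow> 'a::metric_space measure \<Rightarrow> 'a measure \<Rightarrow> ennreal" where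
  "wasserstein p \<nu>1 \<nu>2 = (INF \<rho>\<in>couplings \<nu>1 \<nu>2.
     ennreal_powr (\<integral>\<^sup>+ w. ennreal (dist (fst w) (snd w) powr p) \<partial>\<rho>) (1 / p))"

definition std_gaussian_density :: "'a::euclidean_space \<Rightarrow> ennreal" where
  "std_gaussian_density x = (\<Prod>b\<in>Basis. ennreal (std_normal_density (inner x b)))"

text \<open>\<open>z 1, z 2, \<dots>\<close> are i.i.d. standard Gaussian and independent of \<open>\<xi>\<close>, i.e. the family
  \<open>\<xi>, z 1, z 2, \<dots>\<close> is independent; \<open>z 0\<close> is not used.\<close>

definition gaussian_noise ::
  "'w measure \<Rightarrow> ('w \<Rightarrow> 'a::euclidean_space) \<Rightarrow> (nat \<Rightarrow> 'w \<Rightarrow> 'a) \<Rightarrow> bool" where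
  "gaussian_noise M \<xi> z \<longleftrightarrow>
     prob_space.indep_vars M (\<lambda>_. borel) (\<lambda>n. if n = 0 then \<xi> else z n) UNIV \<and>
     (\<forall>n\<ge>1. distributed M lborel (z n) std_gaussian_density)"

primrec ula :: "('a::real_inner \<Rightarrow> real) \<Rightarrow> real \<Rightarrow> real \<Rightarrow> ('w \<Rightarrow> 'a) \<Rightarrow> (nat \<Rightarrow> 'w \<Rightarrow> 'a)
    \<Rightarrow> nat \<Rightarrow> 'w \<Rightarrow> 'a" where
  "ula U \<beta> \<gamma> \<xi> z 0 \<omega> = \<xi> \<omega>"
| "ula U \<beta> \<gamma> \<xi> z (Suc n) \<omega> = ula U \<beta> \<gamma> \<xi> z n \<omega> - \<gamma> *\<^sub>R grad U (ula U \<beta> \<gamma> \<xi> z n \<omega>)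
     + sqrt (2 * \<gamma> / \<beta>) *\<^sub>R z (Suc n) \<omega>"

end

theory Submission
  imports Defs
begin

text \<open>
The Gibbs measure \<open>\<pi>\<close> is stationary for the Langevin diffusion, and the classical proof compares
the algorithm with that diffusion. Here the diffusion is replaced by a discrete chain that has
\<open>\<pi>\<close> as an exactly invariant law and that uses the same Gaussian increments \<open>v = sqrt (2 \<gamma> / \<beta>) z\<close> as
the algorithm: from \<open>X\<close> it moves to \<open>X + v\<close> with a probability \<open>acc X v\<close> and stays at \<open>X\<close> otherwise.
The acceptance probability satisfies detailed balance
(\<open>acc_detailed_balance\<close>, \<open>gibbs_metropolis_invariant\<close>), so no error is made in the target
measure.

The usual acceptance rule \<open>min 1 (exp (- t))\<close>, \<open>t = \<beta> (U (X + v) - U X)\<close>, would not do: its mean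
displacement is badly biased near the kinks of \<open>U\<close>, where \<open>t\<close> is not close to an odd
function of \<open>v\<close>. Instead \<open>acc X v = exp (- t / 2 - slack X v)\<close>, with a \<open>slack\<close> that is symmetric under
exchange of the two end points, dominates \<open>\<bar>t\<bar> / 2\<close> (so that \<open>acc\<close> is at most \<open>1\<close>) and is even in \<open>v\<close> up to
second order. Since \<open>acc\<close> is then smooth in \<open>t\<close>, the mean displacement in a direction \<open>D = X - Y\<close> is,
up to \<open>O(\<gamma> powr (3/2))\<close>, the Gaussian average of \<open>- (1/2) t \<langle>v, D\<rangle>\<close>. For a convex \<open>U\<close>, Gaussian
integration by parts turns that average into the one-sided bound \<open>- \<gamma> E (U (X + v) - U (Y + v))\<close>
(\<open>gaussian_stein_convex_nonneg\<close>, \<open>stein_U\<close>), and strong convexity at the one point \<open>Y\<close>, where the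
algorithm evaluates the gradient, bounds it by \<open>- \<gamma> (\<langle>grad U Y, D\<rangle> + (\<mu>/2) |D|^2)\<close>
(\<open>reject_drift\<close>), again up to \<open>O(\<gamma> powr (3/2))\<close>. Thus the gradient
enters only through its value at \<open>Y\<close>.

Compare now \<open>X\<close> with the algorithm \<open>y\<close>. The rejections happen with probability
\<open>O(sqrt \<gamma>)\<close>, so they add \<open>O(\<gamma> powr (3/2))\<close> to the expected squared distance in each step, and the drift contracts
it by a factor \<open>1 - c \<gamma>\<close>; after summation the squared distance is \<open>O(sqrt \<gamma>)\<close>, which is the rate \<open>\<gamma> powr (1/4)\<close>.
The same computation works for every even power (\<open>one_step_drift\<close>, \<open>joint_distance_moment\<close>).

The rate \<open>exp (- \<mu> \<gamma> n)\<close> with leading coefficient \<open>1\<close> comes from two copies of the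
algorithm with the same noise, one started at \<open>\<xi>\<close> and one at \<open>\<pi>\<close>: their difference evolves without
noise, and monotonicity contracts it up to a term of order \<open>sqrt \<gamma>\<close>, in every \<open>L^p\<close> (\<open>smooth_dist_euler\<close>,
\<open>joint_smooth_contraction\<close>). All three processes are run together from a coupling of the law of \<open>\<xi>\<close> and
\<open>\<pi>\<close>, so the two estimates combine by Minkowski's inequality on one space, without gluing of
couplings, and the infimum over the initial coupling gives the theorem.
\<close>

section \<open>Convex potentials with an almost everywhere defined gradient\<close>

lemma strongly_convex_imp_convex_on:
  fixes U :: "'a::real_normed_vector \<Rightarrow> real"
  assumes "strongly_convex U"
  shows "convex_on UNIV U"
proof -
  obtain \<kappa> where k: "\<kappa> > 0" and le: "\<And>(x::'a) y t. t \<in> {0..1} \<Longrightarrow> U (t *\<^sub>R x + (1 - t) *\<^sub>R y)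
       \<le> t * U x + (1 - t) * U y - \<kappa> / 2 * t * (1 - t) * (norm (x - y))\<^sup>2"
    using assms unfolding strongly_convex_def by blast
  show ?thesis
  proof (rule convex_onI)
    fix t :: real and x y :: 'a assume t: "0 < t" "t < 1"
    have "0 \<le> \<kappa> / 2 * (1 - t) * t * (norm (y - x))\<^sup>2" using t k by simp
    with le[of "1 - t" x y] t show "U ((1 - t) *\<^sub>R x + t *\<^sub>R y) \<le> (1 - t) * U x + t * U y"
      by (simp add: norm_minus_commute)
  qed simp
qed

lemma GDERIV_grad: "x \<in> grad_dom U \<Longrightarrow> GDERIV U x :> grad U x"
  using grad_eqI unfolding grad_dom_def by blast

text \<open>
The difference quotients along a segment are bounded by the increment over the whole segment, and
they converge to the directional derivative.
\<close>

lemma convex_on_grad_tangent: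
  fixes U :: "'a::euclidean_space \<Rightarrow> real"
  assumes cv: "convex_on UNIV U" and x: "x \<in> grad_dom U"
  shows "U w \<ge> U x + inner (grad U x) (w - x)"
proof -
  define d where "d = w - x"
  have "(U has_derivative (\<lambda>h. inner h (grad U x))) (at x)"
    using GDERIV_grad[OF x] unfolding gderiv_def .
  then have "((\<lambda>t. U (x + t *\<^sub>R d)) has_derivative (\<lambda>t. inner (t *\<^sub>R d) (grad U x))) (at (0::real))"
    by (intro has_derivative_compose[where f="\<lambda>t. x + t *\<^sub>R d" and g=U])
       (auto intro!: derivative_eq_intros)
  then have "((\<lambda>t. U (x + t *\<^sub>R d)) has_real_derivative inner d (grad U x)) (at 0)"
    by (simp add: has_field_derivative_def mult_commute_abs)
  then have lim: "((\<lambda>t. (U (x + t *\<^sub>R d) - U x) / t) \<longlongrightarrow> inner d (grad U x)) (at_right 0)"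
    unfolding DERIV_def by (auto intro: tendsto_mono[OF at_le])
  have "\<forall>\<^sub>F t in at_right 0. (U (x + t *\<^sub>R d) - U x) / t \<le> U w - U x"
  proof -
    have "(U (x + t *\<^sub>R d) - U x) / t \<le> U w - U x" if "0 < t" "t < 1" for t
    proof -
      have "U ((1 - t) *\<^sub>R x + t *\<^sub>R w) \<le> (1 - t) * U x + t * U w"
        using convex_onD[OF cv, of t x w] that by auto
      moreover have "(1 - t) *\<^sub>R x + t *\<^sub>R w = x + t *\<^sub>R d"
        by (simp add: d_def algebra_simps)
      ultimately have "U (x + t *\<^sub>R d) - U x \<le> (U w - U x) * t" by (simp add: algebra_simps)
      then show ?thesis using that by (simp add: pos_divide_le_eq)
    qed
    then show ?thesis unfolding eventually_at_right_field by (intro exI[of _ 1]) auto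
  qed
  then have "inner d (grad U x) \<le> U w - U x"
    using lim by (intro tendsto_upperbound[OF lim]) auto
  then show ?thesis by (simp add: d_def inner_commute)
qed

locale potential =
  fixes U :: "'a::euclidean_space \<Rightarrow> real" and L m \<mu> :: real
  assumes cvx: "convex_on UNIV U"
    and dom_AE: "AE x in lebesgue. x \<in> grad_dom U"
    and L_pos: "L > 0" and m_pos: "m > 0"
    and growth_dom: "\<And>x. x \<in> grad_dom U \<Longrightarrow> norm (grad U x) \<le> m + L * norm x"
    and mu_pos: "\<mu> > 0"
    and grad_mono: "\<And>x y. x \<in> grad_dom U \<Longrightarrow> y \<in> grad_dom U \<Longrightarrow>
           inner (grad U x - grad U y) (x - y) \<ge> \<mu> * (norm (x - y))\<^sup>2"
begin

lemma growth: "norm (grad U x) \<le> m + L * norm x"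
proof (cases "x \<in> grad_dom U")
  case False
  then show ?thesis using L_pos m_pos by (simp add: grad_def)
qed (rule growth_dom)

lemma continuous_U: "continuous_on UNIV U"
  using convex_on_continuous[OF open_UNIV cvx] .

lemma tendsto_U: "f \<longlonglongrightarrow> x \<Longrightarrow> (\<lambda>n. U (f n)) \<longlonglongrightarrow> U x"
  using continuous_U continuous_on_tendsto_compose by fastforce

lemma borel_U [measurable]: "U \<in> borel_measurable borel"
  using continuous_U by (rule borel_measurable_continuous_onI)

text \<open>
A set of full Lebesgue measure is dense. Together with the continuity of \<open>U\<close> this carries
inequalities between values of \<open>U\<close> from points of differentiability to all points.
\<close>

lemma dom_seq:
  obtains f where "\<And>n::nat. f n \<in> grad_dom U" "f \<longlonglongrightarrow> x"
proof -
  have "grad_dom U \<inter> S \<noteq> {}" if S: "open S" "x \<in> S" for S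
  proof
    assume e: "grad_dom U \<inter> S = {}"
    have "AE y in lebesgue. y \<notin> S"
      using dom_AE by eventually_elim (use e in auto)
    then have "S \<in> null_sets lebesgue"
      using S by (subst AE_iff_null_sets) (auto simp: sets_completionI_sets)
    then have "emeasure lborel S = 0"
      using S by (auto simp: null_sets_def emeasure_completion)
    moreover have "emeasure lborel S > 0"
    proof -
      obtain e where "e > 0" "ball x e \<subseteq> S" using S openE by blast
      then have "emeasure lborel (ball x e) \<le> emeasure lborel S"
        using S by (intro emeasure_mono) auto
      moreover have "emeasure lborel (ball x e) > 0" 
        using \<open>e > 0\<close> content_ball_pos[of e x]
        by (metis Sigma_Algebra.measure_def enn2real_0 measure_completion less_irrefl lmeasurable_ball not_gr_zero sets_lborel borel_open open_ball)
      ultimately show ?thesis by simp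
    qed
    ultimately show False by simp
  qed
  then have "x \<in> closure (grad_dom U)" by (auto simp: closure_iff_nhds_not_empty)
  then show ?thesis using that unfolding closure_sequential by blast
qed

text \<open>
A local Lipschitz bound whose constant depends only on the point \<open>z\<close>: it is the tangent inequality at \<open>z\<close>
with the growth bound for the gradient, extended by density.
\<close>

lemma U_diff_le: "U z - U w \<le> (m + L * norm z) * norm (z - w)"
proof -
  obtain f where f: "\<And>n::nat. f n \<in> grad_dom U" "f \<longlonglongrightarrow> z" using dom_seq by blast
  have "U (f n) - U w \<le> (m + L * norm (f n)) * norm (f n - w)" for n
  proof -
    have "U (f n) - U w \<le> inner (grad U (f n)) (f n - w)"
      using convex_on_grad_tangent[OF cvx f(1), of n w] by (simp add: inner_diff_right)
    also have "\<dots> \<le> norm (grad U (f n)) * norm (f n - w)" by (rule norm_cauchy_schwarz)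
    also have "\<dots> \<le> (m + L * norm (f n)) * norm (f n - w)"
      by (intro mult_right_mono growth) auto
    finally show ?thesis .
  qed
  then show ?thesis
    by (intro LIMSEQ_le[OF tendsto_diff[OF tendsto_U[OF f(2)] tendsto_const]
          tendsto_mult[OF tendsto_add[OF tendsto_const tendsto_mult[OF tendsto_const tendsto_norm[OF f(2)]]]
             tendsto_norm[OF tendsto_diff[OF f(2) tendsto_const]]]]) auto
qed

text \<open>
Moving away from \<open>z\<close> along a ray, monotonicity compares the gradient at the current point \<open>x\<close> with the
one at \<open>z\<close>. Only rays through \<open>z\<close> are used, since there the displacement is parallel to \<open>x - z\<close>. In this form no
gradient at \<open>x\<close> is left, so \<open>x\<close> may be arbitrary.
\<close>

lemma U_ray_increment:
  assumes z: "z \<in> grad_dom U" and s: "s \<ge> 0"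
  shows "U (x + s *\<^sub>R (x - z)) - U x \<ge> s * (inner (grad U z) (x - z) + \<mu> * (norm (x - z))\<^sup>2)"
proof -
  obtain f where f: "\<And>n::nat. f n \<in> grad_dom U" "f \<longlonglongrightarrow> x" using dom_seq by blast
  have "U (f n + s *\<^sub>R (f n - z)) - U (f n) \<ge> s * (inner (grad U z) (f n - z) + \<mu> * (norm (f n - z))\<^sup>2)" for n
  proof -
    have "U (f n + s *\<^sub>R (f n - z)) - U (f n) \<ge> s * inner (grad U (f n)) (f n - z)"
      using convex_on_grad_tangent[OF cvx f(1), of n "f n + s *\<^sub>R (f n - z)"] by simp
    moreover have "inner (grad U (f n)) (f n - z) \<ge> inner (grad U z) (f n - z) + \<mu> * (norm (f n - z))\<^sup>2"
      using grad_mono[OF f(1) z, of n] by (simp add: inner_diff_left)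
    then have "s * inner (grad U (f n)) (f n - z) \<ge> s * (inner (grad U z) (f n - z) + \<mu> * (norm (f n - z))\<^sup>2)"
      using s by (rule mult_left_mono)
    ultimately show ?thesis by linarith
  qed
  moreover have "(\<lambda>n. U (f n + s *\<^sub>R (f n - z)) - U (f n)) \<longlonglongrightarrow> U (x + s *\<^sub>R (x - z)) - U x"
    by (intro tendsto_diff tendsto_U tendsto_intros f(2))
  moreover have "(\<lambda>n. s * (inner (grad U z) (f n - z) + \<mu> * (norm (f n - z))\<^sup>2))
      \<longlonglongrightarrow> s * (inner (grad U z) (x - z) + \<mu> * (norm (x - z))\<^sup>2)"
    by (intro tendsto_intros f(2))
  ultimately show ?thesis by (intro LIMSEQ_le) auto
qed

text \<open>
The strong monotonicity constant \<open>\<mu>\<close> is also a strong convexity constant. It need not be the constant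
hidden in \<open>strongly_convex\<close>, and the sharp \<open>\<mu>\<close> is what the step-size restriction is tuned to.
The segment from \<open>z\<close> to \<open>w\<close> is cut into \<open>N\<close> pieces; each ray increment is off by
\<open>O(1 / N^2)\<close>, and \<open>N\<close> tends to infinity. This replaces the integration of the gradient along
the segment, on which it may be undefined.
\<close>

lemma U_strong_tangent:
  assumes z: "z \<in> grad_dom U"
  shows "U w \<ge> U z + inner (grad U z) (w - z) + \<mu> / 2 * (norm (w - z))\<^sup>2"
proof -
  define d where "d = w - z"
  define \<psi> where "\<psi> t = U (z + t *\<^sub>R d) - t * inner (grad U z) d - \<mu> * t\<^sup>2 / 2 * (norm d)\<^sup>2" for t
  have step: "\<psi> (t + \<tau>) - \<psi> t \<ge> - (\<mu> * \<tau>\<^sup>2 / 2 * (norm d)\<^sup>2)" if "t \<ge> 0" "\<tau> \<ge> 0" for t \<tau>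
  proof (cases "t = 0")
    case True
    then show ?thesis
      using convex_on_grad_tangent[OF cvx z, of "z + \<tau> *\<^sub>R d"] by (simp add: \<psi>_def)
  next
    case False
    then have t: "t > 0" using that by simp
    have e1: "z + t *\<^sub>R d + (\<tau> / t) *\<^sub>R (z + t *\<^sub>R d - z) = z + (t + \<tau>) *\<^sub>R d"
      using t by (simp add: algebra_simps)
    have e2: "(\<tau> / t) * (inner (grad U z) (z + t *\<^sub>R d - z) + \<mu> * (norm (z + t *\<^sub>R d - z))\<^sup>2)
        = \<tau> * inner (grad U z) d + \<mu> * t * \<tau> * (norm d)\<^sup>2"
      using t by (simp add: field_simps power2_eq_square)
    have "U (z + (t + \<tau>) *\<^sub>R d) - U (z + t *\<^sub>R d) \<ge> \<tau> * inner (grad U z) d + \<mu> * t * \<tau> * (norm d)\<^sup>2"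
      using U_ray_increment[OF z, of "\<tau> / t" "z + t *\<^sub>R d"] t that unfolding e1 e2 by simp
    then show ?thesis by (simp add: \<psi>_def power2_eq_square field_simps)
  qed
  have tele: "\<psi> (real k / N) - \<psi> 0 \<ge> - (real k * (\<mu> * (1/N)\<^sup>2 / 2 * (norm d)\<^sup>2))" if "N > 0" for k and N :: real
  proof (induction k)
    case (Suc k)
    have e1: "real (Suc k) / N = real k / N + 1 / N" by (simp add: add_divide_distrib)
    have e2: "real (Suc k) * (\<mu> * (1/N)\<^sup>2 / 2 * (norm d)\<^sup>2)
        = real k * (\<mu> * (1/N)\<^sup>2 / 2 * (norm d)\<^sup>2) + \<mu> * (1/N)\<^sup>2 / 2 * (norm d)\<^sup>2"
      by (simp only: of_nat_Suc distrib_right mult_1_left add.commute)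
    have "\<psi> (real k / N + 1 / N) - \<psi> (real k / N) \<ge> - (\<mu> * (1/N)\<^sup>2 / 2 * (norm d)\<^sup>2)"
      using that by (intro step) auto
    then show ?case unfolding e1 e2 using Suc by linarith
  qed simp
  have "\<psi> 1 - \<psi> 0 \<ge> - (inverse (real (Suc n)) * (\<mu> / 2 * (norm d)\<^sup>2))" for n
  proof -
    have e: "real (Suc n) * (\<mu> * (1 / real (Suc n))\<^sup>2 / 2 * (norm d)\<^sup>2)
       = inverse (real (Suc n)) * (\<mu> / 2 * (norm d)\<^sup>2)"
      by (simp add: power2_eq_square field_simps del: of_nat_Suc)
    have "real (Suc n) / real (Suc n) = 1" by simp
    with tele[of "real (Suc n)" "Suc n"] show ?thesis unfolding e by simp
  qed
  moreover have "(\<lambda>n. - (inverse (real (Suc n)) * (\<mu> / 2 * (norm d)\<^sup>2))) \<longlonglongrightarrow> - (0 * (\<mu> / 2 * (norm d)\<^sup>2))"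
    by (intro tendsto_intros LIMSEQ_inverse_real_of_nat)
  ultimately have "\<psi> 1 - \<psi> 0 \<ge> 0"
    using LIMSEQ_le_const2[of "\<lambda>n. - (inverse (real (Suc n)) * (\<mu> / 2 * (norm d)\<^sup>2))" 0 "\<psi> 1 - \<psi> 0"] by auto
  then show ?thesis by (simp add: \<psi>_def d_def)
qed

end

section \<open>Measurability of the gradient\<close>

text \<open>
Differentiability expressed by countably many conditions: at every scale some affine function from
a countable family approximates well. The approximating slopes form a Cauchy sequence because two
slopes that both approximate well on a common ball must be close.
\<close>

lemma grad_dom_eq_approx:
  fixes U :: "'a::euclidean_space \<Rightarrow> real"
  assumes dense: "\<And>g e. e > 0 \<Longrightarrow> \<exists>h\<in>D. norm (h - g) < e"
  shows "grad_dom U = {x. \<forall>i::nat. \<exists>j::nat. \<exists>g\<in>D. \<forall>y\<in>ball 0 (inverse (Suc j)).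
     \<bar>U (x + y) - U x - inner g y\<bar> \<le> inverse (Suc i) * norm y}" (is "_ = ?R")
proof (intro equalityI subsetI)
  fix x assume "x \<in> grad_dom U"
  then obtain g where "(U has_derivative (\<lambda>h. inner h g)) (at x)"
    unfolding grad_dom_def gderiv_def by blast
  then have der: "\<And>e. e > 0 \<Longrightarrow> \<exists>d>0. \<forall>y. norm (y - x) < d \<longrightarrow>
      \<bar>U y - U x - inner (y - x) g\<bar> \<le> e * norm (y - x)"
    unfolding has_derivative_at_alt by simp
  show "x \<in> ?R"
  proof (intro CollectI allI)
    fix i :: nat
    define e where "e = inverse (real (Suc i)) / 2"
    have e: "e > 0" by (simp add: e_def)
    obtain d where d: "d > 0" "\<And>y. norm (y - x) < d \<Longrightarrow> \<bar>U y - U x - inner (y - x) g\<bar> \<le> e * norm (y - x)"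
      using der[OF e] by blast
    obtain j :: nat where j: "inverse (real (Suc j)) < d" using reals_Archimedean[OF d(1)] by blast
    obtain h where h: "h \<in> D" "norm (h - g) < e" using dense[OF e] by blast
    have "\<bar>U (x + y) - U x - inner h y\<bar> \<le> inverse (Suc i) * norm y" if y: "y \<in> ball 0 (inverse (Suc j))" for y
    proof -
      have "\<bar>U (x + y) - U x - inner y g\<bar> \<le> e * norm y" using d(2)[of "x + y"] y j by simp
      moreover have "\<bar>inner (h - g) y\<bar> \<le> e * norm y"
        using Cauchy_Schwarz_ineq2[of "h - g" y] h(2) mult_right_mono[of "norm (h - g)" e "norm y"] by force
      moreover have "inner (h - g) y = inner h y - inner y g"
        using inner_commute[of g y] by (simp add: inner_diff_left)
      ultimately have "\<bar>U (x + y) - U x - inner h y\<bar> \<le> 2 * (e * norm y)" by linarith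
      then show ?thesis by (simp add: e_def)
    qed
    with h(1) show "\<exists>j::nat. \<exists>g\<in>D. \<forall>y\<in>ball 0 (inverse (Suc j)).
       \<bar>U (x + y) - U x - inner g y\<bar> \<le> inverse (Suc i) * norm y" by blast
  qed
next
  fix x assume "x \<in> ?R"
  then have "\<forall>i::nat. \<exists>j::nat. \<exists>g. \<forall>y\<in>ball 0 (inverse (Suc j)).
     \<bar>U (x + y) - U x - inner g y\<bar> \<le> inverse (Suc i) * norm y" by blast
  then obtain J g where Jg: "\<And>i y. norm y < inverse (real (Suc (J i))) \<Longrightarrow>
     \<bar>U (x + y) - U x - inner (g i) y\<bar> \<le> inverse (Suc i) * norm y"
    by (simp only: mem_ball_0 Ball_def) metis
  have gdiff: "norm (g i - g k) \<le> inverse (Suc i) + inverse (Suc k)" for i k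
  proof (cases "g i = g k")
    case False
    define d where "d = min (inverse (real (Suc (J i)))) (inverse (real (Suc (J k)))) / 2"
    have d: "d > 0" "d < inverse (real (Suc (J i)))" "d < inverse (real (Suc (J k)))"
      by (auto simp: d_def min_def field_simps)
    define w where "w = g i - g k"
    define y where "y = (d / norm w) *\<^sub>R w"
    have w: "norm w > 0" using False by (simp add: w_def)
    have ny: "norm y = d" using w d by (simp add: y_def)
    have "inner (g i) y - inner (g k) y = d * norm w"
    proof -
      have "inner (g i) y - inner (g k) y = inner w y" by (simp add: w_def inner_diff_left)
      also have "\<dots> = d * norm w"
        using w by (simp add: y_def power2_norm_eq_inner[symmetric] power2_eq_square)
      finally show ?thesis .
    qed
    moreover have "\<bar>U (x + y) - U x - inner (g i) y\<bar> \<le> inverse (Suc i) * d"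
       "\<bar>U (x + y) - U x - inner (g k) y\<bar> \<le> inverse (Suc k) * d"
      using Jg[of y i] Jg[of y k] ny d by auto
    ultimately have "d * norm w \<le> inverse (Suc i) * d + inverse (Suc k) * d" by linarith
    then have "d * norm w \<le> d * (inverse (Suc i) + inverse (Suc k))" by (simp add: algebra_simps)
    then show ?thesis using d(1) by (simp add: w_def)
  qed (auto)
  have "Cauchy g"
  proof (rule CauchyI)
    fix e :: real assume "e > 0"
    then obtain n :: nat where n: "inverse (real (Suc n)) < e / 2" using reals_Archimedean[of "e/2"] by auto
    have "norm (g i - g k) < e" if "i \<ge> n" "k \<ge> n" for i k
    proof -
      have "inverse (real (Suc i)) \<le> inverse (real (Suc n))" "inverse (real (Suc k)) \<le> inverse (real (Suc n))"
        using that by (auto intro!: le_imp_inverse_le)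
      with gdiff[of i k] n show ?thesis by linarith
    qed
    then show "\<exists>M. \<forall>m\<ge>M. \<forall>n\<ge>M. norm (g m - g n) < e" by blast
  qed
  then obtain g0 where g0: "g \<longlonglongrightarrow> g0" using Cauchy_convergent_iff convergent_def by blast
  have gi: "norm (g i - g0) \<le> inverse (Suc i)" for i
  proof -
    have "(\<lambda>k. norm (g i - g k)) \<longlonglongrightarrow> norm (g i - g0)" by (intro tendsto_intros g0)
    moreover have "(\<lambda>k. inverse (Suc i) + inverse (real (Suc k))) \<longlonglongrightarrow> inverse (Suc i) + 0"
      by (intro tendsto_intros LIMSEQ_inverse_real_of_nat)
    ultimately have "norm (g i - g0) \<le> inverse (Suc i) + 0"
      by (rule LIMSEQ_le) (use gdiff in auto)
    then show ?thesis by simp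
  qed
  have "\<exists>d>0. \<forall>y. norm (y - x) < d \<longrightarrow> \<bar>U y - U x - inner (y - x) g0\<bar> \<le> e * norm (y - x)" if "e > 0" for e
  proof -
    obtain i :: nat where i: "inverse (real (Suc i)) < e / 2" using reals_Archimedean[of "e/2"] \<open>e > 0\<close> by auto
    have "\<bar>U y - U x - inner (y - x) g0\<bar> \<le> e * norm (y - x)" if "norm (y - x) < inverse (real (Suc (J i)))" for y
    proof -
      have "\<bar>U y - U x - inner (g i) (y - x)\<bar> \<le> inverse (Suc i) * norm (y - x)"
        using Jg[of "y - x" i] that by simp
      moreover have "\<bar>inner (g i - g0) (y - x)\<bar> \<le> inverse (Suc i) * norm (y - x)"
        using Cauchy_Schwarz_ineq2[of "g i - g0" "y - x"] mult_right_mono[OF gi[of i], of "norm (y - x)"] by auto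
      moreover have "inner (g i - g0) (y - x) = inner (g i) (y - x) - inner (y - x) g0"
        using inner_commute[of g0 "y - x"] by (simp add: inner_diff_left)
      ultimately have "\<bar>U y - U x - inner (y - x) g0\<bar> \<le> 2 * inverse (Suc i) * norm (y - x)" by linarith
      also have "\<dots> \<le> e * norm (y - x)" using i by (intro mult_right_mono) auto
      finally show ?thesis .
    qed
    then show ?thesis by (intro exI[of _ "inverse (real (Suc (J i)))"]) auto
  qed
  then have "(U has_derivative (\<lambda>h. inner h g0)) (at x)"
    unfolding has_derivative_at_alt by (auto intro: bounded_linear_inner_left)
  then show "x \<in> grad_dom U" unfolding grad_dom_def gderiv_def by blast
qed

lemma borel_grad_dom:
  fixes U :: "'a::euclidean_space \<Rightarrow> real"
  assumes U: "continuous_on UNIV U"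
  shows "grad_dom U \<in> sets borel"
proof -
  obtain D :: "'a set" where D: "countable D" "\<And>X. open X \<Longrightarrow> X \<noteq> {} \<Longrightarrow> \<exists>d\<in>D. d \<in> X"
    using countable_dense_setE by blast
  have dns: "\<exists>h\<in>D. norm (h - g) < e" if "e > 0" for g e
    using D(2)[of "ball g e"] that by (auto simp: dist_norm norm_minus_commute)
  have eq: "grad_dom U = {x. \<forall>i::nat. \<exists>j::nat. \<exists>g\<in>D. \<forall>y\<in>ball 0 (inverse (Suc j)).
     \<bar>U (x + y) - U x - inner g y\<bar> \<le> inverse (Suc i) * norm y}"
    by (rule grad_dom_eq_approx) (rule dns)
  have cl: "closed {x. \<forall>y\<in>ball 0 r. \<bar>U (x + y) - U x - inner g y\<bar> \<le> e * norm y}" for r g e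
  proof -
    have "closed {x. \<bar>U (x + y) - U x - inner g y\<bar> \<le> e * norm y}" for y
      by (intro closed_Collect_le continuous_intros continuous_on_compose2[OF U]) auto
    then have "closed (\<Inter>y\<in>ball 0 r. {x. \<bar>U (x + y) - U x - inner g y\<bar> \<le> e * norm y})"
      by (intro closed_INT) auto
    moreover have "(\<Inter>y\<in>ball 0 r. {x. \<bar>U (x + y) - U x - inner g y\<bar> \<le> e * norm y})
       = {x. \<forall>y\<in>ball 0 r. \<bar>U (x + y) - U x - inner g y\<bar> \<le> e * norm y}" by auto
    ultimately show ?thesis by simp
  qed
  have "grad_dom U = (\<Inter>i::nat. \<Union>j::nat. \<Union>g\<in>D. {x. \<forall>y\<in>ball 0 (inverse (Suc j)).
     \<bar>U (x + y) - U x - inner g y\<bar> \<le> inverse (Suc i) * norm y})"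
    unfolding eq by auto
  moreover have "\<dots> \<in> sets borel"
    using D(1) by (intro sets.countable_INT'' sets.countable_UN' sets.countable_UN'' borel_closed cl) auto
  ultimately show ?thesis by simp
qed

text \<open>
Partial derivatives are limits of difference quotients on the Borel set where the gradient exists.
\<close>

lemma borel_measurable_grad:
  fixes U :: "'a::euclidean_space \<Rightarrow> real"
  assumes U: "continuous_on UNIV U"
  shows "grad U \<in> borel_measurable borel"
proof (subst borel_measurable_euclidean_space, intro ballI)
  fix b :: 'a assume "b \<in> Basis"
  note [measurable] = borel_grad_dom[OF U] borel_measurable_continuous_onI[OF U]
  let ?f = "\<lambda>n x. indicator (grad_dom U) x * ((U (x + inverse (real (Suc n)) *\<^sub>R b) - U x) / inverse (real (Suc n)))"
  show "(\<lambda>x. inner (grad U x) b) \<in> borel_measurable borel"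
  proof (rule borel_measurable_LIMSEQ_real)
    show "?f n \<in> borel_measurable borel" for n by measurable
    fix x
    show "(\<lambda>n. ?f n x) \<longlonglongrightarrow> inner (grad U x) b"
    proof (cases "x \<in> grad_dom U")
      case True
      have "(U has_derivative (\<lambda>h. inner h (grad U x))) (at x)"
        using GDERIV_grad[OF True] unfolding gderiv_def .
      then have "((\<lambda>t. U (x + t *\<^sub>R b)) has_derivative (\<lambda>t. inner (t *\<^sub>R b) (grad U x))) (at (0::real))"
        by (intro has_derivative_compose[where f="\<lambda>t. x + t *\<^sub>R b" and g=U])
           (auto intro!: derivative_eq_intros)
      then have "((\<lambda>t. U (x + t *\<^sub>R b)) has_real_derivative inner b (grad U x)) (at 0)"
        by (simp add: has_field_derivative_def mult_commute_abs)
      then have lim: "((\<lambda>t. (U (x + t *\<^sub>R b) - U x) / t) \<longlongrightarrow> inner b (grad U x)) (at 0)"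
        unfolding DERIV_def by auto
      have "(\<lambda>n. (U (x + inverse (real (Suc n)) *\<^sub>R b) - U x) / inverse (real (Suc n))) \<longlonglongrightarrow> inner b (grad U x)"
        by (rule filterlim_compose[OF lim])
           (use LIMSEQ_inverse_real_of_nat in \<open>simp add: filterlim_at\<close>)
      then show ?thesis using True by (simp add: inner_commute)
    qed (simp add: grad_def)
  qed
qed

section \<open>The standard Gaussian measure\<close>

definition std_gaussian :: "'a::euclidean_space measure" where
  "std_gaussian = density lborel std_gaussian_density"

lemma sets_std_gaussian [measurable_cong, simp]: "sets std_gaussian = sets borel"
  by (simp add: std_gaussian_def)

lemma space_std_gaussian [simp]: "space std_gaussian = UNIV"
  by (simp add: std_gaussian_def)

lemma std_gaussian_density_eq:
  "std_gaussian_density (x::'a::euclidean_space) =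
     ennreal ((1 / sqrt (2 * pi)) ^ DIM('a) * exp (- (norm x)\<^sup>2 / 2))"
proof -
  have "(\<Sum>b\<in>Basis. - (inner x b)\<^sup>2 / 2) = - (norm x)\<^sup>2 / 2"
    by (subst power2_norm_eq_inner, subst euclidean_inner)
       (simp add: sum_negf sum_divide_distrib power2_eq_square)
  then show ?thesis
    by (simp add: std_gaussian_density_def prod_ennreal std_normal_density_def prod_dividef
        exp_sum[symmetric] power_divide)
qed

lemma borel_std_gaussian_density [measurable]: "std_gaussian_density \<in> borel_measurable borel"
  unfolding std_gaussian_density_eq[abs_def] by measurable

lemma nn_integral_std_gaussian:
  "f \<in> borel_measurable borel \<Longrightarrow>
   (\<integral>\<^sup>+z. f z \<partial>std_gaussian) = (\<integral>\<^sup>+z. std_gaussian_density z * f z \<partial>lborel)"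
  unfolding std_gaussian_def by (rule nn_integral_density) auto

lemma prob_space_std_gaussian: "prob_space (std_gaussian :: 'a::euclidean_space measure)"
proof
  have "(\<integral>\<^sup>+x. ennreal (std_normal_density x) \<partial>lborel) = 1"
    using prob_space.emeasure_space_1[OF prob_space_normal_density[of 1 0]]
    by (simp add: emeasure_density)
  then have "(\<integral>\<^sup>+z. std_gaussian_density (z::'a) \<partial>lborel) = 1"
    unfolding std_gaussian_density_def by (subst nn_integral_lborel_prod) auto
  then show "emeasure std_gaussian (space (std_gaussian :: 'a measure)) = 1"
    by (simp add: std_gaussian_def emeasure_density)
qed

interpretation std_gaussian: prob_space "std_gaussian :: 'a::euclidean_space measure"
  by (rule prob_space_std_gaussian)

text \<open>
The integral factorises over the coordinates into one-dimensional Gaussian integrals.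
\<close>

lemma nn_integral_exp_neg_norm_sq:
  assumes "c > 0"
  shows "(\<integral>\<^sup>+x. ennreal (exp (- c * (norm (x::'a::euclidean_space))\<^sup>2)) \<partial>lborel) < \<top>"
proof -
  define s where "s = sqrt (1 / (2 * c))"
  have s: "s > 0" "s\<^sup>2 = 1 / (2 * c)" using assms by (auto simp: s_def)
  have 1: "exp (- c * t\<^sup>2) = sqrt (2 * pi * s\<^sup>2) * normal_density 0 s t" for t
    using s(1) assms by (simp add: normal_density_def s(2) field_simps)
  have "(\<integral>\<^sup>+x. ennreal (normal_density 0 s x) \<partial>lborel) = 1"
    using prob_space.emeasure_space_1[OF prob_space_normal_density[OF s(1), of 0]]
    by (simp add: emeasure_density)
  then have 2: "(\<integral>\<^sup>+t. ennreal (exp (- c * t\<^sup>2)) \<partial>lborel) = ennreal (sqrt (2 * pi * s\<^sup>2))"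
    unfolding 1 by (simp add: ennreal_mult' nn_integral_cmult)
  have "exp (- c * (norm x)\<^sup>2) = (\<Prod>b\<in>Basis. exp (- c * (inner x b)\<^sup>2))" for x :: 'a
    by (subst power2_norm_eq_inner, subst euclidean_inner)
       (simp add: exp_sum[symmetric] sum_negf sum_distrib_left power2_eq_square)
  then have "(\<integral>\<^sup>+x. ennreal (exp (- c * (norm (x::'a))\<^sup>2)) \<partial>lborel)
      = (\<integral>\<^sup>+x. (\<Prod>b\<in>Basis. ennreal (exp (- c * (inner (x::'a) b)\<^sup>2))) \<partial>lborel)"
    by (simp add: prod_ennreal)
  also have "\<dots> = (\<Prod>b\<in>(Basis::'a set). ennreal (sqrt (2 * pi * s\<^sup>2)))"
    by (subst nn_integral_lborel_prod) (use 2 in auto)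
  also have "\<dots> < \<top>" by (simp add: prod_ennreal del: prod_constant)
  finally show ?thesis .
qed

lemma poly_exp_neg_sq_le:
  fixes t c :: real
  assumes "t \<ge> 0" "c > 0"
  shows "(1 + t) ^ k * exp (- c * t\<^sup>2) \<le> exp ((real k)\<^sup>2 / (2 * c)) * exp (- (c / 2) * t\<^sup>2)"
proof -
  have "(1 + t) ^ k \<le> exp t ^ k"
    using assms by (intro power_mono) auto
  also have "\<dots> = exp (real k * t)" by (simp add: exp_of_nat_mult)
  also have "real k * t \<le> (real k)\<^sup>2 / (2 * c) + c / 2 * t\<^sup>2"
  proof -
    have "0 \<le> (real k - c * t)\<^sup>2 / (2 * c)" using assms by simp
    also have "\<dots> = (real k)\<^sup>2 / (2 * c) + c / 2 * t\<^sup>2 - real k * t"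
      using assms by (simp add: power2_eq_square field_simps)
    finally show ?thesis by simp
  qed
  finally have "(1 + t) ^ k \<le> exp ((real k)\<^sup>2 / (2 * c) + c / 2 * t\<^sup>2)" by simp
  then have "(1 + t) ^ k * exp (- c * t\<^sup>2) \<le> exp ((real k)\<^sup>2 / (2 * c) + c / 2 * t\<^sup>2) * exp (- c * t\<^sup>2)"
    by (rule mult_right_mono) simp
  also have "\<dots> = exp ((real k)\<^sup>2 / (2 * c)) * exp (- (c / 2) * t\<^sup>2)"
    by (simp add: exp_add[symmetric])
  finally show ?thesis .
qed

lemma nn_integral_poly_exp_neg_norm_sq:
  assumes "c > 0"
  shows "(\<integral>\<^sup>+x. ennreal ((1 + norm (x::'a::euclidean_space)) ^ k * exp (- c * (norm x)\<^sup>2)) \<partial>lborel) < \<top>"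
proof -
  have "(\<integral>\<^sup>+x. ennreal ((1 + norm (x::'a)) ^ k * exp (- c * (norm x)\<^sup>2)) \<partial>lborel)
     \<le> (\<integral>\<^sup>+x. ennreal (exp ((real k)\<^sup>2 / (2 * c))) * ennreal (exp (- (c / 2) * (norm (x::'a))\<^sup>2)) \<partial>lborel)"
  proof (intro nn_integral_mono)
    fix x :: 'a
    have "ennreal ((1 + norm x) ^ k * exp (- c * (norm x)\<^sup>2))
        \<le> ennreal (exp ((real k)\<^sup>2 / (2 * c)) * exp (- (c / 2) * (norm x)\<^sup>2))"
      by (rule ennreal_leI, rule poly_exp_neg_sq_le) (use assms in auto)
    also have "\<dots> = ennreal (exp ((real k)\<^sup>2 / (2 * c))) * ennreal (exp (- (c / 2) * (norm x)\<^sup>2))"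
      by (rule ennreal_mult') simp
    finally show "ennreal ((1 + norm x) ^ k * exp (- c * (norm x)\<^sup>2))
        \<le> ennreal (exp ((real k)\<^sup>2 / (2 * c))) * ennreal (exp (- (c / 2) * (norm x)\<^sup>2))" .
  qed
  also have "\<dots> = ennreal (exp ((real k)\<^sup>2 / (2 * c))) * (\<integral>\<^sup>+x. ennreal (exp (- (c / 2) * (norm (x::'a))\<^sup>2)) \<partial>lborel)"
    by (rule nn_integral_cmult) auto
  also have "\<dots> < \<top>"
    using nn_integral_exp_neg_norm_sq[of "c / 2", where 'a='a] assms by (simp add: ennreal_mult_less_top)
  finally show ?thesis .
qed

lemma integrable_std_gaussian_power:
  "integrable std_gaussian (\<lambda>z::'a::euclidean_space. (1 + norm z) ^ k)"
proof (rule integrableI_nonneg)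
  let ?c = "(1 / sqrt (2 * pi)) ^ DIM('a)"
  have "(\<integral>\<^sup>+z. ennreal ((1 + norm (z::'a)) ^ k) \<partial>std_gaussian)
     = (\<integral>\<^sup>+z. ennreal ?c * ennreal ((1 + norm (z::'a)) ^ k * exp (- (1/2) * (norm z)\<^sup>2)) \<partial>lborel)"
    by (subst nn_integral_std_gaussian)
       (auto simp: std_gaussian_density_eq ennreal_mult'[symmetric] mult_ac intro!: nn_integral_cong)
  also have "\<dots> = ennreal ?c * (\<integral>\<^sup>+z. ennreal ((1 + norm (z::'a)) ^ k * exp (- (1/2) * (norm z)\<^sup>2)) \<partial>lborel)"
    by (rule nn_integral_cmult) auto
  also have "\<dots> < \<top>"
    using nn_integral_poly_exp_neg_norm_sq[of "1/2" k, where 'a='a] by (simp add: ennreal_mult_less_top)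
  finally show "(\<integral>\<^sup>+z. ennreal ((1 + norm (z::'a)) ^ k) \<partial>std_gaussian) < \<infinity>" by simp
qed auto

text \<open>
The integrability criterion used throughout: at most polynomial growth.
\<close>

lemma integrable_std_gaussian:
  fixes f :: "'a::euclidean_space \<Rightarrow> real"
  assumes "f \<in> borel_measurable borel" "\<And>z. \<bar>f z\<bar> \<le> C * (1 + norm z) ^ k"
  shows "integrable std_gaussian f"
  using assms(1)
  by (intro Bochner_Integration.integrable_bound[OF integrable_mult_right[OF integrable_std_gaussian_power[of k], of C]])
     (auto intro!: AE_I2 order_trans[OF assms(2) abs_ge_self])

lemma nn_integral_lborel_translate:
  fixes f :: "'a::euclidean_space \<Rightarrow> ennreal"
  assumes [measurable]: "f \<in> borel_measurable borel"
  shows "(\<integral>\<^sup>+x. f (x + c) \<partial>lborel) = (\<integral>\<^sup>+x. f x \<partial>lborel)"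
proof -
  have "(\<integral>\<^sup>+x. f x \<partial>lborel) = (\<integral>\<^sup>+x. f x \<partial>distr lborel borel ((+) c))"
    by (simp add: lborel_distr_plus)
  also have "\<dots> = (\<integral>\<^sup>+x. f (x + c) \<partial>lborel)"
    by (subst nn_integral_distr) (auto simp: add.commute)
  finally show ?thesis by simp
qed

lemma nn_integral_lborel_uminus:
  fixes f :: "'a::euclidean_space \<Rightarrow> ennreal"
  assumes [measurable]: "f \<in> borel_measurable borel"
  shows "(\<integral>\<^sup>+x. f (- x) \<partial>lborel) = (\<integral>\<^sup>+x. f x \<partial>lborel)"
proof -
  have "lborel = distr lborel borel (uminus :: 'a \<Rightarrow> 'a)"
    using lborel_affine[of "-1" "0::'a"] by (simp add: density_1 one_ennreal_def[symmetric])
  then have "(\<integral>\<^sup>+x. f x \<partial>lborel) = (\<integral>\<^sup>+x. f x \<partial>distr lborel borel uminus)" by simp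
  also have "\<dots> = (\<integral>\<^sup>+x. f (- x) \<partial>lborel)"
    by (subst nn_integral_distr) auto
  finally show ?thesis by simp
qed

lemma std_gaussian_density_uminus [simp]: "std_gaussian_density (- z) = std_gaussian_density z"
  by (simp add: std_gaussian_density_eq)

lemma distr_std_gaussian_uminus: "distr std_gaussian borel uminus = (std_gaussian :: 'a::euclidean_space measure)"
proof (rule measure_eqI)
  fix A :: "'a set" assume "A \<in> sets (distr std_gaussian borel uminus)"
  then have [measurable]: "A \<in> sets borel" by simp
  have "emeasure (distr std_gaussian borel uminus) A = (\<integral>\<^sup>+z. indicator A (- z) \<partial>std_gaussian)"
    by (simp flip: nn_integral_indicator add: nn_integral_distr)
  also have "\<dots> = (\<integral>\<^sup>+z. std_gaussian_density (- z) * indicator A (- z) \<partial>lborel)"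
    by (subst nn_integral_std_gaussian) auto
  also have "\<dots> = (\<integral>\<^sup>+z. std_gaussian_density z * indicator A z \<partial>lborel)"
    by (rule nn_integral_lborel_uminus) measurable
  also have "\<dots> = emeasure std_gaussian A"
    by (simp add: std_gaussian_def emeasure_density)
  finally show "emeasure (distr std_gaussian borel uminus) A = emeasure std_gaussian A" .
qed simp

lemma integral_std_gaussian_uminus:
  fixes f :: "'a::euclidean_space \<Rightarrow> real"
  assumes [measurable]: "f \<in> borel_measurable borel"
  shows "(\<integral>z. f (- z) \<partial>std_gaussian) = (\<integral>z. f z \<partial>std_gaussian)"
proof -
  have "(\<integral>z. f z \<partial>std_gaussian) = (\<integral>z. f z \<partial>distr std_gaussian borel uminus)"
    by (simp add: distr_std_gaussian_uminus)
  also have "\<dots> = (\<integral>z. f (- z) \<partial>std_gaussian)" by (rule integral_distr) auto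
  finally show ?thesis by simp
qed

lemma integral_std_gaussian_odd:
  fixes f :: "'a::euclidean_space \<Rightarrow> real"
  assumes "f \<in> borel_measurable borel" "\<And>z. f (- z) = - f z"
  shows "(\<integral>z. f z \<partial>std_gaussian) = 0"
  using integral_std_gaussian_uminus[OF assms(1)] unfolding assms(2) by simp

text \<open>
The Cameron--Martin formula for a shift of the standard Gaussian.
\<close>

lemma nn_integral_std_gaussian_shift:
  fixes f :: "'a::euclidean_space \<Rightarrow> ennreal"
  assumes [measurable]: "f \<in> borel_measurable borel"
  shows "(\<integral>\<^sup>+z. f (z - d) \<partial>std_gaussian)
       = (\<integral>\<^sup>+z. f z * ennreal (exp (- inner z d - (norm d)\<^sup>2 / 2)) \<partial>std_gaussian)"
proof -
  have "(\<integral>\<^sup>+z. f (z - d) \<partial>std_gaussian) = (\<integral>\<^sup>+z. std_gaussian_density z * f (z - d) \<partial>lborel)"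
    by (subst nn_integral_std_gaussian) auto
  also have "\<dots> = (\<integral>\<^sup>+z. std_gaussian_density (z + d) * f (z + d - d) \<partial>lborel)"
    by (rule nn_integral_lborel_translate[symmetric]) measurable
  also have "\<dots> = (\<integral>\<^sup>+z. std_gaussian_density z * (f z * ennreal (exp (- inner z d - (norm d)\<^sup>2 / 2))) \<partial>lborel)"
  proof (intro nn_integral_cong)
    fix z :: 'a
    have "exp (- (norm (z + d))\<^sup>2 / 2) = exp (- (norm z)\<^sup>2 / 2) * exp (- inner z d - (norm d)\<^sup>2 / 2)"
      by (simp add: exp_add[symmetric] power2_norm_eq_inner inner_add inner_commute field_simps)
    then show "std_gaussian_density (z + d) * f (z + d - d)
        = std_gaussian_density z * (f z * ennreal (exp (- inner z d - (norm d)\<^sup>2 / 2)))"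
      by (simp add: std_gaussian_density_eq ennreal_mult' mult_ac)
  qed
  also have "\<dots> = (\<integral>\<^sup>+z. f z * ennreal (exp (- inner z d - (norm d)\<^sup>2 / 2)) \<partial>std_gaussian)"
    by (rule nn_integral_std_gaussian[symmetric]) measurable
  finally show ?thesis .
qed

lemma one_plus_norm_diff_power_le:
  fixes z d :: "'a::real_normed_vector"
  shows "(1 + norm (z - d)) ^ k \<le> (1 + norm d) ^ k * (1 + norm z) ^ k"
proof -
  have "1 + norm (z - d) \<le> (1 + norm d) * (1 + norm z)"
  proof -
    have "(1 + norm d) * (1 + norm z) = 1 + norm d + norm z + norm d * norm z"
      by (simp add: algebra_simps)
    moreover have "0 \<le> norm d * norm z" by simp
    ultimately show ?thesis using norm_triangle_ineq4[of z d] by linarith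
  qed
  then have "(1 + norm (z - d)) ^ k \<le> ((1 + norm d) * (1 + norm z)) ^ k" by (intro power_mono) auto
  then show ?thesis by (simp add: power_mult_distrib)
qed

text \<open>
Gaussian integration by parts says that \<open>E (f z * inner z d)\<close> is the derivative of \<open>E f (z - s d)\<close> in
\<open>- s\<close> at \<open>s = 0\<close>, and for a convex \<open>f\<close> this dominates the increment over the whole segment from
\<open>s = 1\<close> to \<open>s = 0\<close>. Differentiation under the integral is avoided: convexity bounds \<open>E f (z - s d)\<close> from above, and the
shift formula together with \<open>exp (- y) \<ge> 1 - y\<close> and \<open>f \<ge> 0\<close> bounds it from below by an expression that is
quadratic in \<open>s\<close>; dividing by \<open>s\<close> and letting \<open>s\<close> tend to \<open>0\<close> gives the claim.
\<close>

lemma gaussian_stein_convex_nonneg: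
  fixes f :: "'a::euclidean_space \<Rightarrow> real"
  assumes cv: "convex_on UNIV f" and nn: "\<And>z. f z \<ge> 0"
    and gr: "\<And>z. f z \<le> C * (1 + norm z) ^ k"
  shows "(\<integral>z. f z - f (z - d) \<partial>std_gaussian) \<le> (\<integral>z. f z * inner z d \<partial>std_gaussian)"
proof -
  have [measurable]: "f \<in> borel_measurable borel"
    using convex_on_continuous[OF open_UNIV cv] by (rule borel_measurable_continuous_onI)
  have C: "C \<ge> 0" using gr[of 0] nn[of 0] by simp
  have int_shift: "integrable std_gaussian (\<lambda>z. f (z - e))" for e
  proof (rule integrable_std_gaussian)
    show "\<bar>f (z - e)\<bar> \<le> (C * (1 + norm e) ^ k) * (1 + norm z) ^ k" for z
      using gr[of "z - e"] mult_left_mono[OF one_plus_norm_diff_power_le[of z e k] C] nn[of "z - e"]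
      by (simp add: mult_ac)
  qed measurable
  have int_f: "integrable std_gaussian f" using int_shift[of 0] by simp
  have int_fi: "integrable std_gaussian (\<lambda>z. f z * inner z d)"
  proof (rule integrable_std_gaussian)
    fix z
    have "\<bar>f z * inner z d\<bar> \<le> (C * (1 + norm z) ^ k) * ((1 + norm z) * norm d)"
      unfolding abs_mult
    proof (intro mult_mono)
      show "\<bar>inner z d\<bar> \<le> (1 + norm z) * norm d"
        using Cauchy_Schwarz_ineq2[of z d] mult_right_mono[of "norm z" "1 + norm z" "norm d"] by simp
    qed (use nn gr C in auto)
    then show "\<bar>f z * inner z d\<bar> \<le> (C * norm d) * (1 + norm z) ^ Suc k" by (simp add: algebra_simps)
  qed measurable
  have main: "(\<integral>z. f z \<partial>std_gaussian) - (\<integral>z. f (z - d) \<partial>std_gaussian)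
     \<le> (\<integral>z. f z * inner z d \<partial>std_gaussian) + s * ((norm d)\<^sup>2 / 2 * (\<integral>z. f z \<partial>std_gaussian))" if s: "0 < s" "s < 1" for s
  proof -
    define y where "y z = s * inner z d + s\<^sup>2 * (norm d)\<^sup>2 / 2" for z
    have [measurable]: "y \<in> borel_measurable borel" unfolding y_def by measurable
    have "(\<integral>\<^sup>+z. ennreal (f (z - s *\<^sub>R d)) \<partial>std_gaussian)
        = (\<integral>\<^sup>+z. ennreal (f z * exp (- y z)) \<partial>std_gaussian)"
      by (subst nn_integral_std_gaussian_shift[of "\<lambda>z. ennreal (f z)"])
         (auto simp: y_def ennreal_mult''[symmetric] power_mult_distrib nn intro!: nn_integral_cong)
    moreover have "(\<integral>\<^sup>+z. ennreal (f (z - s *\<^sub>R d)) \<partial>std_gaussian) = ennreal (\<integral>z. f (z - s *\<^sub>R d) \<partial>std_gaussian)"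
      by (rule nn_integral_eq_integral[OF int_shift]) (simp add: nn)
    ultimately have e: "(\<integral>\<^sup>+z. ennreal (f z * exp (- y z)) \<partial>std_gaussian) = ennreal (\<integral>z. f (z - s *\<^sub>R d) \<partial>std_gaussian)"
      by simp
    have int_e: "integrable std_gaussian (\<lambda>z. f z * exp (- y z))"
      by (rule integrableI_nonneg) (auto simp: e nn)
    have "(\<integral>z. f z * exp (- y z) \<partial>std_gaussian) = (\<integral>z. f (z - s *\<^sub>R d) \<partial>std_gaussian)"
      by (subst integral_eq_nn_integral) (auto simp: e nn integral_nonneg_AE)
    moreover have "(\<integral>z. f (z - s *\<^sub>R d) \<partial>std_gaussian) \<le> (\<integral>z. (1 - s) * f z + s * f (z - d) \<partial>std_gaussian)"
    proof (intro integral_mono int_shift Bochner_Integration.integrable_add integrable_mult_right int_f)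
      fix z
      have "z - s *\<^sub>R d = (1 - s) *\<^sub>R z + s *\<^sub>R (z - d)" by (simp add: algebra_simps)
      then show "f (z - s *\<^sub>R d) \<le> (1 - s) * f z + s * f (z - d)"
        using convex_onD[OF cv, of s z "z - d"] s by simp
    qed
    moreover have "(\<integral>z. f z * (1 - y z) \<partial>std_gaussian) \<le> (\<integral>z. f z * exp (- y z) \<partial>std_gaussian)"
    proof (intro integral_mono int_e)
      have "integrable std_gaussian (\<lambda>z. f z - s * (f z * inner z d) - s\<^sup>2 * (norm d)\<^sup>2 / 2 * f z)"
        by (intro Bochner_Integration.integrable_diff integrable_mult_right int_f int_fi)
      then show "integrable std_gaussian (\<lambda>z. f z * (1 - y z))"
        by (simp add: y_def algebra_simps)
      show "f z * (1 - y z) \<le> f z * exp (- y z)" for z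
        using exp_ge_add_one_self[of "- y z"] by (intro mult_left_mono nn) simp
    qed
    moreover have "(\<integral>z. f z * (1 - y z) \<partial>std_gaussian)
       = (\<integral>z. f z - s * (f z * inner z d) - s\<^sup>2 * (norm d)\<^sup>2 / 2 * f z \<partial>std_gaussian)"
      by (simp add: y_def algebra_simps)
    moreover have "\<dots> = (\<integral>z. f z \<partial>std_gaussian) - s * (\<integral>z. f z * inner z d \<partial>std_gaussian)
         - s\<^sup>2 * (norm d)\<^sup>2 / 2 * (\<integral>z. f z \<partial>std_gaussian)"
      using int_f int_fi by simp
    moreover have "(\<integral>z. (1 - s) * f z + s * f (z - d) \<partial>std_gaussian)
        = (1 - s) * (\<integral>z. f z \<partial>std_gaussian) + s * (\<integral>z. f (z - d) \<partial>std_gaussian)"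
      using int_f int_shift by simp
    ultimately have "(\<integral>z. f z \<partial>std_gaussian) - s * (\<integral>z. f z * inner z d \<partial>std_gaussian)
         - s\<^sup>2 * (norm d)\<^sup>2 / 2 * (\<integral>z. f z \<partial>std_gaussian)
       \<le> (1 - s) * (\<integral>z. f z \<partial>std_gaussian) + s * (\<integral>z. f (z - d) \<partial>std_gaussian)" by linarith
    then have "s * ((\<integral>z. f z \<partial>std_gaussian) - (\<integral>z. f (z - d) \<partial>std_gaussian))
     \<le> s * ((\<integral>z. f z * inner z d \<partial>std_gaussian) + s * ((norm d)\<^sup>2 / 2 * (\<integral>z. f z \<partial>std_gaussian)))"
      by (simp add: algebra_simps power2_eq_square)
    then show ?thesis using s by (simp only: mult_le_cancel_left_pos)
  qed
  let ?c = "(norm d)\<^sup>2 / 2 * (\<integral>z. f z \<partial>std_gaussian)"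
  have "(\<integral>z. f z \<partial>std_gaussian) - (\<integral>z. f (z - d) \<partial>std_gaussian) \<le> (\<integral>z. f z * inner z d \<partial>std_gaussian) + 0 * ?c"
  proof (rule tendsto_lowerbound[where F="at_right (0::real)"])
    show "((\<lambda>s. (\<integral>z. f z * inner z d \<partial>std_gaussian) + s * ?c) \<longlongrightarrow> (\<integral>z. f z * inner z d \<partial>std_gaussian) + 0 * ?c) (at_right 0)"
      by (intro tendsto_intros)
    show "\<forall>\<^sub>F s in at_right 0. (\<integral>z. f z \<partial>std_gaussian) - (\<integral>z. f (z - d) \<partial>std_gaussian)
        \<le> (\<integral>z. f z * inner z d \<partial>std_gaussian) + s * ?c"
      unfolding eventually_at_right_field by (intro exI[of _ 1]) (use main in auto)
  qed auto
  then show ?thesis using int_f int_shift by simp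
qed

section \<open>Inequalities for powers\<close>

text \<open>
The tangent of \<open>t ^ Suc n\<close> at \<open>s\<close>. It turns bounds on squared distances into bounds on
higher even powers.
\<close>

lemma power_tangent_le:
  fixes s t :: real
  assumes "s \<ge> 0" "t \<ge> 0"
  shows "s ^ Suc n + real (Suc n) * s ^ n * (t - s) \<le> t ^ Suc n"
proof (induction n)
  case (Suc n)
  have "s ^ Suc (Suc n) + real (Suc (Suc n)) * s ^ Suc n * (t - s)
      = t * (s ^ Suc n + real (Suc n) * s ^ n * (t - s)) - s ^ n * real (Suc n) * (t - s)\<^sup>2"
    by (simp add: algebra_simps power2_eq_square)
  also have "\<dots> \<le> t * (s ^ Suc n + real (Suc n) * s ^ n * (t - s))"
    using assms by simp
  also have "\<dots> \<le> t * t ^ Suc n"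
    using Suc assms by (intro mult_left_mono) auto
  finally show ?case by simp
qed simp

lemma power_mixture_le:
  fixes u w \<theta> :: real
  assumes "u \<ge> 0" "w \<ge> 0" "0 \<le> \<theta>" "\<theta> \<le> 1"
  shows "((1 - \<theta>) * u + \<theta> * w) ^ Suc n \<le> (1 - \<theta>) * u ^ Suc n + \<theta> * w ^ Suc n"
proof -
  define t where "t = (1 - \<theta>) * u + \<theta> * w"
  have t: "t \<ge> 0" using assms by (simp add: t_def)
  have "(1 - \<theta>) * (t ^ Suc n + real (Suc n) * t ^ n * (u - t)) + \<theta> * (t ^ Suc n + real (Suc n) * t ^ n * (w - t))
     \<le> (1 - \<theta>) * u ^ Suc n + \<theta> * w ^ Suc n"
    using assms t by (intro add_mono mult_left_mono power_tangent_le) auto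
  moreover have "(1 - \<theta>) * (t ^ Suc n + real (Suc n) * t ^ n * (u - t)) + \<theta> * (t ^ Suc n + real (Suc n) * t ^ n * (w - t))
     = t ^ Suc n + real (Suc n) * t ^ n * ((1 - \<theta>) * u + \<theta> * w - t)"
    by (simp add: algebra_simps)
  ultimately show ?thesis by (simp add: t_def)
qed

lemma power_mixed_terms_le:
  fixes a w :: real
  assumes "a \<ge> 0" "w \<ge> 0"
  shows "a ^ (2 * n) * w ^ 4 \<le> a ^ (2 * n + 2) * w\<^sup>2 + w ^ (2 * n + 4)"
    and "a\<^sup>2 * w ^ (2 * n + 2) \<le> a ^ (2 * n + 2) * w\<^sup>2 + w ^ (2 * n + 4)"
proof -
  have "a ^ (2 * n) * w ^ 4 \<le> a ^ (2 * n + 2) * w\<^sup>2 + w ^ (2 * n + 4)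
     \<and> a\<^sup>2 * w ^ (2 * n + 2) \<le> a ^ (2 * n + 2) * w\<^sup>2 + w ^ (2 * n + 4)"
  proof (cases "a \<le> w")
    case True
    have "a ^ (2 * n) * w ^ 4 \<le> w ^ (2 * n) * w ^ 4" "a\<^sup>2 * w ^ (2 * n + 2) \<le> w\<^sup>2 * w ^ (2 * n + 2)"
      using assms True by (auto intro!: mult_right_mono power_mono)
    moreover have "0 \<le> a ^ (2 * n + 2) * w\<^sup>2" by (intro mult_nonneg_nonneg zero_le_power assms)
    moreover have "w ^ (2 * n) * w ^ 4 = w ^ (2 * n + 4)" "w\<^sup>2 * w ^ (2 * n + 2) = w ^ (2 * n + 4)"
      by (simp_all add: power_add eval_nat_numeral mult_ac)
    ultimately show ?thesis by linarith
  next
    case False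
    have wa: "w\<^sup>2 \<le> a\<^sup>2" using assms False by (intro power_mono) auto
    have "a ^ (2 * n) * (w\<^sup>2 * w\<^sup>2) \<le> a ^ (2 * n) * (a\<^sup>2 * w\<^sup>2)"
      using assms wa by (intro mult_left_mono mult_right_mono) auto
    moreover have "w ^ (2 * n) \<le> a ^ (2 * n)" using assms False by (intro power_mono) auto
    then have "a\<^sup>2 * (w ^ (2 * n) * w\<^sup>2) \<le> a\<^sup>2 * (a ^ (2 * n) * w\<^sup>2)"
      by (intro mult_left_mono mult_right_mono) auto
    moreover have "0 \<le> w ^ (2 * n + 4)" by (simp add: assms(2))
    ultimately show ?thesis by (simp add: power_add power2_eq_square power4_eq_xxxx mult_ac)
  qed
  then show "a ^ (2 * n) * w ^ 4 \<le> a ^ (2 * n + 2) * w\<^sup>2 + w ^ (2 * n + 4)"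
    and "a\<^sup>2 * w ^ (2 * n + 2) \<le> a ^ (2 * n + 2) * w\<^sup>2 + w ^ (2 * n + 4)" by auto
qed

text \<open>
Here \<open>a\<^sup>2 - 2 * b + w\<^sup>2\<close> is \<open>norm (A - v) ^ 2\<close> with \<open>a = norm A\<close>, \<open>w = norm v\<close> and \<open>b = inner A v\<close>. The term
linear in \<open>b\<close> is kept exactly because its expectation produces the drift; the rest is of second order in
\<open>w\<close>.
\<close>

lemma quadratic_power_expansion:
  "\<exists>\<kappa>\<ge>1. \<forall>a w b :: real. a \<ge> 0 \<longrightarrow> w \<ge> 0 \<longrightarrow> \<bar>b\<bar> \<le> a * w \<longrightarrow>
     (a\<^sup>2 - 2 * b + w\<^sup>2) ^ Suc n
       \<le> a ^ (2 * n + 2) - 2 * real (Suc n) * a ^ (2 * n) * b + \<kappa> * (a ^ (2 * n) * w\<^sup>2 + w ^ (2 * n + 2))"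
proof (induction n)
  case 0
  show ?case by (intro exI[of _ 1]) (auto simp: power2_eq_square)
next
  case (Suc n)
  then obtain \<kappa> where k: "\<kappa> \<ge> 1" and IH: "\<And>a w b :: real. a \<ge> 0 \<Longrightarrow> w \<ge> 0 \<Longrightarrow> \<bar>b\<bar> \<le> a * w \<Longrightarrow>
     (a\<^sup>2 - 2 * b + w\<^sup>2) ^ Suc n
       \<le> a ^ (2 * n + 2) - 2 * real (Suc n) * a ^ (2 * n) * b + \<kappa> * (a ^ (2 * n) * w\<^sup>2 + w ^ (2 * n + 2))" by blast
  define N where "N = real (Suc n)"
  show ?case
  proof (intro exI[of _ "1 + 6 * N + 6 * \<kappa>"] conjI allI impI)
    show "1 \<le> 1 + 6 * N + 6 * \<kappa>" using k by (simp add: N_def)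
    fix a w b :: real assume a: "a \<ge> 0" and w: "w \<ge> 0" and b: "\<bar>b\<bar> \<le> a * w"
    define x where "x = a\<^sup>2 - 2 * b + w\<^sup>2"
    define P where "P = a ^ (2 * n)"
    define R where "R = w ^ (2 * n + 2)"
    define Q where "Q = P * a\<^sup>2 * w\<^sup>2"
    define V where "V = R * w\<^sup>2"
    have P: "P \<ge> 0" by (simp add: P_def)
    have R: "R \<ge> 0" unfolding R_def by (intro zero_le_power w)
    have N: "N \<ge> 0" by (simp add: N_def)
    have Q0: "Q \<ge> 0" by (simp add: Q_def P)
    have V0: "V \<ge> 0" by (simp add: V_def R)
    have sq: "0 \<le> (a - w)\<^sup>2" by simp
    have x0: "x \<ge> 0"
      using b sq unfolding x_def power2_diff by (simp add: abs_le_iff)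
    have aw: "2 * (a * w) \<le> a\<^sup>2 + w\<^sup>2" using sq unfolding power2_diff by simp
    have x2: "x \<le> 2 * a\<^sup>2 + 2 * w\<^sup>2" using b aw by (simp add: x_def abs_le_iff)
    have m1: "P * w ^ 4 \<le> Q + V" and m2: "a\<^sup>2 * R \<le> Q + V"
      using power_mixed_terms_le[OF a w, of n]
      by (simp_all add: P_def R_def Q_def V_def power_add mult_ac power2_eq_square power4_eq_xxxx)
    have "x ^ Suc (Suc n) = x * x ^ Suc n" by simp
    also have "\<dots> \<le> x * (P * a\<^sup>2 - 2 * N * P * b + \<kappa> * (P * w\<^sup>2 + R))"
      using IH[OF a w b] by (intro mult_left_mono x0) (simp add: x_def P_def R_def N_def power_add mult_ac power2_eq_square)
    also have "\<dots> = x * (P * a\<^sup>2) + x * (- 2 * N * P * b) + \<kappa> * (x * (P * w\<^sup>2 + R))"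
      by (simp add: algebra_simps)
    also have "x * (P * a\<^sup>2) = P * a ^ 4 - 2 * (P * a\<^sup>2 * b) + Q"
      by (simp add: x_def Q_def algebra_simps power2_eq_square power4_eq_xxxx)
    also have "x * (- 2 * N * P * b) \<le> - 2 * N * (P * a\<^sup>2 * b) + (5 * N * Q + N * (P * w ^ 4))"
    proof -
      have "b\<^sup>2 \<le> (a * w)\<^sup>2" using b by (metis abs_ge_zero power2_abs power_mono)
      then have 1: "N * P * (4 * b\<^sup>2) \<le> N * P * (4 * (a * w)\<^sup>2)"
        using N P by (intro mult_left_mono) auto
      have "- 2 * b * w\<^sup>2 \<le> 2 * (a * w) * w\<^sup>2" using b by (intro mult_right_mono) (auto simp: abs_le_iff)
      also have "\<dots> \<le> (a\<^sup>2 + w\<^sup>2) * w\<^sup>2" using aw by (intro mult_right_mono) auto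
      finally have 2: "N * P * (- 2 * b * w\<^sup>2) \<le> N * P * ((a\<^sup>2 + w\<^sup>2) * w\<^sup>2)"
        using N P by (intro mult_left_mono) auto
      have "x * (- 2 * N * P * b) = - 2 * N * (P * a\<^sup>2 * b) + N * P * (4 * b\<^sup>2) + N * P * (- 2 * b * w\<^sup>2)"
        by (simp add: x_def algebra_simps power2_eq_square)
      also have "\<dots> \<le> - 2 * N * (P * a\<^sup>2 * b) + N * P * (4 * (a * w)\<^sup>2) + N * P * ((a\<^sup>2 + w\<^sup>2) * w\<^sup>2)"
        using 1 2 by linarith
      also have "\<dots> = - 2 * N * (P * a\<^sup>2 * b) + (5 * N * Q + N * (P * w ^ 4))"
        by (simp add: Q_def algebra_simps power2_eq_square power4_eq_xxxx)
      finally show ?thesis .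
    qed
    also have "N * (P * w ^ 4) \<le> N * (Q + V)" using m1 N by (intro mult_left_mono) auto
    also have "\<kappa> * (x * (P * w\<^sup>2 + R)) \<le> \<kappa> * (6 * (Q + V))"
    proof (intro mult_left_mono)
      have "x * (P * w\<^sup>2 + R) \<le> (2 * a\<^sup>2 + 2 * w\<^sup>2) * (P * w\<^sup>2 + R)"
        using x2 P R by (intro mult_right_mono) auto
      also have "\<dots> = 2 * Q + 2 * (P * w ^ 4) + 2 * (a\<^sup>2 * R) + 2 * V"
        by (simp add: Q_def V_def algebra_simps power2_eq_square power4_eq_xxxx)
      also have "\<dots> \<le> 6 * (Q + V)"
      proof -
        have "2 * Q + 2 * p + 2 * r + 2 * V \<le> 6 * (Q + V)" if "p \<le> Q + V" "r \<le> Q + V" for p r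
          using add_mono[OF that] by (simp add: algebra_simps)
        from this[OF m1 m2] show ?thesis .
      qed
      finally show "x * (P * w\<^sup>2 + R) \<le> 6 * (Q + V)" .
    qed (use k in auto)
    finally have "x ^ Suc (Suc n) \<le> P * a ^ 4 - 2 * (P * a\<^sup>2 * b) + Q + (- 2 * N * (P * a\<^sup>2 * b) + (5 * N * Q + N * (Q + V)))
       + \<kappa> * (6 * (Q + V))" by simp
    also have "\<dots> \<le> P * a ^ 4 - 2 * (N + 1) * (P * a\<^sup>2) * b + (1 + 6 * N + 6 * \<kappa>) * (Q + V)"
      using V0 N by (simp add: algebra_simps)
    finally show "(a\<^sup>2 - 2 * b + w\<^sup>2) ^ Suc (Suc n)
       \<le> a ^ (2 * Suc n + 2) - 2 * real (Suc (Suc n)) * a ^ (2 * Suc n) * b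
         + (1 + 6 * N + 6 * \<kappa>) * (a ^ (2 * Suc n) * w\<^sup>2 + w ^ (2 * Suc n + 2))"
      by (simp add: x_def P_def Q_def R_def V_def N_def power_add power2_eq_square power4_eq_xxxx mult_ac add_ac)
  qed
qed

lemma norm_diff_power_expansion:
  obtains \<kappa> :: real where "\<kappa> \<ge> 1"
    and "\<And>A v :: 'a::real_inner. norm (A - v) ^ (2 * Suc n)
       \<le> norm A ^ (2 * Suc n) - 2 * real (Suc n) * norm A ^ (2 * n) * inner A v
          + \<kappa> * (norm A ^ (2 * n) * (norm v)\<^sup>2 + norm v ^ (2 * Suc n))"
proof -
  obtain \<kappa> :: real where k: "\<kappa> \<ge> 1" and H: "\<And>a w b :: real. a \<ge> 0 \<Longrightarrow> w \<ge> 0 \<Longrightarrow> \<bar>b\<bar> \<le> a * w \<Longrightarrow>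
     (a\<^sup>2 - 2 * b + w\<^sup>2) ^ Suc n
       \<le> a ^ (2 * n + 2) - 2 * real (Suc n) * a ^ (2 * n) * b + \<kappa> * (a ^ (2 * n) * w\<^sup>2 + w ^ (2 * n + 2))"
    using quadratic_power_expansion[of n] by blast
  show ?thesis
  proof (rule that[OF k])
    fix A v :: 'a
    have "norm (A - v) ^ (2 * Suc n) = ((norm A)\<^sup>2 - 2 * inner A v + (norm v)\<^sup>2) ^ Suc n"
      by (subst power_mult) (simp add: power2_norm_eq_inner inner_diff inner_commute algebra_simps)
    with H[of "norm A" "norm v" "inner A v"] Cauchy_Schwarz_ineq2[of A v]
    show "norm (A - v) ^ (2 * Suc n)
       \<le> norm A ^ (2 * Suc n) - 2 * real (Suc n) * norm A ^ (2 * n) * inner A v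
          + \<kappa> * (norm A ^ (2 * n) * (norm v)\<^sup>2 + norm v ^ (2 * Suc n))"
      by simp
  qed
qed

lemma exp_minus_le_quadratic:
  fixes x :: real
  assumes "x \<ge> 0"
  shows "exp (- x) \<le> 1 - x + x\<^sup>2 / 2"
proof -
  have "1 \<le> (1 - x + x\<^sup>2 / 2) * (1 + x + x\<^sup>2 / 2)"
  proof -
    have "(1 - x + x\<^sup>2 / 2) * (1 + x + x\<^sup>2 / 2) = 1 + (x\<^sup>2)\<^sup>2 / 4"
      by (simp add: power2_eq_square algebra_simps)
    then show ?thesis by simp
  qed
  also have "\<dots> \<le> (1 - x + x\<^sup>2 / 2) * exp x"
  proof (intro mult_left_mono exp_lower_Taylor_quadratic assms)
    have "1 - x + x\<^sup>2 / 2 = ((1 - x)\<^sup>2 + 1) / 2" by (simp add: power2_diff field_simps)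
    moreover have "0 \<le> ((1 - x)\<^sup>2 + 1) / 2" by (intro divide_nonneg_nonneg add_nonneg_nonneg) auto
    ultimately show "0 \<le> 1 - x + x\<^sup>2 / 2" by (simp only:)
  qed
  finally show ?thesis by (simp add: exp_minus divide_simps)
qed

section \<open>The acceptance probability\<close>

text \<open>
The bound on \<open>\<gamma>0\<close> makes the squared gradient step, of size at most about \<open>\<gamma>\<^sup>2 * L\<^sup>2 * norm D ^ 2\<close>,
smaller than the contraction \<open>\<gamma> * \<mu> * norm D ^ 2\<close>.
\<close>

locale langevin = potential +
  fixes \<beta> \<gamma>0 :: real
  assumes beta_pos: "\<beta> > 0" and gamma0_pos: "\<gamma>0 > 0" and gamma0_le: "\<gamma>0 * L\<^sup>2 \<le> \<mu> / 2"
begin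

definition noise :: "real \<Rightarrow> real" where
  "noise \<gamma> = sqrt (2 * \<gamma> / \<beta>)"

text \<open>
Invariant under \<open>(x, v) \<mapsto> (x + v, - v)\<close>, as detailed balance requires, and an upper bound for half the
absolute change of \<open>\<beta> U\<close> between \<open>x\<close> and \<open>x + v\<close>. Writing \<open>norm (x + v)\<close> as \<open>norm x\<close> plus a difference of order
\<open>norm v\<close> shows that it is even in \<open>v\<close> up to second order.
\<close>

definition slack :: "'a \<Rightarrow> 'a \<Rightarrow> real" where
  "slack x v = \<beta> / 2 * norm v * (m + L * (norm x + norm (x + v)))"

definition acc_exp :: "'a \<Rightarrow> 'a \<Rightarrow> real" where
  "acc_exp x v = \<beta> / 2 * (U (x + v) - U x) + slack x v"

definition acc :: "'a \<Rightarrow> 'a \<Rightarrow> real" where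
  "acc x v = exp (- acc_exp x v)"

lemma noise_sq: "\<gamma> \<ge> 0 \<Longrightarrow> (noise \<gamma>)\<^sup>2 = 2 * \<gamma> / \<beta>"
  using beta_pos by (simp add: noise_def)

lemma noise_pos: "\<gamma> > 0 \<Longrightarrow> noise \<gamma> > 0"
  using beta_pos by (simp add: noise_def)

lemma noise_mono: "\<gamma> \<le> \<gamma>' \<Longrightarrow> noise \<gamma> \<le> noise \<gamma>'"
  using beta_pos by (simp add: noise_def divide_right_mono)

lemma abs_U_increment: "\<bar>U (x + v) - U x\<bar> \<le> norm v * (m + L * (norm x + norm (x + v)))"
proof -
  have "(m + L * norm (x + v)) * norm v \<le> (m + L * (norm x + norm (x + v))) * norm v"
    "(m + L * norm x) * norm v \<le> (m + L * (norm x + norm (x + v))) * norm v"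
    using L_pos by (auto intro!: mult_right_mono mult_left_mono)
  then show ?thesis
    using U_diff_le[of "x + v" x] U_diff_le[of x "x + v"] by (simp add: mult.commute abs_le_iff)
qed

lemma slack_nonneg: "slack x v \<ge> 0"
  using beta_pos L_pos m_pos by (simp add: slack_def)

lemma acc_exp_nonneg: "acc_exp x v \<ge> 0" and acc_exp_le: "acc_exp x v \<le> 2 * slack x v"
proof -
  have "\<bar>\<beta> / 2 * (U (x + v) - U x)\<bar> \<le> slack x v"
    using mult_left_mono[OF abs_U_increment, of "\<beta> / 2" x v] beta_pos
    by (simp add: slack_def abs_mult mult.assoc)
  then show "acc_exp x v \<ge> 0" "acc_exp x v \<le> 2 * slack x v" by (auto simp: acc_exp_def abs_le_iff)
qed

lemma acc_pos: "acc x v > 0" and acc_le_1: "acc x v \<le> 1"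
  using acc_exp_nonneg by (auto simp: acc_def)

lemma reject_le: "1 - acc x v \<le> 2 * slack x v"
  using exp_ge_add_one_self[of "- acc_exp x v"] acc_exp_le[of x v] by (simp add: acc_def)

text \<open>
The exponent is of order \<open>sqrt \<gamma>\<close>, so linearising the exponential costs \<open>O(\<gamma>)\<close>, which times the increment
is the tolerated \<open>O(\<gamma> powr (3/2))\<close>.
\<close>

lemma reject_approx: "\<bar>1 - acc x v - acc_exp x v\<bar> \<le> 2 * (slack x v)\<^sup>2"
proof -
  have "\<bar>1 - acc x v - acc_exp x v\<bar> \<le> (acc_exp x v)\<^sup>2 / 2"
    using exp_ge_add_one_self[of "- acc_exp x v"] exp_minus_le_quadratic[OF acc_exp_nonneg, of x v]
    by (simp add: acc_def abs_le_iff)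
  also have "\<dots> \<le> (2 * slack x v)\<^sup>2 / 2"
    using acc_exp_nonneg acc_exp_le by (intro divide_right_mono power_mono) auto
  finally show ?thesis by (simp add: power_mult_distrib)
qed

end

section \<open>Gaussian integrals of the potential\<close>

definition gauss_moment :: "'a::euclidean_space itself \<Rightarrow> nat \<Rightarrow> real" where
  "gauss_moment _ k = (\<integral>z. (1 + norm (z::'a)) ^ k \<partial>std_gaussian)"

lemma gauss_moment_nonneg [simp]: "gauss_moment TYPE('a::euclidean_space) k \<ge> 0"
  unfolding gauss_moment_def by (intro integral_nonneg_AE) auto

lemma abs_integral_std_gaussian_le:
  fixes f :: "'a::euclidean_space \<Rightarrow> real"
  assumes "f \<in> borel_measurable borel" "\<And>z. \<bar>f z\<bar> \<le> C * (1 + norm z) ^ k"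
  shows "\<bar>\<integral>z. f z \<partial>std_gaussian\<bar> \<le> C * gauss_moment TYPE('a) k"
proof -
  have "\<bar>\<integral>z. f z \<partial>std_gaussian\<bar> \<le> (\<integral>z. \<bar>f z\<bar> \<partial>std_gaussian)"
    by (rule integral_abs_bound)
  also have "\<dots> \<le> (\<integral>z. C * (1 + norm (z::'a)) ^ k \<partial>std_gaussian)"
  proof (rule integral_mono)
    show "integrable std_gaussian (\<lambda>z. \<bar>f z\<bar>)" using integrable_std_gaussian[OF assms] by simp
    show "integrable std_gaussian (\<lambda>z::'a. C * (1 + norm z) ^ k)"
      by (intro integrable_mult_right integrable_std_gaussian_power)
  qed (rule assms(2))
  finally show ?thesis by (simp add: gauss_moment_def)
qed

context langevin
begin

lemma measurable_slack [measurable (raw)]: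
  assumes [measurable]: "f \<in> borel_measurable N" "g \<in> borel_measurable N"
  shows "(\<lambda>w. slack (f w) (g w)) \<in> borel_measurable N"
  unfolding slack_def by measurable

lemma measurable_acc_exp [measurable (raw)]:
  assumes [measurable]: "f \<in> borel_measurable N" "g \<in> borel_measurable N"
  shows "(\<lambda>w. acc_exp (f w) (g w)) \<in> borel_measurable N"
  unfolding acc_exp_def by measurable

lemma measurable_acc [measurable (raw)]:
  assumes [measurable]: "f \<in> borel_measurable N" "g \<in> borel_measurable N"
  shows "(\<lambda>w. acc (f w) (g w)) \<in> borel_measurable N"
  unfolding acc_def by measurable

definition noise0 :: real where "noise0 = noise \<gamma>0"

lemma noise0_pos: "noise0 > 0"
  using gamma0_pos noise_pos by (simp add: noise0_def)

definition slack_const :: real where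
  "slack_const = \<beta> / 2 * (m + 2 * L + L * noise0)"

lemma slack_const_pos: "slack_const > 0"
  using beta_pos m_pos L_pos noise0_pos by (simp add: slack_const_def add_pos_pos)

text \<open>
The factor \<open>noise \<gamma>\<close> is what makes rejections rare for small steps.
\<close>

lemma slack_le:
  assumes "0 < \<gamma>" "\<gamma> \<le> \<gamma>0"
  shows "slack X (noise \<gamma> *\<^sub>R z) \<le> slack_const * noise \<gamma> * (1 + norm X) * (1 + norm z) ^ 2"
proof -
  define \<sigma> where "\<sigma> = noise \<gamma>"
  have s: "\<sigma> > 0" "\<sigma> \<le> noise0"
    using assms noise_pos noise_mono by (auto simp: \<sigma>_def noise0_def)
  define W where "W = 1 + norm z"
  define N where "N = 1 + norm X"
  have W: "W \<ge> 1" and N: "N \<ge> 1" by (auto simp: W_def N_def)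
  have WN: "1 \<le> W * N" "W \<le> W * N" "N \<le> W * N"
    using W N mult_mono[of 1 W 1 N] by auto
  have "norm (X + \<sigma> *\<^sub>R z) \<le> norm X + \<sigma> * norm z"
    using norm_triangle_ineq[of X "\<sigma> *\<^sub>R z"] s by simp
  moreover have "\<sigma> * norm z \<le> noise0 * W" using s by (intro mult_mono) (auto simp: W_def)
  moreover have "noise0 * W \<le> noise0 * (W * N)" using WN noise0_pos by (intro mult_left_mono) auto
  moreover have "norm X \<le> W * N" using WN by (simp add: N_def)
  ultimately have "norm X + norm (X + \<sigma> *\<^sub>R z) \<le> (2 + noise0) * (W * N)" by (simp add: algebra_simps)
  then have "L * (norm X + norm (X + \<sigma> *\<^sub>R z)) \<le> L * ((2 + noise0) * (W * N))"
    using L_pos by (intro mult_left_mono) auto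
  moreover have "m \<le> m * (W * N)" using WN m_pos by simp
  ultimately have "m + L * (norm X + norm (X + \<sigma> *\<^sub>R z)) \<le> (m + 2 * L + L * noise0) * (W * N)"
    by (simp add: algebra_simps)
  moreover have "norm (\<sigma> *\<^sub>R z) \<le> \<sigma> * W" using s by (simp add: W_def)
  ultimately have "norm (\<sigma> *\<^sub>R z) * (m + L * (norm X + norm (X + \<sigma> *\<^sub>R z)))
      \<le> (\<sigma> * W) * ((m + 2 * L + L * noise0) * (W * N))"
    using s W m_pos L_pos by (intro mult_mono) auto
  then have "\<beta> / 2 * (norm (\<sigma> *\<^sub>R z) * (m + L * (norm X + norm (X + \<sigma> *\<^sub>R z))))
      \<le> \<beta> / 2 * ((\<sigma> * W) * ((m + 2 * L + L * noise0) * (W * N)))"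
    using beta_pos by (intro mult_left_mono) auto
  then show ?thesis
    by (simp add: slack_def slack_const_def \<sigma>_def[symmetric] W_def[symmetric] N_def[symmetric]
        power2_eq_square mult_ac)
qed

text \<open>
Confinement: \<open>U\<close> is bounded below, as the integration by parts needs, and \<open>exp (- \<beta> * U x)\<close> decays like a
Gaussian.
\<close>

lemma U_quadratic_lower: "\<exists>C. \<forall>x. \<mu> / 8 * (norm x)\<^sup>2 - C \<le> U x"
proof -
  obtain f where f: "\<And>n::nat. f n \<in> grad_dom U" using dom_seq by blast
  define z where "z = f 0"
  define g where "g = grad U z"
  have "\<mu> / 8 * (norm x)\<^sup>2 - ((norm g)\<^sup>2 / \<mu> + \<mu> / 4 * (norm z)\<^sup>2 - U z) \<le> U x" for x
  proof -
    define w where "w = x - z"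
    have "U x \<ge> U z + inner g w + \<mu> / 2 * (norm w)\<^sup>2"
      using U_strong_tangent[OF f, of 0 x] by (simp add: z_def g_def w_def)
    moreover have "inner g w \<ge> - (norm g * norm w)"
      using Cauchy_Schwarz_ineq2[of g w] by (simp add: abs_le_iff)
    moreover have "0 \<le> (norm g - \<mu> / 2 * norm w)\<^sup>2 / \<mu>" using mu_pos by simp
    moreover have "(norm g - \<mu> / 2 * norm w)\<^sup>2 / \<mu> = (norm g)\<^sup>2 / \<mu> - norm g * norm w + \<mu> / 4 * (norm w)\<^sup>2"
      using mu_pos by (simp add: power2_diff power2_eq_square field_simps)
    moreover have "\<mu> / 8 * (norm x)\<^sup>2 \<le> \<mu> / 8 * (2 * (norm w)\<^sup>2 + 2 * (norm z)\<^sup>2)"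
    proof (intro mult_left_mono)
      have "norm x \<le> norm w + norm z" using norm_triangle_ineq[of w z] by (simp add: w_def)
      then have "(norm x)\<^sup>2 \<le> (norm w + norm z)\<^sup>2" by (intro power_mono) auto
      moreover have "0 \<le> (norm w - norm z)\<^sup>2" by simp
      ultimately show "(norm x)\<^sup>2 \<le> 2 * (norm w)\<^sup>2 + 2 * (norm z)\<^sup>2"
        by (simp add: power2_sum power2_diff)
    qed (use mu_pos in simp)
    ultimately show ?thesis by (simp add: algebra_simps)
  qed
  then show ?thesis by blast
qed

lemma U_growth_along_noise:
  assumes s: "s \<ge> 0"
  shows "\<bar>U (X + s *\<^sub>R z)\<bar> \<le> (\<bar>U X\<bar> + s * (m + 2 * L * norm X + L * s)) * (1 + norm z) ^ 2"
proof -
  define W where "W = 1 + norm z"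
  have W: "1 \<le> W" "norm z \<le> W" by (auto simp: W_def)
  then have W2: "1 \<le> W\<^sup>2" "W \<le> W\<^sup>2"
    using mult_mono[of 1 W 1 W] by (auto simp: power2_eq_square)
  have "norm (X + s *\<^sub>R z) \<le> norm X + s * W"
    using norm_triangle_ineq[of X "s *\<^sub>R z"] s mult_left_mono[OF W(2) s] by simp
  then have "m + L * (norm X + norm (X + s *\<^sub>R z)) \<le> m + L * (2 * norm X + s * W)"
    using L_pos by simp
  also have "\<dots> \<le> (m + 2 * L * norm X + L * s) * W"
  proof -
    have "m * 1 \<le> m * W" "L * (2 * norm X) * 1 \<le> L * (2 * norm X) * W"
      using m_pos L_pos W by (intro mult_left_mono; simp)+
    then show ?thesis by (simp add: algebra_simps)
  qed
  finally have "norm (s *\<^sub>R z) * (m + L * (norm X + norm (X + s *\<^sub>R z)))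
      \<le> (s * W) * ((m + 2 * L * norm X + L * s) * W)"
    using s W m_pos L_pos by (intro mult_mono mult_left_mono) (auto intro!: mult_left_mono)
  then have "\<bar>U (X + s *\<^sub>R z) - U X\<bar> \<le> s * (m + 2 * L * norm X + L * s) * W\<^sup>2"
    using abs_U_increment[of X "s *\<^sub>R z"] by (simp add: power2_eq_square mult_ac)
  moreover have "\<bar>U X\<bar> \<le> \<bar>U X\<bar> * W\<^sup>2" using W2 by (simp add: mult_le_cancel_left1)
  ultimately show ?thesis unfolding W_def[symmetric] by (simp add: distrib_right)
qed

lemma integrable_U_noise:
  assumes s: "s \<ge> 0"
  shows "integrable std_gaussian (\<lambda>z. U (X + s *\<^sub>R z))"
  by (rule integrable_std_gaussian[OF _ U_growth_along_noise[OF s]]) measurable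

lemma integrable_inner_mult:
  fixes f :: "'a \<Rightarrow> real"
  assumes [measurable]: "f \<in> borel_measurable borel" and b: "\<And>z. \<bar>f z\<bar> \<le> C * (1 + norm z) ^ k"
  shows "integrable std_gaussian (\<lambda>z. f z * inner D (s *\<^sub>R z))"
proof (rule integrable_std_gaussian)
  fix z :: 'a
  have "\<bar>inner D (s *\<^sub>R z)\<bar> \<le> norm D * (\<bar>s\<bar> * norm z)"
    using Cauchy_Schwarz_ineq2[of D "s *\<^sub>R z"] by simp
  also have "\<dots> \<le> norm D * \<bar>s\<bar> * (1 + norm z)"
    by (simp add: mult_left_mono mult.assoc)
  finally have "\<bar>f z * inner D (s *\<^sub>R z)\<bar> \<le> (C * (1 + norm z) ^ k) * (norm D * \<bar>s\<bar> * (1 + norm z))"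
    unfolding abs_mult by (intro mult_mono b) (auto intro: order_trans[OF abs_ge_zero b])
  then show "\<bar>f z * inner D (s *\<^sub>R z)\<bar> \<le> (C * norm D * \<bar>s\<bar>) * (1 + norm z) ^ Suc k"
    by (simp add: mult_ac)
qed measurable

text \<open>
The convex Gaussian inequality for \<open>f z = U (X + s z) - B\<close> and \<open>d = (X - Y) / s\<close>, so that the shift by \<open>d\<close>
moves \<open>X\<close> to \<open>Y\<close>. The constant \<open>B\<close> only makes \<open>f\<close> nonnegative: it is annihilated by the odd
weight and cancels in the difference.
\<close>

lemma stein_U:
  assumes s: "s > 0"
  shows "s\<^sup>2 * (\<integral>z. U (X + s *\<^sub>R z) - U (Y + s *\<^sub>R z) \<partial>std_gaussian)
       \<le> (\<integral>z. U (X + s *\<^sub>R z) * inner (X - Y) (s *\<^sub>R z) \<partial>std_gaussian)"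
proof -
  obtain C0 where C0: "\<And>x. \<mu> / 8 * (norm x)\<^sup>2 - C0 \<le> U x" using U_quadratic_lower by blast
  define B where "B = - C0"
  have B: "B \<le> U x" for x
  proof -
    have "0 \<le> \<mu> / 8 * (norm x)\<^sup>2" using mu_pos by simp
    then show ?thesis using C0[of x] by (simp add: B_def)
  qed
  define d where "d = (1 / s) *\<^sub>R (X - Y)"
  define f where "f z = U (X + s *\<^sub>R z) - B" for z
  define C where "C = \<bar>U X\<bar> + s * (m + 2 * L * norm X + L * s) + \<bar>B\<bar>"
  have sd: "s *\<^sub>R d = X - Y" using s by (simp add: d_def)
  have cv: "convex_on UNIV f"
  proof (rule convex_onI)
    fix t :: real and x y assume t: "0 < t" "t < 1"
    have "X + s *\<^sub>R ((1 - t) *\<^sub>R x + t *\<^sub>R y) = (1 - t) *\<^sub>R (X + s *\<^sub>R x) + t *\<^sub>R (X + s *\<^sub>R y)"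
      by (simp add: algebra_simps)
    then show "f ((1 - t) *\<^sub>R x + t *\<^sub>R y) \<le> (1 - t) * f x + t * f y"
      using convex_onD[OF cvx, of t "X + s *\<^sub>R x" "X + s *\<^sub>R y"] t by (simp add: f_def algebra_simps)
  qed simp
  have gr: "f z \<le> C * (1 + norm z) ^ 2" for z
  proof -
    have "\<bar>B\<bar> \<le> \<bar>B\<bar> * (1 + norm z) ^ 2" by (simp add: mult_le_cancel_left1)
    then show ?thesis using U_growth_along_noise[of s X z] s by (simp add: f_def C_def algebra_simps abs_le_iff)
  qed
  have st: "(\<integral>z. f z - f (z - d) \<partial>std_gaussian) \<le> (\<integral>z. f z * inner z d \<partial>std_gaussian)"
    by (rule gaussian_stein_convex_nonneg[OF cv _ gr]) (simp add: f_def B)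
  have e1: "f z - f (z - d) = U (X + s *\<^sub>R z) - U (Y + s *\<^sub>R z)" for z
  proof -
    have "X + s *\<^sub>R (z - d) = Y + s *\<^sub>R z" using sd by (simp add: scaleR_diff_right)
    then show ?thesis by (simp add: f_def)
  qed
  have "(\<integral>z. U (X + s *\<^sub>R z) * inner (X - Y) (s *\<^sub>R z) \<partial>std_gaussian)
     = (\<integral>z. s\<^sup>2 * (f z * inner z d) + B * inner (X - Y) (s *\<^sub>R z) \<partial>std_gaussian)"
    by (simp add: f_def sd[symmetric] algebra_simps power2_eq_square inner_commute)
  also have "\<dots> = s\<^sup>2 * (\<integral>z. f z * inner z d \<partial>std_gaussian) + (\<integral>z. B * inner (X - Y) (s *\<^sub>R z) \<partial>std_gaussian)"
  proof (subst Bochner_Integration.integral_add)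
    have "f \<in> borel_measurable borel" unfolding f_def by measurable
    from integrable_inner_mult[OF this, of C 2 d 1] gr B
    have "integrable std_gaussian (\<lambda>z. f z * inner z d)" by (simp add: f_def inner_commute)
    then show "integrable std_gaussian (\<lambda>z. s\<^sup>2 * (f z * inner z d))" by simp
    show "integrable std_gaussian (\<lambda>z. B * inner (X - Y) (s *\<^sub>R z))"
      by (rule integrable_inner_mult[of "\<lambda>_. B" "\<bar>B\<bar>" 0]) auto
  qed simp
  also have "(\<integral>z. B * inner (X - Y) (s *\<^sub>R z) \<partial>std_gaussian) = 0"
    by (rule integral_std_gaussian_odd) auto
  finally have "(\<integral>z. U (X + s *\<^sub>R z) * inner (X - Y) (s *\<^sub>R z) \<partial>std_gaussian)
     = s\<^sup>2 * (\<integral>z. f z * inner z d \<partial>std_gaussian)" by simp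
  then show ?thesis using mult_left_mono[OF st, of "s\<^sup>2"] unfolding e1 by simp
qed

end

lemma measure_std_gaussian_UNIV [simp]: "measure std_gaussian (UNIV :: 'a::euclidean_space set) = 1"
  using std_gaussian.prob_space[where 'a='a] by simp

context langevin
begin

section \<open>Mean displacement of the invariant chain\<close>

text \<open>
The three summands bound, in this order, the variation of \<open>U\<close> under the noise at \<open>Y\<close>, the linearisation error of
the acceptance probability, and the part of the slack that is not even in the increment.
\<close>

definition drift_const :: "'a itself \<Rightarrow> real" where
  "drift_const _ = \<beta> / 2 * (m + L + L * noise0) * gauss_moment TYPE('a) 2 + 2 * slack_const\<^sup>2 * gauss_moment TYPE('a) 5 + \<beta> / 2 * L * gauss_moment TYPE('a) 3"

lemma abs_inner_noise_le:
  assumes "s \<ge> 0"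
  shows "\<bar>inner D (s *\<^sub>R z)\<bar> \<le> (norm D * s) * (1 + norm z)"
proof -
  have "\<bar>inner D (s *\<^sub>R z)\<bar> \<le> norm D * (s * norm z)"
    using Cauchy_Schwarz_ineq2[of D "s *\<^sub>R z"] assms by simp
  also have "\<dots> \<le> norm D * s * (1 + norm z)"
    using assms by (simp add: mult_left_mono mult.assoc)
  finally show ?thesis .
qed

text \<open>
Strong convexity at \<open>Y\<close> bounds \<open>U (X + v)\<close> from below, the Lipschitz bound controls \<open>U (Y + v) - U Y\<close>, and
the terms linear in \<open>v\<close> have mean zero. The error is linear in \<open>norm Y\<close>; a quadratic error could not be absorbed by
the contraction for step sizes up to \<open>\<gamma>0\<close>.
\<close>

lemma potential_gap_integral:
  assumes g: "0 < \<gamma>" "\<gamma> \<le> \<gamma>0" and Y: "Y \<in> grad_dom U"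
  shows "inner (grad U Y) (X - Y) + \<mu> / 2 * (norm (X - Y))\<^sup>2 - noise \<gamma> * (m + L * norm Y + L * noise0) * gauss_moment TYPE('a) 2
     \<le> (\<integral>z. U (X + noise \<gamma> *\<^sub>R z) - U (Y + noise \<gamma> *\<^sub>R z) \<partial>std_gaussian)"
proof -
  define \<sigma> where "\<sigma> = noise \<gamma>"
  define D where "D = X - Y"
  define q where "q = inner (grad U Y) D + \<mu> / 2 * (norm D)\<^sup>2"
  define R where "R = \<sigma> * (m + L * norm Y + L * noise0)"
  have s: "\<sigma> > 0" "\<sigma> \<le> noise0"
    using g noise_pos noise_mono by (auto simp: \<sigma>_def noise0_def)
  have R: "R \<ge> 0" using s m_pos L_pos noise0_pos by (simp add: R_def)
  have pt: "q + inner (grad U Y + \<mu> *\<^sub>R D) (\<sigma> *\<^sub>R z) - R * (1 + norm z) ^ 2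
     \<le> U (X + \<sigma> *\<^sub>R z) - U (Y + \<sigma> *\<^sub>R z)" for z
  proof -
    define v where "v = \<sigma> *\<^sub>R z"
    define W where "W = 1 + norm z"
    have W: "W \<ge> 1" by (simp add: W_def)
    have nv: "norm v \<le> \<sigma> * W" "norm v \<le> noise0 * W"
      using s mult_mono[OF s(2), of "norm z" W] by (auto simp: v_def W_def)
    have Xv: "X + v - Y = D + v" by (simp add: D_def)
    have 1: "U (X + v) \<ge> U Y + inner (grad U Y) (D + v) + \<mu> / 2 * (norm (D + v))\<^sup>2"
      using U_strong_tangent[OF Y, of "X + v"] unfolding Xv .
    have "(norm (D + v))\<^sup>2 = (norm D)\<^sup>2 + 2 * inner D v + (norm v)\<^sup>2"
      by (simp add: power2_norm_eq_inner inner_add inner_commute algebra_simps)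
    then have 2: "\<mu> / 2 * (norm (D + v))\<^sup>2 \<ge> \<mu> / 2 * ((norm D)\<^sup>2 + 2 * inner D v)"
      using mu_pos by (intro mult_left_mono) auto
    have "U (Y + v) - U Y \<le> (m + L * norm (Y + v)) * norm v"
      using U_diff_le[of "Y + v" Y] by simp
    also have "\<dots> \<le> ((m + L * norm Y + L * noise0) * W) * (\<sigma> * W)"
    proof (intro mult_mono nv)
      have "L * norm (Y + v) \<le> L * (norm Y + noise0 * W)"
        using L_pos norm_triangle_ineq[of Y v] nv(2) by (intro mult_left_mono) auto
      moreover have "m * 1 \<le> m * W" "L * norm Y * 1 \<le> L * norm Y * W"
        using m_pos L_pos W by (intro mult_left_mono; simp)+
      ultimately show "m + L * norm (Y + v) \<le> (m + L * norm Y + L * noise0) * W"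
        by (simp add: algebra_simps)
    qed (use m_pos L_pos noise0_pos W in auto)
    finally have 3: "U (Y + v) - U Y \<le> R * W ^ 2" by (simp add: R_def power2_eq_square mult_ac)
    have "q + inner (grad U Y + \<mu> *\<^sub>R D) v = inner (grad U Y) (D + v) + \<mu> / 2 * ((norm D)\<^sup>2 + 2 * inner D v)"
      by (simp add: q_def inner_add algebra_simps)
    then have "q + inner (grad U Y + \<mu> *\<^sub>R D) v - R * W ^ 2 \<le> U (X + v) - U (Y + v)"
      using 1 2 3 by linarith
    then show ?thesis by (simp add: v_def W_def)
  qed
  have int1: "integrable std_gaussian (\<lambda>z. inner (grad U Y + \<mu> *\<^sub>R D) (\<sigma> *\<^sub>R z))"
    using integrable_inner_mult[of "\<lambda>_. 1" 1 0] by simp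
  have int2: "integrable std_gaussian (\<lambda>z::'a. R * (1 + norm z) ^ 2)"
    by (intro integrable_mult_right integrable_std_gaussian_power)
  have "(\<integral>z. q + inner (grad U Y + \<mu> *\<^sub>R D) (\<sigma> *\<^sub>R z) - R * (1 + norm z) ^ 2 \<partial>std_gaussian)
     \<le> (\<integral>z. U (X + \<sigma> *\<^sub>R z) - U (Y + \<sigma> *\<^sub>R z) \<partial>std_gaussian)"
    using s int1 int2 by (intro integral_mono Bochner_Integration.integrable_diff integrable_U_noise pt
         Bochner_Integration.integrable_add) auto
  moreover have "(\<integral>z. q + inner (grad U Y + \<mu> *\<^sub>R D) (\<sigma> *\<^sub>R z) - R * (1 + norm z) ^ 2 \<partial>std_gaussian)
     = q + (\<integral>z. inner (grad U Y + \<mu> *\<^sub>R D) (\<sigma> *\<^sub>R z) \<partial>std_gaussian) - R * gauss_moment TYPE('a) 2"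
    using int1 int2 by (simp add: gauss_moment_def)
  moreover have "(\<integral>z. inner (grad U Y + \<mu> *\<^sub>R D) (\<sigma> *\<^sub>R z) \<partial>std_gaussian) = 0"
    by (rule integral_std_gaussian_odd) auto
  ultimately have "q - R * gauss_moment TYPE('a) 2
     \<le> (\<integral>z. U (X + \<sigma> *\<^sub>R z) - U (Y + \<sigma> *\<^sub>R z) \<partial>std_gaussian)" by linarith
  then show ?thesis by (simp add: q_def R_def D_def \<sigma>_def)
qed

text \<open>
The rejected increment \<open>(1 - acc X v) v\<close> has, in the direction \<open>D = X - Y\<close>, a mean of at least the one that a gradient step
with the gradient at \<open>Y\<close> would have, plus a strong convexity gain. Linearising
\<open>1 - acc\<close> leaves the potential difference, which is handled by \<open>stein_U\<close> and
\<open>potential_gap_integral\<close>, and the slack, whose even part cancels against the odd weight \<open>inner D v\<close>.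
\<close>

lemma reject_drift:
  assumes g: "0 < \<gamma>" "\<gamma> \<le> \<gamma>0" and Y: "Y \<in> grad_dom U"
  shows "\<gamma> * (inner (grad U Y) (X - Y) + \<mu> / 2 * (norm (X - Y))\<^sup>2)
       - drift_const TYPE('a) * noise \<gamma> ^ 3 * (1 + norm X)\<^sup>2 * (1 + norm (X - Y))
     \<le> (\<integral>z. (1 - acc X (noise \<gamma> *\<^sub>R z)) * inner (X - Y) (noise \<gamma> *\<^sub>R z) \<partial>std_gaussian)"
proof -
  define \<sigma> where "\<sigma> = noise \<gamma>"
  define D where "D = X - Y"
  define N where "N = 1 + norm X"
  define G :: "('a \<Rightarrow> real) \<Rightarrow> real" where "G f = (\<integral>z. f z * inner D (\<sigma> *\<^sub>R z) \<partial>std_gaussian)" for f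
  have s: "\<sigma> > 0" "\<sigma> \<le> noise0"
    using g noise_pos noise_mono by (auto simp: \<sigma>_def noise0_def)
  have N: "N \<ge> 1" by (simp add: N_def)
  have sq: "\<beta> / 2 * \<sigma>\<^sup>2 = \<gamma>"
    using g beta_pos by (simp add: \<sigma>_def noise_sq)
  note inn = abs_inner_noise_le[OF less_imp_le[OF s(1)]]
  have slk: "slack X (\<sigma> *\<^sub>R z) \<le> slack_const * \<sigma> * N * (1 + norm z) ^ 2" for z
    using slack_le[OF g] by (simp add: \<sigma>_def N_def)
  have int_U: "integrable std_gaussian (\<lambda>z. U (X + \<sigma> *\<^sub>R z) * inner D (\<sigma> *\<^sub>R z))"
    by (rule integrable_inner_mult[OF _ U_growth_along_noise]) (use s in auto)
  have int_0: "integrable std_gaussian (\<lambda>z. inner D (\<sigma> *\<^sub>R z))"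
    using integrable_inner_mult[of "\<lambda>_. 1" 1 0] by simp
  have int_sl: "integrable std_gaussian (\<lambda>z. slack X (\<sigma> *\<^sub>R z) * inner D (\<sigma> *\<^sub>R z))"
    using slk slack_nonneg by (intro integrable_inner_mult[of _ "slack_const * \<sigma> * N" 2]) auto
  have int_e: "integrable std_gaussian (\<lambda>z. (1 - acc X (\<sigma> *\<^sub>R z)) * inner D (\<sigma> *\<^sub>R z))"
    using acc_le_1 less_imp_le[OF acc_pos]
    by (intro integrable_inner_mult[of _ 1 0]) (auto simp: abs_le_iff add_increasing2)
  have zero: "G (\<lambda>_. c) = 0" for c
    unfolding G_def by (rule integral_std_gaussian_odd) auto
  have Gexp: "G (\<lambda>z. acc_exp X (\<sigma> *\<^sub>R z)) = \<beta> / 2 * G (\<lambda>z. U (X + \<sigma> *\<^sub>R z)) + G (\<lambda>z. slack X (\<sigma> *\<^sub>R z))"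
  proof -
    have "G (\<lambda>z. acc_exp X (\<sigma> *\<^sub>R z)) = (\<integral>z. \<beta> / 2 * (U (X + \<sigma> *\<^sub>R z) * inner D (\<sigma> *\<^sub>R z))
         - \<beta> / 2 * U X * inner D (\<sigma> *\<^sub>R z) + slack X (\<sigma> *\<^sub>R z) * inner D (\<sigma> *\<^sub>R z) \<partial>std_gaussian)"
      unfolding G_def acc_exp_def by (intro Bochner_Integration.integral_cong refl) (simp add: algebra_simps)
    also have "\<dots> = (\<integral>z. \<beta> / 2 * (U (X + \<sigma> *\<^sub>R z) * inner D (\<sigma> *\<^sub>R z)) \<partial>std_gaussian)
         - (\<integral>z. \<beta> / 2 * U X * inner D (\<sigma> *\<^sub>R z) \<partial>std_gaussian)
         + (\<integral>z. slack X (\<sigma> *\<^sub>R z) * inner D (\<sigma> *\<^sub>R z) \<partial>std_gaussian)"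
      by (subst Bochner_Integration.integral_add Bochner_Integration.integral_diff;
          (intro Bochner_Integration.integrable_diff integrable_mult_right int_U int_0 int_sl)?)+ simp
    also have "(\<integral>z. \<beta> / 2 * U X * inner D (\<sigma> *\<^sub>R z) \<partial>std_gaussian) = 0"
      using zero[of "\<beta> / 2 * U X"] by (simp add: G_def)
    finally show ?thesis by (simp add: G_def)
  qed
  have GU: "\<beta> / 2 * G (\<lambda>z. U (X + \<sigma> *\<^sub>R z))
     \<ge> \<gamma> * (inner (grad U Y) D + \<mu> / 2 * (norm D)\<^sup>2) - \<gamma> * (\<sigma> * (m + L * norm Y + L * noise0) * gauss_moment TYPE('a) 2)"
  proof -
    have "\<gamma> * (inner (grad U Y) D + \<mu> / 2 * (norm D)\<^sup>2 - \<sigma> * (m + L * norm Y + L * noise0) * gauss_moment TYPE('a) 2)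
       \<le> \<gamma> * (\<integral>z. U (X + \<sigma> *\<^sub>R z) - U (Y + \<sigma> *\<^sub>R z) \<partial>std_gaussian)"
      using potential_gap_integral[OF g Y, of X] g by (intro mult_left_mono) (auto simp: D_def \<sigma>_def)
    also have "\<dots> = \<beta> / 2 * (\<sigma>\<^sup>2 * (\<integral>z. U (X + \<sigma> *\<^sub>R z) - U (Y + \<sigma> *\<^sub>R z) \<partial>std_gaussian))"
      by (simp only: sq[symmetric] mult.assoc)
    also have "\<dots> \<le> \<beta> / 2 * G (\<lambda>z. U (X + \<sigma> *\<^sub>R z))"
      using stein_U[OF s(1), of X Y] beta_pos by (intro mult_left_mono) (auto simp: G_def D_def)
    finally show ?thesis by (simp add: right_diff_distrib)
  qed
  have Gsl: "\<bar>G (\<lambda>z. slack X (\<sigma> *\<^sub>R z))\<bar> \<le> \<beta> / 2 * L * norm D * \<sigma> ^ 3 * gauss_moment TYPE('a) 3"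
  proof -
    \<comment> \<open>the even part and the remainder of second order\<close>
    define f1 where "f1 z = \<beta> / 2 * norm (\<sigma> *\<^sub>R z) * (m + 2 * L * norm X)" for z :: 'a
    define f2 where "f2 z = \<beta> / 2 * norm (\<sigma> *\<^sub>R z) * (L * (norm (X + \<sigma> *\<^sub>R z) - norm X))" for z :: 'a
    have [measurable]: "f1 \<in> borel_measurable borel" "f2 \<in> borel_measurable borel"
      unfolding f1_def f2_def by measurable
    have f2: "\<bar>f2 z\<bar> \<le> (\<beta> / 2 * L * \<sigma>\<^sup>2) * (1 + norm z)\<^sup>2" for z
    proof -
      have "\<bar>norm (X + \<sigma> *\<^sub>R z) - norm X\<bar> \<le> norm (\<sigma> *\<^sub>R z)"
        using norm_triangle_ineq3[of "X + \<sigma> *\<^sub>R z" X] by simp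
      then have "\<bar>f2 z\<bar> \<le> \<beta> / 2 * norm (\<sigma> *\<^sub>R z) * (L * norm (\<sigma> *\<^sub>R z))"
        unfolding f2_def abs_mult using beta_pos L_pos by (intro mult_mono) auto
      also have "\<dots> = \<beta> / 2 * L * \<sigma>\<^sup>2 * (norm z)\<^sup>2" by (simp add: power2_eq_square)
      also have "\<dots> \<le> (\<beta> / 2 * L * \<sigma>\<^sup>2) * (1 + norm z)\<^sup>2"
        using beta_pos L_pos by (intro mult_left_mono power_mono) auto
      finally show ?thesis .
    qed
    have i2: "integrable std_gaussian (\<lambda>z. f2 z * inner D (\<sigma> *\<^sub>R z))"
      by (rule integrable_inner_mult[OF _ f2]) measurable
    have i1: "integrable std_gaussian (\<lambda>z. f1 z * inner D (\<sigma> *\<^sub>R z))"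
    proof (intro integrable_inner_mult)
      fix z
      have c: "0 \<le> \<beta> / 2 * \<sigma> * (m + 2 * L * norm X)" using s beta_pos m_pos L_pos by simp
      have eq: "f1 z = (\<beta> / 2 * \<sigma> * (m + 2 * L * norm X)) * norm z"
        using s by (simp add: f1_def mult_ac)
      have "\<bar>f1 z\<bar> = (\<beta> / 2 * \<sigma> * (m + 2 * L * norm X)) * norm z"
        unfolding eq by (rule abs_of_nonneg[OF mult_nonneg_nonneg[OF c norm_ge_zero]])
      also have "\<dots> \<le> (\<beta> / 2 * \<sigma> * (m + 2 * L * norm X)) * (1 + norm z) ^ 1"
        by (intro mult_left_mono c) simp
      finally show "\<bar>f1 z\<bar> \<le> (\<beta> / 2 * \<sigma> * (m + 2 * L * norm X)) * (1 + norm z) ^ 1" .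
    qed measurable
    have "G (\<lambda>z. slack X (\<sigma> *\<^sub>R z)) = (\<integral>z. f1 z * inner D (\<sigma> *\<^sub>R z) + f2 z * inner D (\<sigma> *\<^sub>R z) \<partial>std_gaussian)"
      unfolding G_def slack_def f1_def f2_def
      by (intro Bochner_Integration.integral_cong refl) (simp add: algebra_simps)
    also have "\<dots> = (\<integral>z. f1 z * inner D (\<sigma> *\<^sub>R z) \<partial>std_gaussian) + (\<integral>z. f2 z * inner D (\<sigma> *\<^sub>R z) \<partial>std_gaussian)"
      by (rule Bochner_Integration.integral_add[OF i1 i2])
    also have "(\<integral>z. f1 z * inner D (\<sigma> *\<^sub>R z) \<partial>std_gaussian) = 0"
      by (rule integral_std_gaussian_odd) (auto simp: f1_def)
    finally have e: "G (\<lambda>z. slack X (\<sigma> *\<^sub>R z)) = (\<integral>z. f2 z * inner D (\<sigma> *\<^sub>R z) \<partial>std_gaussian)" by simp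
    show ?thesis unfolding e
    proof (rule order_trans[OF abs_integral_std_gaussian_le[where C="\<beta> / 2 * L * norm D * \<sigma> ^ 3" and k=3]])
      fix z
      have "\<bar>f2 z * inner D (\<sigma> *\<^sub>R z)\<bar> \<le> ((\<beta> / 2 * L * \<sigma>\<^sup>2) * (1 + norm z)\<^sup>2) * ((norm D * \<sigma>) * (1 + norm z))"
        unfolding abs_mult using f2 inn by (intro mult_mono order_trans[OF abs_ge_zero f2]) auto
      then show "\<bar>f2 z * inner D (\<sigma> *\<^sub>R z)\<bar> \<le> \<beta> / 2 * L * norm D * \<sigma> ^ 3 * (1 + norm z) ^ 3"
        by (simp add: power2_eq_square power3_eq_cube mult_ac)
    qed auto
  qed
  have Ge: "\<bar>G (\<lambda>z. 1 - acc X (\<sigma> *\<^sub>R z)) - G (\<lambda>z. acc_exp X (\<sigma> *\<^sub>R z))\<bar>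
     \<le> 2 * slack_const\<^sup>2 * \<sigma> ^ 3 * N\<^sup>2 * norm D * gauss_moment TYPE('a) 5"
  proof -
    have int_x: "integrable std_gaussian (\<lambda>z. acc_exp X (\<sigma> *\<^sub>R z) * inner D (\<sigma> *\<^sub>R z))"
    proof (rule integrable_inner_mult[of _ "2 * slack_const * \<sigma> * N" 2])
      show "\<bar>acc_exp X (\<sigma> *\<^sub>R z)\<bar> \<le> 2 * slack_const * \<sigma> * N * (1 + norm z)\<^sup>2" for z
        using acc_exp_nonneg[of X "\<sigma> *\<^sub>R z"] acc_exp_le[of X "\<sigma> *\<^sub>R z"] slk[of z] by (simp add: mult_ac)
    qed measurable
    have "G (\<lambda>z. 1 - acc X (\<sigma> *\<^sub>R z)) - G (\<lambda>z. acc_exp X (\<sigma> *\<^sub>R z))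
      = (\<integral>z. (1 - acc X (\<sigma> *\<^sub>R z) - acc_exp X (\<sigma> *\<^sub>R z)) * inner D (\<sigma> *\<^sub>R z) \<partial>std_gaussian)"
      unfolding G_def Bochner_Integration.integral_diff[OF int_e int_x, symmetric]
      by (simp add: left_diff_distrib)
    also have "\<bar>\<dots>\<bar> \<le> 2 * slack_const\<^sup>2 * \<sigma> ^ 3 * N\<^sup>2 * norm D * gauss_moment TYPE('a) 5"
    proof (rule abs_integral_std_gaussian_le)
      fix z
      have "\<bar>1 - acc X (\<sigma> *\<^sub>R z) - acc_exp X (\<sigma> *\<^sub>R z)\<bar> \<le> 2 * (slack X (\<sigma> *\<^sub>R z))\<^sup>2"
        by (rule reject_approx)
      also have "\<dots> \<le> 2 * (slack_const * \<sigma> * N * (1 + norm z) ^ 2)\<^sup>2"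
        using slk slack_nonneg by (intro mult_left_mono power_mono) auto
      finally have "\<bar>(1 - acc X (\<sigma> *\<^sub>R z) - acc_exp X (\<sigma> *\<^sub>R z)) * inner D (\<sigma> *\<^sub>R z)\<bar>
         \<le> (2 * (slack_const * \<sigma> * N * (1 + norm z) ^ 2)\<^sup>2) * ((norm D * \<sigma>) * (1 + norm z))"
        unfolding abs_mult by (intro mult_mono inn) auto
      also have "\<dots> = 2 * slack_const\<^sup>2 * \<sigma> ^ 3 * N\<^sup>2 * norm D * (1 + norm z) ^ 5"
        by (simp add: power_mult_distrib eval_nat_numeral mult_ac)
      finally show "\<bar>(1 - acc X (\<sigma> *\<^sub>R z) - acc_exp X (\<sigma> *\<^sub>R z)) * inner D (\<sigma> *\<^sub>R z)\<bar>
         \<le> 2 * slack_const\<^sup>2 * \<sigma> ^ 3 * N\<^sup>2 * norm D * (1 + norm z) ^ 5" .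
    qed measurable
    finally show ?thesis .
  qed
  define H where "H = \<sigma> ^ 3 * (N\<^sup>2 * (1 + norm D))"
  have N2: "N \<le> N\<^sup>2" "1 \<le> N\<^sup>2" using N by (auto simp: power2_eq_square mult_le_cancel_left1 mult_ge1_I)
  have s3: "\<sigma> ^ 3 \<ge> 0" using s by simp
  have "norm D \<le> N\<^sup>2 * (1 + norm D)" using mult_mono[OF N2(2), of "norm D" "1 + norm D"] by simp
  then have h1: "\<sigma> ^ 3 * norm D \<le> H" unfolding H_def by (rule mult_left_mono[OF _ s3])
  have h2: "\<sigma> ^ 3 * (N\<^sup>2 * norm D) \<le> H"
    unfolding H_def by (intro mult_left_mono s3) auto
  have h3: "\<gamma> * (\<sigma> * (m + L * norm Y + L * noise0) * gauss_moment TYPE('a) 2) \<le> \<beta> / 2 * (m + L + L * noise0) * gauss_moment TYPE('a) 2 * H"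
  proof -
    have "norm Y \<le> norm X + norm D" using norm_triangle_ineq4[of X D] by (simp add: D_def)
    also have "\<dots> \<le> N\<^sup>2 * (1 + norm D)"
    proof -
      have "N * 1 + 1 * norm D \<le> N\<^sup>2 * 1 + N\<^sup>2 * norm D" using N2 by (intro add_mono mult_mono) auto
      then show ?thesis by (simp add: N_def algebra_simps)
    qed
    finally have "L * norm Y \<le> L * (N\<^sup>2 * (1 + norm D))" using L_pos by (intro mult_left_mono) auto
    moreover have one: "1 \<le> N\<^sup>2 * (1 + norm D)" using mult_mono[OF N2(2), of 1 "1 + norm D"] by simp
    have "(m + L * noise0) * 1 \<le> (m + L * noise0) * (N\<^sup>2 * (1 + norm D))"
      using m_pos L_pos noise0_pos by (intro mult_left_mono one) auto
    ultimately have "m + L * norm Y + L * noise0 \<le> (m + L + L * noise0) * (N\<^sup>2 * (1 + norm D))"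
      by (simp add: algebra_simps)
    then have "(\<beta> / 2 * \<sigma> ^ 3 * gauss_moment TYPE('a) 2) * (m + L * norm Y + L * noise0)
       \<le> (\<beta> / 2 * \<sigma> ^ 3 * gauss_moment TYPE('a) 2) * ((m + L + L * noise0) * (N\<^sup>2 * (1 + norm D)))"
      using beta_pos s3 by (intro mult_left_mono) auto
    then show ?thesis by (simp add: sq[symmetric] H_def power2_eq_square power3_eq_cube mult_ac)
  qed
  have h1': "\<beta> / 2 * L * norm D * \<sigma> ^ 3 * gauss_moment TYPE('a) 3 \<le> \<beta> / 2 * L * gauss_moment TYPE('a) 3 * H"
    using mult_left_mono[OF h1, of "\<beta> / 2 * L * gauss_moment TYPE('a) 3"] beta_pos L_pos by (simp add: mult_ac)
  have h2': "2 * slack_const\<^sup>2 * \<sigma> ^ 3 * N\<^sup>2 * norm D * gauss_moment TYPE('a) 5 \<le> 2 * slack_const\<^sup>2 * gauss_moment TYPE('a) 5 * H"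
    using mult_left_mono[OF h2, of "2 * slack_const\<^sup>2 * gauss_moment TYPE('a) 5"] by (simp add: mult_ac)
  have dc: "drift_const TYPE('a) * \<sigma> ^ 3 * N\<^sup>2 * (1 + norm D) = \<beta> / 2 * (m + L + L * noise0) * gauss_moment TYPE('a) 2 * H
       + 2 * slack_const\<^sup>2 * gauss_moment TYPE('a) 5 * H + \<beta> / 2 * L * gauss_moment TYPE('a) 3 * H"
    by (simp only: drift_const_def H_def mult.assoc distrib_right)
  have "\<gamma> * (inner (grad U Y) D + \<mu> / 2 * (norm D)\<^sup>2) - drift_const TYPE('a) * \<sigma> ^ 3 * N\<^sup>2 * (1 + norm D)
     \<le> G (\<lambda>z. 1 - acc X (\<sigma> *\<^sub>R z))"
    using Gexp GU Gsl Ge h3 h1' h2' unfolding dc abs_le_iff by linarith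
  then show ?thesis by (simp only: G_def D_def \<sigma>_def N_def)
qed

end

section \<open>Contraction of even powers in one step\<close>

text \<open>
Pure bookkeeping for the squared distance \<open>d ^ 2\<close>: the term \<open>\<gamma>\<^sup>2 * g\<^sup>2\<close> consumes three quarters of the
contraction because \<open>\<gamma> * L\<^sup>2 \<le> \<mu> / 2\<close>, and the error linear in \<open>d\<close> consumes another eighth by the inequality
between geometric and arithmetic mean.
\<close>

lemma drift_quadratic_bound:
  fixes d N \<sigma> \<sigma>0 \<gamma> \<mu> \<beta> L l K3 g S :: real
  assumes pos: "d \<ge> 0" "N \<ge> 1" "0 < \<sigma>" "\<sigma> \<le> \<sigma>0" "0 < \<mu>" "0 < \<beta>" "0 < L" "0 \<le> l" "0 \<le> K3" "0 \<le> g"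
    and sq: "\<gamma> = \<beta> / 2 * \<sigma>\<^sup>2" and gL: "\<gamma> * L\<^sup>2 \<le> \<mu> / 2"
    and g: "g \<le> l * N + L * d"
    and S: "S \<le> d\<^sup>2 - \<gamma> * \<mu> * d\<^sup>2 + \<gamma>\<^sup>2 * g\<^sup>2 + K3 * \<sigma> ^ 3 * N\<^sup>2 * (1 + d)"
  shows "S \<le> (1 - \<gamma> * \<mu> / 8) * d\<^sup>2 + (K3 + 3 / 4 * \<beta>\<^sup>2 * \<sigma>0 * l\<^sup>2 + 4 * \<sigma>0 / (\<beta> * \<mu>) * K3\<^sup>2) * \<sigma> ^ 3 * N ^ 4"
proof -
  have gam: "\<gamma> > 0" using pos by (simp add: sq)
  have N24: "N\<^sup>2 \<le> N ^ 4" using pos by (intro power_increasing) auto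
  have N4: "N ^ 4 \<ge> 0" using pos by simp
  have s4: "\<sigma> ^ 4 \<le> \<sigma>0 * \<sigma> ^ 3"
    using pos mult_right_mono[of \<sigma> \<sigma>0 "\<sigma> ^ 3"] by (simp add: eval_nat_numeral)
  have "g\<^sup>2 \<le> (l * N + L * d)\<^sup>2" using pos g by (intro power_mono) auto
  \<comment> \<open>the weight \<open>3 / 2\<close> leaves a quarter of the contraction for the other errors\<close>
  also have "\<dots> \<le> 3 * (l * N)\<^sup>2 + 3 / 2 * (L * d)\<^sup>2"
  proof -
    have "0 \<le> (2 * (l * N) - L * d)\<^sup>2 / 2" by simp
    also have "\<dots> = 3 * (l * N)\<^sup>2 + 3 / 2 * (L * d)\<^sup>2 - (l * N + L * d)\<^sup>2"
      by (simp add: power2_eq_square field_simps)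
    finally show ?thesis by simp
  qed
  finally have "\<gamma>\<^sup>2 * g\<^sup>2 \<le> \<gamma>\<^sup>2 * (3 * (l * N)\<^sup>2 + 3 / 2 * (L * d)\<^sup>2)" by (intro mult_left_mono) auto
  also have "\<dots> = 3 / 4 * \<beta>\<^sup>2 * l\<^sup>2 * N\<^sup>2 * \<sigma> ^ 4 + 3 / 2 * \<gamma> * d\<^sup>2 * (\<gamma> * L\<^sup>2)"
    by (simp add: sq power2_eq_square eval_nat_numeral algebra_simps)
  also have "\<dots> \<le> 3 / 4 * \<beta>\<^sup>2 * l\<^sup>2 * N ^ 4 * (\<sigma>0 * \<sigma> ^ 3) + 3 / 2 * \<gamma> * d\<^sup>2 * (\<mu> / 2)"
    using gL gam pos N24 by (intro add_mono mult_mono mult_left_mono s4) auto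
  finally have 1: "\<gamma>\<^sup>2 * g\<^sup>2 \<le> 3 / 4 * \<beta>\<^sup>2 * \<sigma>0 * l\<^sup>2 * \<sigma> ^ 3 * N ^ 4 + 3 / 4 * (\<gamma> * \<mu> * d\<^sup>2)"
    by (simp add: mult_ac)
  have 2: "K3 * \<sigma> ^ 3 * N\<^sup>2 \<le> K3 * \<sigma> ^ 3 * N ^ 4" using pos N24 by (intro mult_left_mono) auto
  have 3: "K3 * \<sigma> ^ 3 * N\<^sup>2 * d \<le> \<gamma> * \<mu> / 8 * d\<^sup>2 + 4 * \<sigma>0 / (\<beta> * \<mu>) * K3\<^sup>2 * \<sigma> ^ 3 * N ^ 4"
  proof -
    define y where "y = K3 * \<sigma> ^ 3 * N\<^sup>2"
    have "0 \<le> (\<gamma> * \<mu> * d / 4 - y)\<^sup>2 * (2 / (\<gamma> * \<mu>))" using gam pos by (intro mult_nonneg_nonneg) auto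
    also have "\<dots> = \<gamma> * \<mu> / 8 * d\<^sup>2 + 2 / (\<gamma> * \<mu>) * y\<^sup>2 - y * d"
      using gam pos by (simp add: power2_eq_square field_simps)
    also have "2 / (\<gamma> * \<mu>) * y\<^sup>2 = 4 / (\<beta> * \<mu>) * K3\<^sup>2 * N ^ 4 * \<sigma> ^ 4"
      using pos by (simp add: sq y_def field_simps eval_nat_numeral)
    also have "\<dots> \<le> 4 / (\<beta> * \<mu>) * K3\<^sup>2 * N ^ 4 * (\<sigma>0 * \<sigma> ^ 3)"
      using pos N4 by (intro mult_left_mono s4) auto
    finally show ?thesis by (simp add: y_def mult_ac)
  qed
  have "K3 * \<sigma> ^ 3 * N\<^sup>2 * (1 + d) = K3 * \<sigma> ^ 3 * N\<^sup>2 + K3 * \<sigma> ^ 3 * N\<^sup>2 * d" by (simp add: algebra_simps)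
  then have "S \<le> d\<^sup>2 - \<gamma> * \<mu> * d\<^sup>2 + (3 / 4 * \<beta>\<^sup>2 * \<sigma>0 * l\<^sup>2 * \<sigma> ^ 3 * N ^ 4 + 3 / 4 * (\<gamma> * \<mu> * d\<^sup>2))
     + K3 * \<sigma> ^ 3 * N ^ 4 + (\<gamma> * \<mu> / 8 * d\<^sup>2 + 4 * \<sigma>0 / (\<beta> * \<mu>) * K3\<^sup>2 * \<sigma> ^ 3 * N ^ 4)"
    using S 1 2 3 by linarith
  then show ?thesis by (simp add: algebra_simps)
qed

context langevin
begin

lemma reject_moment_le:
  assumes g: "0 < \<gamma>" "\<gamma> \<le> \<gamma>0"
  shows "(\<integral>z. (1 - acc X (noise \<gamma> *\<^sub>R z)) * norm (noise \<gamma> *\<^sub>R z) ^ k \<partial>std_gaussian)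
     \<le> 2 * slack_const * (1 + norm X) * noise \<gamma> ^ (k + 1) * gauss_moment TYPE('a) (k + 2)"
    and "integrable std_gaussian (\<lambda>z. (1 - acc X (noise \<gamma> *\<^sub>R z)) * norm (noise \<gamma> *\<^sub>R z) ^ k)"
proof -
  have s: "noise \<gamma> > 0" using g noise_pos by auto
  have b: "\<bar>(1 - acc X (noise \<gamma> *\<^sub>R z)) * norm (noise \<gamma> *\<^sub>R z) ^ k\<bar>
      \<le> 2 * slack_const * (1 + norm X) * noise \<gamma> ^ (k + 1) * (1 + norm z) ^ (k + 2)" for z
  proof -
    have "\<bar>1 - acc X (noise \<gamma> *\<^sub>R z)\<bar> \<le> 2 * (slack_const * noise \<gamma> * (1 + norm X) * (1 + norm z) ^ 2)"
      using reject_le[of X "noise \<gamma> *\<^sub>R z"] slack_le[OF g, of X z] acc_le_1[of X "noise \<gamma> *\<^sub>R z"] by linarith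
    moreover have "norm (noise \<gamma> *\<^sub>R z) ^ k \<le> noise \<gamma> ^ k * (1 + norm z) ^ k"
      using s by (simp add: power_mult_distrib mult_left_mono power_mono)
    ultimately have "\<bar>(1 - acc X (noise \<gamma> *\<^sub>R z)) * norm (noise \<gamma> *\<^sub>R z) ^ k\<bar>
       \<le> (2 * (slack_const * noise \<gamma> * (1 + norm X) * (1 + norm z) ^ 2)) * (noise \<gamma> ^ k * (1 + norm z) ^ k)"
      unfolding abs_mult using s slack_const_pos by (intro mult_mono) auto
    then show ?thesis by (simp add: power_add power2_eq_square mult_ac)
  qed
  show "integrable std_gaussian (\<lambda>z. (1 - acc X (noise \<gamma> *\<^sub>R z)) * norm (noise \<gamma> *\<^sub>R z) ^ k)"
    by (rule integrable_std_gaussian[OF _ b]) measurable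
  show "(\<integral>z. (1 - acc X (noise \<gamma> *\<^sub>R z)) * norm (noise \<gamma> *\<^sub>R z) ^ k \<partial>std_gaussian)
     \<le> 2 * slack_const * (1 + norm X) * noise \<gamma> ^ (k + 1) * gauss_moment TYPE('a) (k + 2)"
    by (rule order_trans[OF abs_ge_self abs_integral_std_gaussian_le[OF _ b]]) measurable
qed

lemma integrable_reject_inner:
  "integrable std_gaussian (\<lambda>z. (1 - acc X (s *\<^sub>R z)) * inner D (s *\<^sub>R z))"
  using acc_le_1 less_imp_le[OF acc_pos]
  by (intro integrable_inner_mult[of _ 1 0]) (auto simp: abs_le_iff add_increasing2)

lemma reject_inner_ge:
  assumes g: "0 < \<gamma>" "\<gamma> \<le> \<gamma>0"
  shows "- (norm h * (2 * slack_const * (1 + norm X) * noise \<gamma> ^ 2 * gauss_moment TYPE('a) 3))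
     \<le> (\<integral>z. (1 - acc X (noise \<gamma> *\<^sub>R z)) * inner h (noise \<gamma> *\<^sub>R z) \<partial>std_gaussian)"
proof -
  note R = reject_moment_le[OF g, of X 1]
  have "- (norm h * (\<integral>z. (1 - acc X (noise \<gamma> *\<^sub>R z)) * norm (noise \<gamma> *\<^sub>R z) ^ 1 \<partial>std_gaussian))
     = (\<integral>z. - norm h * ((1 - acc X (noise \<gamma> *\<^sub>R z)) * norm (noise \<gamma> *\<^sub>R z) ^ 1) \<partial>std_gaussian)"
    by (simp only: integral_mult_right_zero mult_minus_left Bochner_Integration.integral_minus)
  also have "\<dots> \<le> (\<integral>z. (1 - acc X (noise \<gamma> *\<^sub>R z)) * inner h (noise \<gamma> *\<^sub>R z) \<partial>std_gaussian)"
  proof (intro integral_mono integrable_mult_right R(2) integrable_reject_inner)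
    fix z
    have "- (norm h * norm (noise \<gamma> *\<^sub>R z)) \<le> inner h (noise \<gamma> *\<^sub>R z)"
      using Cauchy_Schwarz_ineq2[of h "noise \<gamma> *\<^sub>R z"] by (simp only: abs_le_iff) linarith
    then have "(1 - acc X (noise \<gamma> *\<^sub>R z)) * (- (norm h * norm (noise \<gamma> *\<^sub>R z)))
        \<le> (1 - acc X (noise \<gamma> *\<^sub>R z)) * inner h (noise \<gamma> *\<^sub>R z)"
      using acc_le_1 by (intro mult_left_mono) auto
    then show "- norm h * ((1 - acc X (noise \<gamma> *\<^sub>R z)) * norm (noise \<gamma> *\<^sub>R z) ^ 1)
        \<le> (1 - acc X (noise \<gamma> *\<^sub>R z)) * inner h (noise \<gamma> *\<^sub>R z)" by (simp add: mult_ac)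
  qed
  finally have "- (norm h * (\<integral>z. (1 - acc X (noise \<gamma> *\<^sub>R z)) * norm (noise \<gamma> *\<^sub>R z) ^ 1 \<partial>std_gaussian))
     \<le> (\<integral>z. (1 - acc X (noise \<gamma> *\<^sub>R z)) * inner h (noise \<gamma> *\<^sub>R z) \<partial>std_gaussian)" .
  moreover have "norm h * (\<integral>z. (1 - acc X (noise \<gamma> *\<^sub>R z)) * norm (noise \<gamma> *\<^sub>R z) ^ 1 \<partial>std_gaussian)
     \<le> norm h * (2 * slack_const * (1 + norm X) * noise \<gamma> ^ 2 * gauss_moment TYPE('a) 3)"
    using R(1) by (intro mult_left_mono) (auto simp: numeral_2_eq_2 numeral_3_eq_3)
  ultimately show ?thesis by linarith
qed

text \<open>
This is applied with \<open>A = X - Y + \<gamma> grad U Y\<close>: if the proposal is accepted, the noise cancels and the difference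
between the invariant chain and the algorithm becomes \<open>A\<close>; if it is rejected, the difference becomes \<open>A - v\<close>.
\<close>

lemma coupling_power_le:
  obtains \<kappa> where "\<kappa> \<ge> 1"
    and "\<And>\<gamma> X A. 0 < \<gamma> \<Longrightarrow> \<gamma> \<le> \<gamma>0 \<Longrightarrow>
      (\<integral>\<^sup>+z. ennreal (acc X (noise \<gamma> *\<^sub>R z) * norm A ^ (2 * Suc n)
          + (1 - acc X (noise \<gamma> *\<^sub>R z)) * norm (A - noise \<gamma> *\<^sub>R z) ^ (2 * Suc n)) \<partial>std_gaussian)
      \<le> ennreal (norm A ^ (2 * Suc n)
         + real (Suc n) * norm A ^ (2 * n) *
            (- 2 * (\<integral>z. (1 - acc X (noise \<gamma> *\<^sub>R z)) * inner A (noise \<gamma> *\<^sub>R z) \<partial>std_gaussian)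
             + \<kappa> * (2 * slack_const * (1 + norm X) * noise \<gamma> ^ 3 * gauss_moment TYPE('a) 4))
         + \<kappa> * (2 * slack_const * (1 + norm X) * noise \<gamma> ^ (2 * n + 3) * gauss_moment TYPE('a) (2 * n + 4)))"
proof -
  obtain \<kappa> :: real where k: "\<kappa> \<ge> 1" and H: "\<And>A v :: 'a. norm (A - v) ^ (2 * Suc n)
       \<le> norm A ^ (2 * Suc n) - 2 * real (Suc n) * norm A ^ (2 * n) * inner A v
          + \<kappa> * (norm A ^ (2 * n) * (norm v)\<^sup>2 + norm v ^ (2 * Suc n))"
    using norm_diff_power_expansion[of n, where 'a='a] by blast
  show ?thesis
  proof (rule that[OF k])
    fix \<gamma> :: real and X A :: 'a assume g: "0 < \<gamma>" "\<gamma> \<le> \<gamma>0"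
    define \<sigma> where "\<sigma> = noise \<gamma>"
    define a where "a = norm A"
    define e where "e z = 1 - acc X (\<sigma> *\<^sub>R z)" for z
    define E1 where "E1 = (\<integral>z. e z * inner A (\<sigma> *\<^sub>R z) \<partial>std_gaussian)"
    define E3 where "E3 = (\<integral>z. e z * norm (\<sigma> *\<^sub>R z) ^ 2 \<partial>std_gaussian)"
    define E4 where "E4 = (\<integral>z. e z * norm (\<sigma> *\<^sub>R z) ^ (2 * Suc n) \<partial>std_gaussian)"
    define J where "J z = a ^ (2 * Suc n) - 2 * real (Suc n) * a ^ (2 * n) * (e z * inner A (\<sigma> *\<^sub>R z))
          + \<kappa> * (a ^ (2 * n) * (e z * norm (\<sigma> *\<^sub>R z) ^ 2) + e z * norm (\<sigma> *\<^sub>R z) ^ (2 * Suc n))" for z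
    have a: "a \<ge> 0" by (simp add: a_def)
    have i1: "integrable std_gaussian (\<lambda>z. e z * inner A (\<sigma> *\<^sub>R z))"
      unfolding e_def by (rule integrable_reject_inner)
    have i3: "integrable std_gaussian (\<lambda>z. e z * norm (\<sigma> *\<^sub>R z) ^ k)" for k
      unfolding e_def \<sigma>_def by (rule reject_moment_le(2)[OF g])
    have iJ: "integrable std_gaussian J"
      unfolding J_def
      by (intro Bochner_Integration.integrable_add Bochner_Integration.integrable_diff integrable_mult_right i1 i3) auto
    have pt: "acc X (\<sigma> *\<^sub>R z) * a ^ (2 * Suc n) + e z * norm (A - \<sigma> *\<^sub>R z) ^ (2 * Suc n) \<le> J z" for z
    proof -
      have "e z * norm (A - \<sigma> *\<^sub>R z) ^ (2 * Suc n) \<le> e z * (a ^ (2 * Suc n) - 2 * real (Suc n) * a ^ (2 * n) * inner A (\<sigma> *\<^sub>R z)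
          + \<kappa> * (a ^ (2 * n) * (norm (\<sigma> *\<^sub>R z))\<^sup>2 + norm (\<sigma> *\<^sub>R z) ^ (2 * Suc n)))"
        using H[of A "\<sigma> *\<^sub>R z"] acc_le_1 by (intro mult_left_mono) (auto simp: a_def e_def)
      moreover have "acc X (\<sigma> *\<^sub>R z) * a ^ (2 * Suc n) = a ^ (2 * Suc n) - e z * a ^ (2 * Suc n)"
        by (simp add: e_def left_diff_distrib)
      moreover have "e z * (a ^ (2 * Suc n) - 2 * real (Suc n) * a ^ (2 * n) * inner A (\<sigma> *\<^sub>R z)
          + \<kappa> * (a ^ (2 * n) * (norm (\<sigma> *\<^sub>R z))\<^sup>2 + norm (\<sigma> *\<^sub>R z) ^ (2 * Suc n)))
        = e z * a ^ (2 * Suc n) - 2 * real (Suc n) * a ^ (2 * n) * (e z * inner A (\<sigma> *\<^sub>R z))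
          + \<kappa> * (a ^ (2 * n) * (e z * norm (\<sigma> *\<^sub>R z) ^ 2) + e z * norm (\<sigma> *\<^sub>R z) ^ (2 * Suc n))"
        by (simp only: distrib_left right_diff_distrib mult_ac)
      ultimately show ?thesis unfolding J_def by linarith
    qed
    have J0: "J z \<ge> 0" for z
    proof -
      have "0 \<le> acc X (\<sigma> *\<^sub>R z) * a ^ (2 * Suc n) + e z * norm (A - \<sigma> *\<^sub>R z) ^ (2 * Suc n)"
        using a less_imp_le[OF acc_pos] acc_le_1 by (intro add_nonneg_nonneg mult_nonneg_nonneg) (auto simp: e_def)
      then show ?thesis using pt[of z] by linarith
    qed
    have "(\<integral>\<^sup>+z. ennreal (acc X (\<sigma> *\<^sub>R z) * a ^ (2 * Suc n) + e z * norm (A - \<sigma> *\<^sub>R z) ^ (2 * Suc n)) \<partial>std_gaussian)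
       \<le> (\<integral>\<^sup>+z. ennreal (J z) \<partial>std_gaussian)"
      by (intro nn_integral_mono ennreal_leI pt)
    also have "\<dots> = ennreal (\<integral>z. J z \<partial>std_gaussian)"
      by (rule nn_integral_eq_integral[OF iJ]) (simp add: J0)
    also have "(\<integral>z. J z \<partial>std_gaussian) = a ^ (2 * Suc n) - 2 * real (Suc n) * a ^ (2 * n) * E1 + \<kappa> * (a ^ (2 * n) * E3 + E4)"
      unfolding J_def E1_def E3_def E4_def
      by (simp add: i1 i3 del: power_Suc mult_Suc_right scaleR_conv_of_real norm_scaleR inner_scaleR_right of_nat_Suc)
    also have "\<dots> \<le> a ^ (2 * Suc n) + real (Suc n) * a ^ (2 * n) *
            (- 2 * E1 + \<kappa> * (2 * slack_const * (1 + norm X) * \<sigma> ^ 3 * gauss_moment TYPE('a) 4))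
         + \<kappa> * (2 * slack_const * (1 + norm X) * \<sigma> ^ (2 * n + 3) * gauss_moment TYPE('a) (2 * n + 4))"
    proof -
      define r where "r = real (Suc n)"
      define P where "P = a ^ (2 * n)"
      define B3 where "B3 = 2 * slack_const * (1 + norm X) * \<sigma> ^ 3 * gauss_moment TYPE('a) 4"
      define B4 where "B4 = 2 * slack_const * (1 + norm X) * \<sigma> ^ (2 * n + 3) * gauss_moment TYPE('a) (2 * n + 4)"
      have r: "r \<ge> 1" and P: "P \<ge> 0" by (auto simp: r_def P_def a)
      have "E3 \<le> B3"
        using reject_moment_le(1)[OF g, of X 2] by (simp add: E3_def B3_def e_def \<sigma>_def)
      moreover have "E3 \<ge> 0" unfolding E3_def
        by (intro integral_nonneg_AE) (auto simp: e_def acc_le_1)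
      ultimately have "P * E3 \<le> r * P * B3"
        using r P mult_mono[of 1 r "P * E3" "P * B3"] mult_left_mono[of E3 B3 P] by (simp add: mult_ac)
      moreover have "E4 \<le> B4"
        using reject_moment_le(1)[OF g, of X "2 * Suc n"] by (simp add: E4_def B4_def e_def \<sigma>_def eval_nat_numeral)
      ultimately have "\<kappa> * (P * E3 + E4) \<le> \<kappa> * (r * P * B3 + B4)"
        using k by (intro mult_left_mono add_mono) auto
      then have "a ^ (2 * Suc n) - 2 * r * P * E1 + \<kappa> * (P * E3 + E4)
         \<le> a ^ (2 * Suc n) + r * P * (- 2 * E1 + \<kappa> * B3) + \<kappa> * B4"
        by (simp add: algebra_simps)
      then show ?thesis unfolding r_def P_def B3_def B4_def .
    qed
    finally show "(\<integral>\<^sup>+z. ennreal (acc X (noise \<gamma> *\<^sub>R z) * norm A ^ (2 * Suc n)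
          + (1 - acc X (noise \<gamma> *\<^sub>R z)) * norm (A - noise \<gamma> *\<^sub>R z) ^ (2 * Suc n)) \<partial>std_gaussian)
      \<le> ennreal (norm A ^ (2 * Suc n)
         + real (Suc n) * norm A ^ (2 * n) *
            (- 2 * (\<integral>z. (1 - acc X (noise \<gamma> *\<^sub>R z)) * inner A (noise \<gamma> *\<^sub>R z) \<partial>std_gaussian)
             + \<kappa> * (2 * slack_const * (1 + norm X) * noise \<gamma> ^ 3 * gauss_moment TYPE('a) 4))
         + \<kappa> * (2 * slack_const * (1 + norm X) * noise \<gamma> ^ (2 * n + 3) * gauss_moment TYPE('a) (2 * n + 4)))"
      by (simp only: a_def \<sigma>_def E1_def e_def ennreal_leI order_trans)
  qed
qed

text \<open>
The second-order expansion in the rejected noise is, up to the last error term, the tangent of the power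
\<open>Suc n\<close> at \<open>norm A ^ 2\<close>, evaluated at a quantity \<open>S\<close> that obeys the quadratic bound. Using the tangent at \<open>norm A ^ 2\<close>,
rather than at \<open>norm (X - Y) ^ 2\<close>, avoids any comparison between \<open>A\<close> and \<open>X - Y\<close>. The error in \<open>S\<close> is then moved out
of the power by convexity, at the weight \<open>c * \<gamma>\<close>.
\<close>

lemma one_step_drift:
  obtains c K where "c > 0" "c * \<gamma>0 \<le> 1" "K > 0"
    and "\<And>\<gamma> X Y. 0 < \<gamma> \<Longrightarrow> \<gamma> \<le> \<gamma>0 \<Longrightarrow> Y \<in> grad_dom U \<Longrightarrow>
      (\<integral>\<^sup>+z. ennreal (acc X (noise \<gamma> *\<^sub>R z) * norm (X - Y + \<gamma> *\<^sub>R grad U Y) ^ (2 * Suc n)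
          + (1 - acc X (noise \<gamma> *\<^sub>R z)) * norm (X - Y + \<gamma> *\<^sub>R grad U Y - noise \<gamma> *\<^sub>R z) ^ (2 * Suc n)) \<partial>std_gaussian)
      \<le> ennreal ((1 - c * \<gamma>) * norm (X - Y) ^ (2 * Suc n) + K * \<gamma> * noise \<gamma> ^ Suc n * (1 + norm X) ^ (4 * Suc n))"
proof -
  obtain \<kappa> where k: "\<kappa> \<ge> 1"
    and H: "\<And>\<gamma> X A. 0 < \<gamma> \<Longrightarrow> \<gamma> \<le> \<gamma>0 \<Longrightarrow>
      (\<integral>\<^sup>+z. ennreal (acc X (noise \<gamma> *\<^sub>R z) * norm A ^ (2 * Suc n)
          + (1 - acc X (noise \<gamma> *\<^sub>R z)) * norm (A - noise \<gamma> *\<^sub>R z) ^ (2 * Suc n)) \<partial>std_gaussian)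
      \<le> ennreal (norm A ^ (2 * Suc n)
         + real (Suc n) * norm A ^ (2 * n) *
            (- 2 * (\<integral>z. (1 - acc X (noise \<gamma> *\<^sub>R z)) * inner A (noise \<gamma> *\<^sub>R z) \<partial>std_gaussian)
             + \<kappa> * (2 * slack_const * (1 + norm X) * noise \<gamma> ^ 3 * gauss_moment TYPE('a) 4))
         + \<kappa> * (2 * slack_const * (1 + norm X) * noise \<gamma> ^ (2 * n + 3) * gauss_moment TYPE('a) (2 * n + 4)))"
    using coupling_power_le[of n] by blast
  \<comment> \<open>the second entry keeps \<open>1 - c * \<gamma>\<close> nonnegative\<close>
  define c where "c = min (\<mu> / 8) (1 / \<gamma>0)"
  have c: "c > 0" "c * \<gamma>0 \<le> 1" "c \<le> \<mu> / 8"
    using mu_pos gamma0_pos by (auto simp: c_def min_def field_simps)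
  define M where "M = gauss_moment TYPE('a)"
  have M: "M j \<ge> 0" for j by (simp add: M_def)
  define K3 where "K3 = 2 * drift_const TYPE('a) + 2 * \<beta> * noise0 * slack_const * M 3 * (m + L) + 2 * \<kappa> * slack_const * M 4"
  define K4 where "K4 = K3 + 3 / 4 * \<beta>\<^sup>2 * noise0 * (m + L)\<^sup>2 + 4 * noise0 / (\<beta> * \<mu>) * K3\<^sup>2"
  define K where "K = c * (2 * K4 / (c * \<beta>)) ^ Suc n + \<kappa> * (2 * slack_const * M (2 * n + 4)) * (2 / \<beta>) * noise0 ^ n"
  have dcp: "drift_const TYPE('a) \<ge> 0"
    using beta_pos m_pos L_pos noise0_pos by (simp add: drift_const_def)
  have K3: "K3 \<ge> 0"
    using dcp beta_pos m_pos L_pos noise0_pos slack_const_pos k M by (simp add: K3_def)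
  have K4: "K4 > 0"
    using K3 beta_pos m_pos L_pos noise0_pos mu_pos by (simp add: K4_def add_nonneg_pos add_pos_nonneg)
  have K: "K > 0"
    using K4 c beta_pos noise0_pos slack_const_pos k M by (simp add: K_def add_pos_nonneg)
  show ?thesis
  proof (rule that[OF c(1,2) K])
    fix \<gamma> :: real and X Y :: 'a assume g: "0 < \<gamma>" "\<gamma> \<le> \<gamma>0" and Y: "Y \<in> grad_dom U"
    define \<sigma> where "\<sigma> = noise \<gamma>"
    define D where "D = X - Y"
    define d where "d = norm D"
    define h where "h = grad U Y"
    define A where "A = D + \<gamma> *\<^sub>R h"
    define N where "N = 1 + norm X"
    define E where "E u = (\<integral>z. (1 - acc X (\<sigma> *\<^sub>R z)) * inner u (\<sigma> *\<^sub>R z) \<partial>std_gaussian)" for u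
    have s: "\<sigma> > 0" "\<sigma> \<le> noise0"
      using g noise_pos noise_mono by (auto simp: \<sigma>_def noise0_def)
    have N: "N \<ge> 1" by (simp add: N_def)
    have d: "d \<ge> 0" by (simp add: d_def)
    have sq: "\<gamma> = \<beta> / 2 * \<sigma>\<^sup>2" using g beta_pos by (simp add: \<sigma>_def noise_sq)
    have gL: "\<gamma> * L\<^sup>2 \<le> \<mu> / 2"
      using gamma0_le mult_right_mono[OF g(2), of "L\<^sup>2"] by simp
    have cg: "0 \<le> c * \<gamma>" "c * \<gamma> \<le> 1"
      using c(1) g(1) order_trans[OF mult_left_mono[OF g(2), of c] c(2)] by auto
    have hn: "norm h \<le> (m + L) * N + L * d"
    proof -
      have "norm Y \<le> norm X + d" using norm_triangle_ineq4[of X D] by (simp add: D_def d_def)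
      then have "L * norm Y \<le> L * (norm X + d)" using L_pos by (intro mult_left_mono) auto
      moreover have "m * 1 \<le> m * N" using N m_pos by (intro mult_left_mono) auto
      ultimately show ?thesis using growth[of Y] L_pos by (simp add: h_def N_def algebra_simps)
    qed
    define S where "S = (norm A)\<^sup>2 - 2 * E A + \<kappa> * (2 * slack_const * N * \<sigma> ^ 3 * M 4)"
    define V where "V = \<sigma> ^ 3 * N\<^sup>2 * (1 + d)"
    have EA: "E A = E D + \<gamma> * E h"
    proof -
      have "E A = (\<integral>z. (1 - acc X (\<sigma> *\<^sub>R z)) * inner D (\<sigma> *\<^sub>R z)
          + \<gamma> * ((1 - acc X (\<sigma> *\<^sub>R z)) * inner h (\<sigma> *\<^sub>R z)) \<partial>std_gaussian)"
        unfolding E_def A_def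
        by (intro Bochner_Integration.integral_cong refl) (simp add: inner_add algebra_simps)
      also have "\<dots> = E D + \<gamma> * E h"
        using integrable_reject_inner unfolding E_def by (subst Bochner_Integration.integral_add) auto
      finally show ?thesis .
    qed
    have ED: "E D \<ge> \<gamma> * (inner h D + \<mu> / 2 * d\<^sup>2) - drift_const TYPE('a) * V"
      using reject_drift[OF g Y, of X] by (simp add: E_def D_def d_def h_def \<sigma>_def N_def V_def mult.assoc)
    have Eh: "- (2 * \<gamma> * E h) \<le> 2 * \<beta> * noise0 * slack_const * M 3 * (m + L) * V"
    proof -
      have "- E h \<le> norm h * (2 * slack_const * N * \<sigma>\<^sup>2 * M 3)"
        using reject_inner_ge[OF g, of h X] by (simp add: E_def \<sigma>_def N_def M_def)
      also have "\<dots> \<le> ((m + L) * (N * (1 + d))) * (2 * slack_const * N * \<sigma>\<^sup>2 * M 3)"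
      proof (intro mult_right_mono)
        have "(m + L) * N + L * d \<le> (m + L) * N + (m + L) * (N * d)"
          using mult_mono[of 1 N d d] N d m_pos L_pos by (intro add_mono mult_mono) auto
        then show "norm h \<le> (m + L) * (N * (1 + d))" using hn by (simp add: algebra_simps)
      qed (use slack_const_pos N M in simp)
      finally have "2 * \<gamma> * (- E h) \<le> 2 * \<gamma> * (((m + L) * (N * (1 + d))) * (2 * slack_const * N * \<sigma>\<^sup>2 * M 3))"
        using g by (intro mult_left_mono) auto
      also have "\<dots> = 2 * \<beta> * slack_const * M 3 * (m + L) * N\<^sup>2 * (1 + d) * (\<sigma> * \<sigma> ^ 3)"
        by (simp add: sq power2_eq_square eval_nat_numeral mult_ac)
      also have "\<dots> \<le> 2 * \<beta> * slack_const * M 3 * (m + L) * N\<^sup>2 * (1 + d) * (noise0 * \<sigma> ^ 3)"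
        using s beta_pos slack_const_pos M m_pos L_pos d by (intro mult_left_mono mult_right_mono) auto
      finally show ?thesis by (simp add: V_def mult_ac)
    qed
    have VN: "\<kappa> * (2 * slack_const * N * \<sigma> ^ 3 * M 4) \<le> 2 * \<kappa> * slack_const * M 4 * V"
    proof -
      have "N * 1 \<le> N\<^sup>2 * (1 + d)" using N d by (intro mult_mono) (auto simp: power2_eq_square)
      then have "(2 * \<kappa> * slack_const * M 4 * \<sigma> ^ 3) * N \<le> (2 * \<kappa> * slack_const * M 4 * \<sigma> ^ 3) * (N\<^sup>2 * (1 + d))"
        using s k slack_const_pos M by (intro mult_left_mono) auto
      then show ?thesis by (simp add: V_def mult_ac)
    qed
    have nA: "(norm A)\<^sup>2 = d\<^sup>2 + 2 * \<gamma> * inner h D + \<gamma>\<^sup>2 * (norm h)\<^sup>2"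
      unfolding A_def d_def power2_norm_eq_inner
      by (simp add: inner_add inner_commute algebra_simps power2_eq_square)
    have "S \<le> d\<^sup>2 - \<gamma> * \<mu> * d\<^sup>2 + \<gamma>\<^sup>2 * (norm h)\<^sup>2 + K3 * V"
      using ED Eh VN unfolding S_def EA nA K3_def by (simp add: algebra_simps)
    then have S0: "S \<le> d\<^sup>2 - \<gamma> * \<mu> * d\<^sup>2 + \<gamma>\<^sup>2 * (norm h)\<^sup>2 + K3 * \<sigma> ^ 3 * N\<^sup>2 * (1 + d)"
      by (simp add: V_def mult.assoc)
    have "0 \<le> m + L" using m_pos L_pos by simp
    then have "S \<le> (1 - \<gamma> * \<mu> / 8) * d\<^sup>2 + K4 * \<sigma> ^ 3 * N ^ 4"
      unfolding K4_def
      by (rule drift_quadratic_bound[OF d N s mu_pos beta_pos L_pos _ K3 norm_ge_zero sq gL hn S0])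
    also have "(1 - \<gamma> * \<mu> / 8) * d\<^sup>2 \<le> (1 - c * \<gamma>) * d\<^sup>2"
      using c(3) g mult_left_mono[OF c(3), of \<gamma>] by (intro mult_right_mono) (auto simp: mult.commute)
    finally have S1: "S \<le> (1 - c * \<gamma>) * d\<^sup>2 + K4 * \<sigma> ^ 3 * N ^ 4" by simp
    \<comment> \<open>chosen such that \<open>c * \<gamma> * w\<close> is the error in the bound for \<open>S\<close>\<close>
    define w where "w = 2 * K4 / (c * \<beta>) * (\<sigma> * N ^ 4)"
    have w: "w \<ge> 0" using K4 c beta_pos s N by (simp add: w_def)
    define T where "T = (1 - c * \<gamma>) * d\<^sup>2 + c * \<gamma> * w"
    have "c * \<gamma> * w = K4 * \<sigma> ^ 3 * N ^ 4"
      using c beta_pos by (simp add: w_def sq eval_nat_numeral)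
    then have ST: "S \<le> T" using S1 by (simp add: T_def)
    have T: "T \<ge> 0" using cg w by (simp add: T_def)
    have "norm A ^ (2 * Suc n) + real (Suc n) * norm A ^ (2 * n) * (S - (norm A)\<^sup>2)
       \<le> norm A ^ (2 * Suc n) + real (Suc n) * norm A ^ (2 * n) * (T - (norm A)\<^sup>2)"
      using ST by (intro add_mono mult_left_mono) auto
    also have "\<dots> \<le> T ^ Suc n"
      using power_tangent_le[of "(norm A)\<^sup>2" T n] T by (simp only: power_mult zero_le_power2)
    also have "\<dots> \<le> (1 - c * \<gamma>) * (d\<^sup>2) ^ Suc n + c * \<gamma> * w ^ Suc n"
      unfolding T_def using cg w by (intro power_mixture_le) auto
    finally have 1: "norm A ^ (2 * Suc n) + real (Suc n) * norm A ^ (2 * n) * (S - (norm A)\<^sup>2)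
       \<le> (1 - c * \<gamma>) * (d\<^sup>2) ^ Suc n + c * \<gamma> * w ^ Suc n" .
    have 2: "c * \<gamma> * w ^ Suc n = c * (2 * K4 / (c * \<beta>)) ^ Suc n * \<gamma> * \<sigma> ^ Suc n * N ^ (4 * Suc n)"
    proof -
      have "w ^ Suc n = (2 * K4 / (c * \<beta>)) ^ Suc n * (\<sigma> ^ Suc n * N ^ (4 * Suc n))"
        unfolding w_def by (simp only: power_mult_distrib power_mult)
      then show ?thesis by (simp only: mult_ac)
    qed
    have 3: "\<kappa> * (2 * slack_const * N * \<sigma> ^ (2 * n + 3) * M (2 * n + 4))
        \<le> \<kappa> * (2 * slack_const * M (2 * n + 4)) * (2 / \<beta>) * noise0 ^ n * \<gamma> * \<sigma> ^ Suc n * N ^ (4 * Suc n)"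
    proof -
      have "\<sigma> ^ (2 * n + 3) = \<sigma>\<^sup>2 * (\<sigma> ^ Suc n * \<sigma> ^ n)"
        by (simp add: power_add[symmetric] mult_2 eval_nat_numeral)
      also have "\<dots> = (2 / \<beta>) * \<gamma> * (\<sigma> ^ Suc n * \<sigma> ^ n)" using beta_pos by (simp add: sq)
      also have "\<dots> \<le> (2 / \<beta>) * \<gamma> * (\<sigma> ^ Suc n * noise0 ^ n)"
        using beta_pos g s by (intro mult_left_mono power_mono) auto
      finally have "\<sigma> ^ (2 * n + 3) * N \<le> ((2 / \<beta>) * \<gamma> * (\<sigma> ^ Suc n * noise0 ^ n)) * N ^ (4 * Suc n)"
        using N s g beta_pos noise0_pos self_le_power[of N "4 * Suc n"] by (intro mult_mono) auto
      then have "(\<kappa> * (2 * slack_const * M (2 * n + 4))) * (\<sigma> ^ (2 * n + 3) * N)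
         \<le> (\<kappa> * (2 * slack_const * M (2 * n + 4))) * (((2 / \<beta>) * \<gamma> * (\<sigma> ^ Suc n * noise0 ^ n)) * N ^ (4 * Suc n))"
        using k slack_const_pos M by (intro mult_left_mono) auto
      then show ?thesis by (simp only: mult_ac)
    qed
    have "norm A ^ (2 * Suc n) + real (Suc n) * norm A ^ (2 * n) *
            (- 2 * E A + \<kappa> * (2 * slack_const * N * \<sigma> ^ 3 * M 4))
         + \<kappa> * (2 * slack_const * N * \<sigma> ^ (2 * n + 3) * M (2 * n + 4))
       \<le> (1 - c * \<gamma>) * (d\<^sup>2) ^ Suc n + K * \<gamma> * \<sigma> ^ Suc n * N ^ (4 * Suc n)"
    proof -
      have "- 2 * E A + \<kappa> * (2 * slack_const * N * \<sigma> ^ 3 * M 4) = S - (norm A)\<^sup>2" by (simp add: S_def)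
      moreover have "K * \<gamma> * \<sigma> ^ Suc n * N ^ (4 * Suc n) = c * (2 * K4 / (c * \<beta>)) ^ Suc n * \<gamma> * \<sigma> ^ Suc n * N ^ (4 * Suc n)
        + \<kappa> * (2 * slack_const * M (2 * n + 4)) * (2 / \<beta>) * noise0 ^ n * \<gamma> * \<sigma> ^ Suc n * N ^ (4 * Suc n)"
        unfolding K_def by (simp only: distrib_right)
      ultimately show ?thesis using 1 3 unfolding 2 by (simp only:)
    qed
    from order_trans[OF H[OF g, of X A] ennreal_leI[OF this[unfolded E_def \<sigma>_def N_def M_def]]]
    show "(\<integral>\<^sup>+z. ennreal (acc X (noise \<gamma> *\<^sub>R z) * norm (X - Y + \<gamma> *\<^sub>R grad U Y) ^ (2 * Suc n)
          + (1 - acc X (noise \<gamma> *\<^sub>R z)) * norm (X - Y + \<gamma> *\<^sub>R grad U Y - noise \<gamma> *\<^sub>R z) ^ (2 * Suc n)) \<partial>std_gaussian)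
      \<le> ennreal ((1 - c * \<gamma>) * norm (X - Y) ^ (2 * Suc n) + K * \<gamma> * noise \<gamma> ^ Suc n * (1 + norm X) ^ (4 * Suc n))"
      by (simp only: A_def D_def h_def d_def power_mult)
  qed
qed

end

section \<open>The Gibbs measure is invariant\<close>

text \<open>
One noisy step makes the law absolutely continuous, whatever the starting point; hence the algorithm
almost surely never leaves the set where the gradient exists.
\<close>

lemma null_lborel_affine_std_gaussian:
  fixes N :: "'a::euclidean_space set"
  assumes N: "N \<in> null_sets lborel" and s: "s \<noteq> 0"
  shows "(\<integral>\<^sup>+z. indicator N (t + s *\<^sub>R z) \<partial>std_gaussian) = 0"
proof -
  have [measurable]: "N \<in> sets borel" using N by (auto simp: null_sets_def)
  have "0 = (\<integral>\<^sup>+x. indicator N x \<partial>lborel)"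
    using N by (simp add: null_sets_def)
  also have "\<dots> = (\<integral>\<^sup>+x. indicator N x \<partial>density (distr lborel borel (\<lambda>x. t + s *\<^sub>R x)) (\<lambda>_. ennreal (\<bar>s\<bar>^DIM('a))))"
    using lborel_affine[OF s, of t] by simp
  also have "\<dots> = ennreal (\<bar>s\<bar>^DIM('a)) * (\<integral>\<^sup>+x. indicator N (t + s *\<^sub>R x) \<partial>lborel)"
    by (simp add: nn_integral_density nn_integral_distr nn_integral_cmult del: nn_integral_indicator)
  finally have "(\<integral>\<^sup>+x. indicator N (t + s *\<^sub>R x) \<partial>lborel) = 0"
    using s zero_less_power[of "\<bar>s\<bar>" "DIM('a)"] by (auto simp: ennreal_eq_0_iff not_le[symmetric])
  then have "AE x in lborel. indicator N (t + s *\<^sub>R x) = (0::ennreal)"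
    by (subst (asm) nn_integral_0_iff_AE) auto
  then have "AE x in lborel. std_gaussian_density x * indicator N (t + s *\<^sub>R x) = (0::ennreal)"
    by eventually_elim simp
  then show ?thesis
    by (subst nn_integral_std_gaussian) (auto simp: nn_integral_0_iff_AE)
qed

context langevin
begin

lemma borel_grad [measurable]: "grad U \<in> borel_measurable borel"
  using continuous_U by (rule borel_measurable_grad)

lemma borel_dom [measurable]: "grad_dom U \<in> sets borel"
  using continuous_U by (rule borel_grad_dom)

lemma compl_dom_null: "- grad_dom U \<in> null_sets lborel"
proof -
  have "AE x in lebesgue. x \<notin> - grad_dom U" using dom_AE by simp
  then have "- grad_dom U \<in> null_sets lebesgue"
    by (subst AE_iff_null_sets) (auto intro: sets_completionI_sets)
  then show ?thesis
    by (auto simp: null_sets_def emeasure_completion)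
qed

definition partition_fn :: ennreal where
  "partition_fn = (\<integral>\<^sup>+ y. ennreal (exp (- \<beta> * U y)) \<partial>lborel)"

lemma gibbs_weight_moment:
  "(\<integral>\<^sup>+x. ennreal (exp (- \<beta> * U x)) * ennreal ((1 + norm x) ^ k) \<partial>lborel) < \<top>"
proof -
  obtain C where C: "\<And>x. \<mu> / 8 * (norm x)\<^sup>2 - C \<le> U x" using U_quadratic_lower by blast
  have "(\<integral>\<^sup>+x. ennreal (exp (- \<beta> * U x)) * ennreal ((1 + norm x) ^ k) \<partial>lborel)
    \<le> (\<integral>\<^sup>+x. ennreal (exp (\<beta> * C)) * ennreal ((1 + norm x) ^ k * exp (- (\<beta> * \<mu> / 8) * (norm (x::'a))\<^sup>2)) \<partial>lborel)"
  proof (intro nn_integral_mono)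
    fix x :: 'a
    have "\<beta> * (\<mu> / 8 * (norm x)\<^sup>2 - C) \<le> \<beta> * U x" using C beta_pos by (intro mult_left_mono) auto
    then have "exp (- \<beta> * U x) \<le> exp (\<beta> * C + (- (\<beta> * \<mu> / 8) * (norm x)\<^sup>2))" by (simp add: algebra_simps)
    then have "exp (- \<beta> * U x) * (1 + norm x) ^ k \<le> exp (\<beta> * C) * ((1 + norm x) ^ k * exp (- (\<beta> * \<mu> / 8) * (norm x)\<^sup>2))"
      using mult_right_mono[of "exp (- \<beta> * U x)" "exp (\<beta> * C) * exp (- (\<beta> * \<mu> / 8) * (norm x)\<^sup>2)" "(1 + norm x) ^ k"]
      unfolding exp_add by (simp add: mult_ac)
    then show "ennreal (exp (- \<beta> * U x)) * ennreal ((1 + norm x) ^ k)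
       \<le> ennreal (exp (\<beta> * C)) * ennreal ((1 + norm x) ^ k * exp (- (\<beta> * \<mu> / 8) * (norm x)\<^sup>2))"
      by (simp only: ennreal_mult'[symmetric] exp_ge_zero ennreal_leI)
  qed
  also have "\<dots> = ennreal (exp (\<beta> * C)) * (\<integral>\<^sup>+x. ennreal ((1 + norm x) ^ k * exp (- (\<beta> * \<mu> / 8) * (norm (x::'a))\<^sup>2)) \<partial>lborel)"
    by (rule nn_integral_cmult) auto
  also have "\<dots> < \<top>"
    using nn_integral_poly_exp_neg_norm_sq[of "\<beta> * \<mu> / 8" k, where 'a='a] beta_pos mu_pos
    by (simp add: ennreal_mult_less_top)
  finally show ?thesis .
qed

lemma partition_fn_pos: "partition_fn \<noteq> 0"
proof
  assume "partition_fn = 0"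
  then have "AE x in lborel. ennreal (exp (- \<beta> * U x)) = 0"
    unfolding partition_fn_def by (subst (asm) nn_integral_0_iff_AE) auto
  then have "AE x in (lborel :: 'a measure). False" by simp
  then have "emeasure lborel (UNIV :: 'a set) = 0"
    by (subst (asm) AE_iff_measurable[OF _ refl]) auto
  then show False by simp
qed

lemma gibbs_eq: "gibbs \<beta> U = density lborel (\<lambda>x. ennreal (exp (- \<beta> * U x)) / partition_fn)"
  by (simp add: gibbs_def partition_fn_def)

lemma sets_gibbs [measurable_cong, simp]: "sets (gibbs \<beta> U) = sets borel"
  by (simp add: gibbs_eq)

lemma nn_integral_gibbs:
  assumes [measurable]: "f \<in> borel_measurable borel"
  shows "(\<integral>\<^sup>+x. f x \<partial>gibbs \<beta> U) = (\<integral>\<^sup>+x. ennreal (exp (- \<beta> * U x)) * f x \<partial>lborel) / partition_fn"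
proof -
  have "(\<integral>\<^sup>+x. f x \<partial>gibbs \<beta> U) = (\<integral>\<^sup>+x. (ennreal (exp (- \<beta> * U x)) / partition_fn) * f x \<partial>lborel)"
    unfolding gibbs_eq by (rule nn_integral_density) auto
  also have "\<dots> = (\<integral>\<^sup>+x. (ennreal (exp (- \<beta> * U x)) * f x) * inverse partition_fn \<partial>lborel)"
    by (intro nn_integral_cong) (simp only: divide_ennreal_def mult_ac)
  also have "\<dots> = (\<integral>\<^sup>+x. ennreal (exp (- \<beta> * U x)) * f x \<partial>lborel) / partition_fn"
    unfolding divide_ennreal_def by (rule nn_integral_multc) measurable
  finally show ?thesis .
qed

lemma gibbs_moment: "(\<integral>\<^sup>+x. ennreal ((1 + norm x) ^ k) \<partial>gibbs \<beta> U) < \<top>"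
  using gibbs_weight_moment[of k] partition_fn_pos
  by (simp add: nn_integral_gibbs ennreal_divide_eq_top_iff less_top[symmetric])

lemma gibbs_null_compl_dom: "(\<integral>\<^sup>+x. indicator (- grad_dom U) x \<partial>gibbs \<beta> U) = 0"
proof -
  have "AE x in lborel. x \<notin> - grad_dom U" using compl_dom_null by (rule AE_not_in)
  then have "AE x in lborel. ennreal (exp (- \<beta> * U x)) * indicator (- grad_dom U) x = 0"
    by eventually_elim (simp add: indicator_def)
  then show ?thesis by (subst nn_integral_gibbs) (auto simp: nn_integral_0_iff_AE)
qed

lemma acc_detailed_balance:
  "exp (- \<beta> * U (x + v)) * acc (x + v) (- v) = exp (- \<beta> * U x) * acc x v"
  by (simp add: acc_def acc_exp_def slack_def exp_add[symmetric] algebra_simps)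

text \<open>
Detailed balance in integrated form: exchange the two end points of an accepted move, by
translation of \<open>x\<close> and reflection of \<open>z\<close>.
\<close>

lemma gibbs_accepted_flow:
  assumes [measurable]: "F \<in> borel_measurable borel"
  shows "(\<integral>\<^sup>+x. (\<integral>\<^sup>+z. ennreal (acc x (s *\<^sub>R z)) * F (x + s *\<^sub>R z) \<partial>std_gaussian) \<partial>gibbs \<beta> U)
       = (\<integral>\<^sup>+x. (\<integral>\<^sup>+z. ennreal (acc x (s *\<^sub>R z)) * F x \<partial>std_gaussian) \<partial>gibbs \<beta> U)"
proof -
  interpret P: pair_sigma_finite "lborel :: 'a measure" "std_gaussian :: 'a measure" ..
  have fub: "(\<integral>\<^sup>+x. ennreal (exp (- \<beta> * U x)) * (\<integral>\<^sup>+z. f x z \<partial>std_gaussian) \<partial>lborel)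
     = (\<integral>\<^sup>+z. (\<integral>\<^sup>+x. ennreal (exp (- \<beta> * U x)) * f x z \<partial>lborel) \<partial>std_gaussian)"
    if [measurable]: "(\<lambda>(x, z). f x z) \<in> borel_measurable (borel \<Otimes>\<^sub>M borel)" for f :: "'a \<Rightarrow> 'a \<Rightarrow> ennreal"
  proof -
    have "(\<integral>\<^sup>+x. ennreal (exp (- \<beta> * U x)) * (\<integral>\<^sup>+z. f x z \<partial>std_gaussian) \<partial>lborel)
      = (\<integral>\<^sup>+x. (\<integral>\<^sup>+z. ennreal (exp (- \<beta> * U x)) * f x z \<partial>std_gaussian) \<partial>lborel)"
      by (intro nn_integral_cong nn_integral_cmult[symmetric]) measurable
    also have "\<dots> = (\<integral>\<^sup>+z. (\<integral>\<^sup>+x. ennreal (exp (- \<beta> * U x)) * f x z \<partial>lborel) \<partial>std_gaussian)"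
      by (rule P.Fubini'[symmetric]) measurable
    finally show ?thesis .
  qed
  have "(\<integral>\<^sup>+z. (\<integral>\<^sup>+x. ennreal (exp (- \<beta> * U x)) * (ennreal (acc x (s *\<^sub>R z)) * F (x + s *\<^sub>R z)) \<partial>lborel) \<partial>std_gaussian)
      = (\<integral>\<^sup>+z. (\<integral>\<^sup>+x. ennreal (exp (- \<beta> * U (x + s *\<^sub>R z))) * (ennreal (acc (x + s *\<^sub>R z) (s *\<^sub>R (- z))) * F (x + s *\<^sub>R z)) \<partial>lborel) \<partial>std_gaussian)"
    using acc_detailed_balance
    by (intro nn_integral_cong) (simp add: ennreal_mult'[symmetric] mult.assoc[symmetric] less_imp_le[OF acc_pos])
  also have "\<dots> = (\<integral>\<^sup>+z. (\<integral>\<^sup>+x. ennreal (exp (- \<beta> * U x)) * (ennreal (acc x (s *\<^sub>R (- z))) * F x) \<partial>lborel) \<partial>std_gaussian)"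
    by (intro nn_integral_cong nn_integral_lborel_translate) measurable
  also have "\<dots> = (\<integral>\<^sup>+z. (\<integral>\<^sup>+x. ennreal (exp (- \<beta> * U x)) * (ennreal (acc x (s *\<^sub>R z)) * F x) \<partial>lborel) \<partial>distr std_gaussian borel uminus)"
    by (subst nn_integral_distr) auto
  also have "\<dots> = (\<integral>\<^sup>+z. (\<integral>\<^sup>+x. ennreal (exp (- \<beta> * U x)) * (ennreal (acc x (s *\<^sub>R z)) * F x) \<partial>lborel) \<partial>std_gaussian)"
    by (simp only: distr_std_gaussian_uminus)
  finally have E: "(\<integral>\<^sup>+z. (\<integral>\<^sup>+x. ennreal (exp (- \<beta> * U x)) * (ennreal (acc x (s *\<^sub>R z)) * F (x + s *\<^sub>R z)) \<partial>lborel) \<partial>std_gaussian)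
      = (\<integral>\<^sup>+z. (\<integral>\<^sup>+x. ennreal (exp (- \<beta> * U x)) * (ennreal (acc x (s *\<^sub>R z)) * F x) \<partial>lborel) \<partial>std_gaussian)" .
  have m1: "(\<lambda>(x, z). ennreal (acc x (s *\<^sub>R z)) * F (x + s *\<^sub>R z)) \<in> borel_measurable (borel \<Otimes>\<^sub>M borel)"
    and m2: "(\<lambda>(x, z). ennreal (acc x (s *\<^sub>R z)) * F x) \<in> borel_measurable (borel \<Otimes>\<^sub>M borel)"
    by measurable
  have "(\<lambda>x. \<integral>\<^sup>+z. ennreal (acc x (s *\<^sub>R z)) * F (x + s *\<^sub>R z) \<partial>std_gaussian) \<in> borel_measurable borel"
    "(\<lambda>x. \<integral>\<^sup>+z. ennreal (acc x (s *\<^sub>R z)) * F x \<partial>std_gaussian) \<in> borel_measurable borel"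
    by measurable
  from this[THEN nn_integral_gibbs] show ?thesis
    by (simp only: fub[OF m1] fub[OF m2] E)
qed

lemma gibbs_metropolis_invariant:
  assumes [measurable]: "F \<in> borel_measurable borel"
  shows "(\<integral>\<^sup>+x. (\<integral>\<^sup>+z. ennreal (acc x (s *\<^sub>R z)) * F (x + s *\<^sub>R z)
            + ennreal (1 - acc x (s *\<^sub>R z)) * F x \<partial>std_gaussian) \<partial>gibbs \<beta> U) = (\<integral>\<^sup>+x. F x \<partial>gibbs \<beta> U)"
proof -
  have "(\<integral>\<^sup>+x. (\<integral>\<^sup>+z. ennreal (acc x (s *\<^sub>R z)) * F (x + s *\<^sub>R z)
            + ennreal (1 - acc x (s *\<^sub>R z)) * F x \<partial>std_gaussian) \<partial>gibbs \<beta> U)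
      = (\<integral>\<^sup>+x. (\<integral>\<^sup>+z. ennreal (acc x (s *\<^sub>R z)) * F (x + s *\<^sub>R z) \<partial>std_gaussian) \<partial>gibbs \<beta> U)
      + (\<integral>\<^sup>+x. (\<integral>\<^sup>+z. ennreal (1 - acc x (s *\<^sub>R z)) * F x \<partial>std_gaussian) \<partial>gibbs \<beta> U)"
    by (subst nn_integral_add[symmetric]) (auto intro!: nn_integral_cong nn_integral_add)
  also have "\<dots> = (\<integral>\<^sup>+x. (\<integral>\<^sup>+z. ennreal (acc x (s *\<^sub>R z)) * F x \<partial>std_gaussian) \<partial>gibbs \<beta> U)
      + (\<integral>\<^sup>+x. (\<integral>\<^sup>+z. ennreal (1 - acc x (s *\<^sub>R z)) * F x \<partial>std_gaussian) \<partial>gibbs \<beta> U)"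
    by (simp only: gibbs_accepted_flow[OF assms])
  also have "\<dots> = (\<integral>\<^sup>+x. (\<integral>\<^sup>+z. ennreal (acc x (s *\<^sub>R z)) * F x
            + ennreal (1 - acc x (s *\<^sub>R z)) * F x \<partial>std_gaussian) \<partial>gibbs \<beta> U)"
    by (subst nn_integral_add[symmetric]) (auto intro!: nn_integral_cong nn_integral_add[symmetric])
  also have "\<dots> = (\<integral>\<^sup>+x. (\<integral>\<^sup>+z. F x \<partial>(std_gaussian :: 'a measure)) \<partial>gibbs \<beta> U)"
    by (intro nn_integral_cong)
       (simp add: distrib_right[symmetric] ennreal_plus[symmetric] less_imp_le[OF acc_pos] acc_le_1 del: ennreal_plus)
  also have "\<dots> = (\<integral>\<^sup>+x. F x \<partial>gibbs \<beta> U)"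
    using std_gaussian.emeasure_space_1[where 'a='a] by simp
  finally show ?thesis .
qed

end

section \<open>The joint process\<close>

definition unit_uniform :: "real measure" where
  "unit_uniform = uniform_measure lborel {0..1}"

lemma sets_unit_uniform [measurable_cong, simp]: "sets unit_uniform = sets borel"
  by (simp add: unit_uniform_def)

lemma prob_space_unit_uniform: "prob_space unit_uniform"
  unfolding unit_uniform_def by (rule prob_space_uniform_measure) auto

interpretation unit_uniform: prob_space unit_uniform
  by (rule prob_space_unit_uniform)

lemma nn_integral_unit_uniform_threshold:
  assumes "0 \<le> a" "a \<le> 1"
  shows "(\<integral>\<^sup>+u. (if u \<le> a then P else Q) \<partial>unit_uniform) = ennreal a * P + ennreal (1 - a) * Q"
proof -
  have "(\<integral>\<^sup>+u. (if u \<le> a then P else Q) \<partial>unit_uniform)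
      = (\<integral>\<^sup>+u. (if u \<le> a then P else Q) * indicator {0..1} u \<partial>lborel)"
    unfolding unit_uniform_def by (subst nn_integral_uniform_measure) (auto simp: divide_ennreal_def)
  also have "\<dots> = (\<integral>\<^sup>+u. P * indicator {0..a} u + Q * indicator {a<..1} u \<partial>lborel)"
    using assms by (intro nn_integral_cong) (auto simp: indicator_def)
  also have "\<dots> = P * ennreal a + Q * ennreal (1 - a)"
    using assms by (subst nn_integral_add) (auto simp: nn_integral_cmult)
  finally show ?thesis by (simp add: mult.commute)
qed

abbreviation borel3 :: "('a::euclidean_space \<times> 'a \<times> 'a) measure" where
  "borel3 \<equiv> borel \<Otimes>\<^sub>M (borel \<Otimes>\<^sub>M borel)"

context langevin
begin

definition euler :: "real \<Rightarrow> 'a \<Rightarrow> 'a \<Rightarrow> 'a" where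
  "euler \<gamma> y z = y - \<gamma> *\<^sub>R grad U y + noise \<gamma> *\<^sub>R z"

lemma measurable_euler [measurable (raw)]:
  assumes [measurable]: "f \<in> borel_measurable N" "g \<in> borel_measurable N"
  shows "(\<lambda>w. euler \<gamma> (f w) (g w)) \<in> borel_measurable N"
  unfolding euler_def by measurable

text \<open>
The three components are the \<open>\<pi>\<close>-invariant chain, the algorithm started from \<open>\<pi>\<close> and the algorithm
started from \<open>\<xi>\<close>. All of them use the same Gaussian increment; the uniform variable decides about acceptance.
\<close>

definition joint_step :: "real \<Rightarrow> 'a \<times> 'a \<times> 'a \<Rightarrow> 'a \<times> real \<Rightarrow> 'a \<times> 'a \<times> 'a" where
  "joint_step \<gamma> s w =
     (if snd w \<le> acc (fst s) (noise \<gamma> *\<^sub>R fst w) then fst s + noise \<gamma> *\<^sub>R fst w else fst s,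
      euler \<gamma> (fst (snd s)) (fst w), euler \<gamma> (snd (snd s)) (fst w))"

text \<open>
The initial coupling \<open>\<rho>\<close> has the law of \<open>\<xi>\<close> as its first and \<open>\<pi>\<close> as its second marginal; the first two components
start at the same point.
\<close>

primrec joint :: "real \<Rightarrow> ('a \<times> 'a) measure \<Rightarrow> nat \<Rightarrow> ('a \<times> 'a \<times> 'a) measure" where
  "joint \<gamma> \<rho> 0 = distr \<rho> borel3 (\<lambda>q. (snd q, snd q, fst q))"
| "joint \<gamma> \<rho> (Suc n) = distr (joint \<gamma> \<rho> n \<Otimes>\<^sub>M (std_gaussian \<Otimes>\<^sub>M unit_uniform)) borel3
     (\<lambda>q. joint_step \<gamma> (fst q) (snd q))"

lemma sets_joint [measurable_cong, simp]: "sets (joint \<gamma> \<rho> n) = sets borel3"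
  by (cases n) auto

lemma measurable_joint_step [measurable]:
  "(\<lambda>q. joint_step \<gamma> (fst q) (snd q)) \<in> borel3 \<Otimes>\<^sub>M (std_gaussian \<Otimes>\<^sub>M unit_uniform) \<rightarrow>\<^sub>M borel3"
  unfolding joint_step_def by measurable

lemma prob_space_joint:
  assumes "prob_space \<rho>" "sets \<rho> = sets (borel \<Otimes>\<^sub>M borel)"
  shows "prob_space (joint \<gamma> \<rho> n)"
proof (induction n)
  case 0
  note [measurable_cong] = assms(2)
  show ?case unfolding joint.simps by (rule prob_space.prob_space_distr[OF assms(1)]) measurable
next
  case (Suc n)
  have "prob_space (joint \<gamma> \<rho> n \<Otimes>\<^sub>M (std_gaussian \<Otimes>\<^sub>M unit_uniform))"
    by (intro prob_space_pair Suc prob_space_std_gaussian prob_space_unit_uniform)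
  then show ?case unfolding joint.simps by (rule prob_space.prob_space_distr) measurable
qed

lemma nn_integral_joint_0:
  assumes [measurable]: "F \<in> borel_measurable borel3" and [measurable_cong]: "sets \<rho> = sets (borel \<Otimes>\<^sub>M borel)"
  shows "(\<integral>\<^sup>+s. F s \<partial>joint \<gamma> \<rho> 0) = (\<integral>\<^sup>+q. F (snd q, snd q, fst q) \<partial>\<rho>)"
  unfolding joint.simps by (rule nn_integral_distr) measurable

lemma nn_integral_joint_Suc:
  assumes [measurable]: "F \<in> borel_measurable borel3"
  shows "(\<integral>\<^sup>+s. F s \<partial>joint \<gamma> \<rho> (Suc n)) =
    (\<integral>\<^sup>+s. (\<integral>\<^sup>+z.
        ennreal (acc (fst s) (noise \<gamma> *\<^sub>R z))
          * F (fst s + noise \<gamma> *\<^sub>R z, euler \<gamma> (fst (snd s)) z, euler \<gamma> (snd (snd s)) z)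
      + ennreal (1 - acc (fst s) (noise \<gamma> *\<^sub>R z))
          * F (fst s, euler \<gamma> (fst (snd s)) z, euler \<gamma> (snd (snd s)) z) \<partial>std_gaussian) \<partial>joint \<gamma> \<rho> n)"
proof -
  interpret R: pair_prob_space "std_gaussian :: 'a measure" unit_uniform ..
  have "(\<integral>\<^sup>+s. F s \<partial>joint \<gamma> \<rho> (Suc n))
      = (\<integral>\<^sup>+q. F (joint_step \<gamma> (fst q) (snd q)) \<partial>(joint \<gamma> \<rho> n \<Otimes>\<^sub>M (std_gaussian \<Otimes>\<^sub>M unit_uniform)))"
    unfolding joint.simps by (rule nn_integral_distr) measurable
  also have "\<dots> = (\<integral>\<^sup>+s. (\<integral>\<^sup>+w. F (joint_step \<gamma> s w) \<partial>(std_gaussian \<Otimes>\<^sub>M unit_uniform)) \<partial>joint \<gamma> \<rho> n)"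
  proof -
    have "(\<lambda>q. F (joint_step \<gamma> (fst q) (snd q)))
        \<in> borel_measurable (joint \<gamma> \<rho> n \<Otimes>\<^sub>M (std_gaussian \<Otimes>\<^sub>M unit_uniform))" by measurable
    from R.nn_integral_fst[OF this] show ?thesis by simp
  qed
  also have "\<dots> = (\<integral>\<^sup>+s. (\<integral>\<^sup>+z. (\<integral>\<^sup>+u. F (joint_step \<gamma> s (z, u)) \<partial>unit_uniform) \<partial>std_gaussian) \<partial>joint \<gamma> \<rho> n)"
  proof (intro nn_integral_cong)
    fix s :: "'a \<times> 'a \<times> 'a"
    have "(\<lambda>w. (s, w)) \<in> std_gaussian \<Otimes>\<^sub>M unit_uniform \<rightarrow>\<^sub>M borel3 \<Otimes>\<^sub>M (std_gaussian \<Otimes>\<^sub>M unit_uniform)"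
      by (rule measurable_Pair1') (simp add: space_pair_measure)
    from measurable_compose[OF this measurable_joint_step[of \<gamma>]]
    have [measurable]: "joint_step \<gamma> s \<in> std_gaussian \<Otimes>\<^sub>M unit_uniform \<rightarrow>\<^sub>M borel3" by simp
    show "(\<integral>\<^sup>+w. F (joint_step \<gamma> s w) \<partial>(std_gaussian \<Otimes>\<^sub>M unit_uniform))
        = (\<integral>\<^sup>+z. (\<integral>\<^sup>+u. F (joint_step \<gamma> s (z, u)) \<partial>unit_uniform) \<partial>std_gaussian)"
      by (rule unit_uniform.nn_integral_fst[symmetric]) measurable
  qed
  also have "\<dots> = (\<integral>\<^sup>+s. (\<integral>\<^sup>+z.
        ennreal (acc (fst s) (noise \<gamma> *\<^sub>R z))
          * F (fst s + noise \<gamma> *\<^sub>R z, euler \<gamma> (fst (snd s)) z, euler \<gamma> (snd (snd s)) z)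
      + ennreal (1 - acc (fst s) (noise \<gamma> *\<^sub>R z))
          * F (fst s, euler \<gamma> (fst (snd s)) z, euler \<gamma> (snd (snd s)) z) \<partial>std_gaussian) \<partial>joint \<gamma> \<rho> n)"
  proof (intro nn_integral_cong)
    fix s z
    show "(\<integral>\<^sup>+u. F (joint_step \<gamma> s (z, u)) \<partial>unit_uniform) =
        ennreal (acc (fst s) (noise \<gamma> *\<^sub>R z))
          * F (fst s + noise \<gamma> *\<^sub>R z, euler \<gamma> (fst (snd s)) z, euler \<gamma> (snd (snd s)) z)
      + ennreal (1 - acc (fst s) (noise \<gamma> *\<^sub>R z))
          * F (fst s, euler \<gamma> (fst (snd s)) z, euler \<gamma> (snd (snd s)) z)"
      by (subst nn_integral_unit_uniform_threshold[symmetric])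
         (auto simp: joint_step_def less_imp_le[OF acc_pos] acc_le_1 intro!: nn_integral_cong)
  qed
  finally show ?thesis .
qed

lemma acc_mixture_const [simp]:
  "ennreal (acc x v) * c + ennreal (1 - acc x v) * c = c"
  by (simp add: distrib_right[symmetric] ennreal_plus[symmetric] less_imp_le[OF acc_pos] acc_le_1 del: ennreal_plus)

lemma joint_fst_gibbs:
  assumes [measurable]: "F \<in> borel_measurable borel"
    and sets[measurable_cong]: "sets \<rho> = sets (borel \<Otimes>\<^sub>M borel)" and gibbs: "distr \<rho> borel snd = gibbs \<beta> U"
  shows "(\<integral>\<^sup>+s. F (fst s) \<partial>joint \<gamma> \<rho> n) = (\<integral>\<^sup>+x. F x \<partial>gibbs \<beta> U)"
  using assms(1)
proof (induction n arbitrary: F)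
  case 0
  note [measurable] = 0
  have "(\<integral>\<^sup>+s. F (fst s) \<partial>joint \<gamma> \<rho> 0) = (\<integral>\<^sup>+q. F (snd q) \<partial>\<rho>)"
    by (subst nn_integral_joint_0) (auto simp: sets)
  also have "\<dots> = (\<integral>\<^sup>+x. F x \<partial>distr \<rho> borel snd)"
    by (rule nn_integral_distr[symmetric]) measurable
  finally show ?case by (simp add: gibbs)
next
  case (Suc n)
  note [measurable] = Suc.prems
  have "(\<integral>\<^sup>+s. F (fst s) \<partial>joint \<gamma> \<rho> (Suc n)) = (\<integral>\<^sup>+s. (\<integral>\<^sup>+z.
        ennreal (acc (fst s) (noise \<gamma> *\<^sub>R z)) * F (fst s + noise \<gamma> *\<^sub>R z)
      + ennreal (1 - acc (fst s) (noise \<gamma> *\<^sub>R z)) * F (fst s) \<partial>std_gaussian) \<partial>joint \<gamma> \<rho> n)"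
    by (subst nn_integral_joint_Suc) auto
  also have "\<dots> = (\<integral>\<^sup>+x. (\<integral>\<^sup>+z.
        ennreal (acc x (noise \<gamma> *\<^sub>R z)) * F (x + noise \<gamma> *\<^sub>R z)
      + ennreal (1 - acc x (noise \<gamma> *\<^sub>R z)) * F x \<partial>std_gaussian) \<partial>gibbs \<beta> U)"
    by (rule Suc.IH) measurable
  also have "\<dots> = (\<integral>\<^sup>+x. F x \<partial>gibbs \<beta> U)" by (rule gibbs_metropolis_invariant) measurable
  finally show ?case .
qed

lemma joint_euler_Suc:
  assumes [measurable]: "F \<in> borel_measurable (borel \<Otimes>\<^sub>M borel)"
  shows "(\<integral>\<^sup>+s. F (snd s) \<partial>joint \<gamma> \<rho> (Suc n))
    = (\<integral>\<^sup>+s. (\<integral>\<^sup>+z. F (euler \<gamma> (fst (snd s)) z, euler \<gamma> (snd (snd s)) z) \<partial>std_gaussian) \<partial>joint \<gamma> \<rho> n)"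
  by (subst nn_integral_joint_Suc) auto

lemma nn_integral_euler_compl_dom:
  assumes "\<gamma> > 0"
  shows "(\<integral>\<^sup>+z. indicator (- grad_dom U) (euler \<gamma> y z) \<partial>std_gaussian) = 0"
  unfolding euler_def using noise_pos[OF assms]
  by (intro null_lborel_affine_std_gaussian compl_dom_null) auto

lemma joint_AE_dom:
  assumes g: "g = (\<lambda>s. fst (snd s)) \<or> g = (\<lambda>s. snd (snd s))" and "\<gamma> > 0"
    and sets[measurable_cong]: "sets \<rho> = sets (borel \<Otimes>\<^sub>M borel)" and gibbs: "distr \<rho> borel snd = gibbs \<beta> U"
    and init: "AE q in \<rho>. fst q \<in> grad_dom U"
  shows "AE s in joint \<gamma> \<rho> n. g s \<in> grad_dom U"
proof -
  have [measurable]: "g \<in> borel_measurable borel3" using g by auto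
  have "(\<integral>\<^sup>+s. indicator (- grad_dom U) (g s) \<partial>joint \<gamma> \<rho> n) = 0"
  proof (cases n)
    case 0
    have "(\<integral>\<^sup>+q. indicator (- grad_dom U) (snd q) \<partial>\<rho>) = (\<integral>\<^sup>+x. indicator (- grad_dom U) x \<partial>distr \<rho> borel snd)"
      by (rule nn_integral_distr[symmetric]) measurable
    then have 1: "(\<integral>\<^sup>+q. indicator (- grad_dom U) (snd q) \<partial>\<rho>) = 0"
      unfolding gibbs by (simp only: gibbs_null_compl_dom)
    have "AE q in \<rho>. indicator (- grad_dom U) (fst q) = (0::ennreal)"
      using init by eventually_elim simp
    then have 2: "(\<integral>\<^sup>+q. indicator (- grad_dom U) (fst q) \<partial>\<rho>) = 0"
      by (subst nn_integral_0_iff_AE) auto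
    show ?thesis unfolding 0 using g
    proof
      assume "g = (\<lambda>s. fst (snd s))" then show "(\<integral>\<^sup>+s. indicator (- grad_dom U) (g s) \<partial>joint \<gamma> \<rho> 0) = 0"
        by (subst nn_integral_joint_0) (auto simp: sets 1)
    next
      assume "g = (\<lambda>s. snd (snd s))" then show "(\<integral>\<^sup>+s. indicator (- grad_dom U) (g s) \<partial>joint \<gamma> \<rho> 0) = 0"
        by (subst nn_integral_joint_0) (auto simp: sets 2)
    qed
  next
    case (Suc k)
    show ?thesis unfolding Suc using g
    proof
      assume "g = (\<lambda>s. fst (snd s))" then show "(\<integral>\<^sup>+s. indicator (- grad_dom U) (g s) \<partial>joint \<gamma> \<rho> (Suc k)) = 0"
        using joint_euler_Suc[of "\<lambda>p. indicator (- grad_dom U) (fst p)" \<gamma> \<rho> k]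
        by (simp add: nn_integral_euler_compl_dom[OF assms(2)])
    next
      assume "g = (\<lambda>s. snd (snd s))" then show "(\<integral>\<^sup>+s. indicator (- grad_dom U) (g s) \<partial>joint \<gamma> \<rho> (Suc k)) = 0"
        using joint_euler_Suc[of "\<lambda>p. indicator (- grad_dom U) (snd p)" \<gamma> \<rho> k]
        by (simp add: nn_integral_euler_compl_dom[OF assms(2)])
    qed
  qed
  then have "AE s in joint \<gamma> \<rho> n. indicator (- grad_dom U) (g s) = (0::ennreal)"
    by (subst (asm) nn_integral_0_iff_AE) auto
  then show ?thesis by eventually_elim (auto simp: indicator_def split: if_splits)
qed

text \<open>
The one-step bound is integrated over the current joint law. Its error term depends only on the
invariant chain, whose moments are those of \<open>\<pi>\<close> at all times, so the recursion closes.
The distance from the first component is bounded in the same way for both copies of the algorithm: for the copy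
started from \<open>\<pi>\<close> the initial term vanishes, for the other one the bound yields moments.
\<close>

lemma joint_distance_moment:
  obtains C where "C > 0"
    and "\<And>\<gamma> \<rho> n g. 0 < \<gamma> \<Longrightarrow> \<gamma> \<le> \<gamma>0 \<Longrightarrow> g = (\<lambda>s. fst (snd s)) \<or> g = (\<lambda>s. snd (snd s)) \<Longrightarrow>
      sets \<rho> = sets (borel \<Otimes>\<^sub>M borel) \<Longrightarrow> distr \<rho> borel snd = gibbs \<beta> U \<Longrightarrow>
      AE q in \<rho>. fst q \<in> grad_dom U \<Longrightarrow>
      (\<integral>\<^sup>+s. ennreal (norm (fst s - g s) ^ (2 * Suc k)) \<partial>joint \<gamma> \<rho> n)
      \<le> (\<integral>\<^sup>+s. ennreal (norm (fst s - g s) ^ (2 * Suc k)) \<partial>joint \<gamma> \<rho> 0) + ennreal (C * noise \<gamma> ^ Suc k)"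
proof -
  obtain c K where c: "c > 0" "c * \<gamma>0 \<le> 1" and K: "K > 0"
    and step: "\<And>\<gamma> X Y. 0 < \<gamma> \<Longrightarrow> \<gamma> \<le> \<gamma>0 \<Longrightarrow> Y \<in> grad_dom U \<Longrightarrow>
      (\<integral>\<^sup>+z. ennreal (acc X (noise \<gamma> *\<^sub>R z) * norm (X - Y + \<gamma> *\<^sub>R grad U Y) ^ (2 * Suc k)
          + (1 - acc X (noise \<gamma> *\<^sub>R z)) * norm (X - Y + \<gamma> *\<^sub>R grad U Y - noise \<gamma> *\<^sub>R z) ^ (2 * Suc k)) \<partial>std_gaussian)
      \<le> ennreal ((1 - c * \<gamma>) * norm (X - Y) ^ (2 * Suc k) + K * \<gamma> * noise \<gamma> ^ Suc k * (1 + norm X) ^ (4 * Suc k))"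
    using one_step_drift[of k] by blast
  define P where "P = enn2real (\<integral>\<^sup>+x. ennreal ((1 + norm x) ^ (4 * Suc k)) \<partial>gibbs \<beta> U)"
  have P: "(\<integral>\<^sup>+x. ennreal ((1 + norm x) ^ (4 * Suc k)) \<partial>gibbs \<beta> U) = ennreal P"
    using gibbs_moment[of "4 * Suc k"] by (simp add: P_def less_top)
  have P0: "P \<ge> 0" by (simp add: P_def)
  define C where "C = K * P / c + 1"
  show ?thesis
  proof (rule that[of C])
    show "C > 0" using K P0 c by (simp add: C_def add_nonneg_pos)
    fix \<gamma> :: real and \<rho> :: "('a \<times> 'a) measure" and n and g :: "'a \<times> 'a \<times> 'a \<Rightarrow> 'a"
    assume gam: "0 < \<gamma>" "\<gamma> \<le> \<gamma>0" and g: "g = (\<lambda>s. fst (snd s)) \<or> g = (\<lambda>s. snd (snd s))"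
      and sets: "sets \<rho> = sets (borel \<Otimes>\<^sub>M borel)" and gibbs: "distr \<rho> borel snd = gibbs \<beta> U"
      and init: "AE q in \<rho>. fst q \<in> grad_dom U"
    have [measurable]: "g \<in> borel_measurable borel3" using g by auto
    have cg: "0 \<le> c * \<gamma>" "c * \<gamma> \<le> 1"
      using c(1) gam(1) order_trans[OF mult_left_mono[OF gam(2), of c] c(2)] by auto
    define a where "a n = (\<integral>\<^sup>+s. ennreal (norm (fst s - g s) ^ (2 * Suc k)) \<partial>joint \<gamma> \<rho> n)" for n
    define B where "B = K * P / c * noise \<gamma> ^ Suc k"
    have B: "B \<ge> 0" using K P0 c noise_pos[OF gam(1)] by (simp add: B_def)
    have rec: "a (Suc n) \<le> ennreal (1 - c * \<gamma>) * a n + ennreal (c * \<gamma>) * ennreal B" for n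
    proof -
      have "a (Suc n) = (\<integral>\<^sup>+s. (\<integral>\<^sup>+z. ennreal (acc (fst s) (noise \<gamma> *\<^sub>R z) * norm (fst s - g s + \<gamma> *\<^sub>R grad U (g s)) ^ (2 * Suc k)
          + (1 - acc (fst s) (noise \<gamma> *\<^sub>R z)) * norm (fst s - g s + \<gamma> *\<^sub>R grad U (g s) - noise \<gamma> *\<^sub>R z) ^ (2 * Suc k)) \<partial>std_gaussian) \<partial>joint \<gamma> \<rho> n)"
      proof -
        have e1: "norm (X + noise \<gamma> *\<^sub>R z - euler \<gamma> Y z) = norm (X - Y + \<gamma> *\<^sub>R grad U Y)"
          and e2: "norm (X - euler \<gamma> Y z) = norm (X - Y + \<gamma> *\<^sub>R grad U Y - noise \<gamma> *\<^sub>R z)" for X Y z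
          by (simp_all add: euler_def algebra_simps)
        have "a (Suc n) = (\<integral>\<^sup>+s. (\<integral>\<^sup>+z. ennreal (acc (fst s) (noise \<gamma> *\<^sub>R z)) * ennreal (norm (fst s + noise \<gamma> *\<^sub>R z - euler \<gamma> (g s) z) ^ (2 * Suc k))
          + ennreal (1 - acc (fst s) (noise \<gamma> *\<^sub>R z)) * ennreal (norm (fst s - euler \<gamma> (g s) z) ^ (2 * Suc k)) \<partial>std_gaussian) \<partial>joint \<gamma> \<rho> n)"
          unfolding a_def using g by (subst nn_integral_joint_Suc) auto
        then show ?thesis
          unfolding e1 unfolding e2
          by (simp only: ennreal_mult'[symmetric] ennreal_plus[symmetric] less_imp_le[OF acc_pos] acc_le_1
              diff_ge_0_iff_ge mult_nonneg_nonneg zero_le_power norm_ge_zero)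
      qed
      also have "\<dots> \<le> (\<integral>\<^sup>+s. ennreal ((1 - c * \<gamma>) * norm (fst s - g s) ^ (2 * Suc k) + K * \<gamma> * noise \<gamma> ^ Suc k * (1 + norm (fst s)) ^ (4 * Suc k)) \<partial>joint \<gamma> \<rho> n)"
        using joint_AE_dom[OF g gam(1) sets gibbs init, of n]
        by (intro nn_integral_mono_AE, eventually_elim) (rule step[OF gam])
      also have "\<dots> = (\<integral>\<^sup>+s. ennreal (1 - c * \<gamma>) * ennreal (norm (fst s - g s) ^ (2 * Suc k))
          + ennreal (K * \<gamma> * noise \<gamma> ^ Suc k) * ennreal ((1 + norm (fst s)) ^ (4 * Suc k)) \<partial>joint \<gamma> \<rho> n)"
        using cg K gam noise_pos[OF gam(1)]
        by (intro nn_integral_cong) (subst ennreal_plus, auto simp: ennreal_mult' simp del: power_Suc)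
      also have "\<dots> = ennreal (1 - c * \<gamma>) * a n + ennreal (K * \<gamma> * noise \<gamma> ^ Suc k) * (\<integral>\<^sup>+s. ennreal ((1 + norm (fst s)) ^ (4 * Suc k)) \<partial>joint \<gamma> \<rho> n)"
        unfolding a_def by (subst nn_integral_add) (auto simp: nn_integral_cmult simp del: power_Suc)
      also have "(\<integral>\<^sup>+s. ennreal ((1 + norm (fst s)) ^ (4 * Suc k)) \<partial>joint \<gamma> \<rho> n) = ennreal P"
        unfolding P[symmetric] by (rule joint_fst_gibbs[OF _ sets gibbs]) measurable
      also have "ennreal (K * \<gamma> * noise \<gamma> ^ Suc k) * ennreal P = ennreal (c * \<gamma>) * ennreal B"
        using c P0 cg by (simp add: B_def ennreal_mult'[symmetric] ennreal_mult''[symmetric] mult_ac)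
      finally show ?thesis .
    qed
    have main: "a n \<le> a 0 + ennreal B" for n
    proof (induction n)
      case (Suc n)
      have "a (Suc n) \<le> ennreal (1 - c * \<gamma>) * (a 0 + ennreal B) + ennreal (c * \<gamma>) * (a 0 + ennreal B)"
        by (intro order_trans[OF rec] add_mono mult_left_mono Suc) auto
      also have "\<dots> = (ennreal (1 - c * \<gamma>) + ennreal (c * \<gamma>)) * (a 0 + ennreal B)" by (rule distrib_right[symmetric])
      also have "\<dots> = a 0 + ennreal B"
        using cg by (simp add: ennreal_plus[symmetric] del: ennreal_plus)
      finally show ?case .
    qed simp
    have "B \<le> C * noise \<gamma> ^ Suc k"
      using noise_pos[OF gam(1)] by (simp add: B_def C_def distrib_right)
    then have "a 0 + ennreal B \<le> a 0 + ennreal (C * noise \<gamma> ^ Suc k)"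
      by (intro add_mono ennreal_leI) auto
    with main[of n]
    show "(\<integral>\<^sup>+s. ennreal (norm (fst s - g s) ^ (2 * Suc k)) \<partial>joint \<gamma> \<rho> n)
      \<le> (\<integral>\<^sup>+s. ennreal (norm (fst s - g s) ^ (2 * Suc k)) \<partial>joint \<gamma> \<rho> 0) + ennreal (C * noise \<gamma> ^ Suc k)"
      unfolding a_def by (rule order_trans)
  qed
qed

end

section \<open>Synchronous contraction in \<open>L^p\<close>\<close>

lemma powr_convex_nonneg:
  fixes x y t p :: real
  assumes p: "p \<ge> 1" and xy: "x \<ge> 0" "y \<ge> 0" and t: "0 \<le> t" "t \<le> 1"
  shows "(t * x + (1 - t) * y) powr p \<le> t * x powr p + (1 - t) * y powr p"
proof -
  have sc: "(s * u) powr p \<le> s * u powr p" if "0 \<le> s" "s \<le> 1" "u \<ge> 0" for s u :: real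
  proof -
    have "s powr p \<le> s powr 1" using that p by (intro powr_mono') auto
    then show ?thesis using that by (simp add: powr_mult mult_right_mono)
  qed
  consider "x = 0" | "y = 0" | "x > 0" "y > 0" using xy by fastforce
  then show ?thesis
  proof cases
    case 1 then show ?thesis using sc[of "1 - t" y] t xy by simp
  next
    case 2 then show ?thesis using sc[of t x] t xy by simp
  next
    case 3
    then show ?thesis using convex_onD[OF powr_convex[OF p], of "1 - t" x y] t by simp
  qed
qed

text \<open>
Minkowski's inequality, stated with upper bounds \<open>a\<close> and \<open>b\<close> for the norms, which is the form in which a
recursion for \<open>L^p\<close> norms is propagated.
\<close>

lemma nn_integral_powr_Minkowski:
  fixes f g :: "'b \<Rightarrow> real"
  assumes meas[measurable]: "f \<in> borel_measurable N" "g \<in> borel_measurable N"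
    and nn: "\<And>x. f x \<ge> 0" "\<And>x. g x \<ge> 0" and p: "p \<ge> 1" and ab: "a \<ge> 0" "b \<ge> 0"
    and f: "(\<integral>\<^sup>+x. ennreal (f x powr p) \<partial>N) \<le> ennreal (a powr p)"
    and g: "(\<integral>\<^sup>+x. ennreal (g x powr p) \<partial>N) \<le> ennreal (b powr p)"
  shows "(\<integral>\<^sup>+x. ennreal ((f x + g x) powr p) \<partial>N) \<le> ennreal ((a + b) powr p)"
proof -
  have zero: "(\<integral>\<^sup>+x. ennreal ((u x + v x) powr p) \<partial>N) \<le> ennreal ((0 + c) powr p)"
    if [measurable]: "u \<in> borel_measurable N" "v \<in> borel_measurable N"
      and u: "(\<integral>\<^sup>+x. ennreal (u x powr p) \<partial>N) \<le> ennreal (0 powr p)"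
      and v: "(\<integral>\<^sup>+x. ennreal (v x powr p) \<partial>N) \<le> ennreal (c powr p)" for u v :: "'b \<Rightarrow> real" and c
  proof -
    have "(\<integral>\<^sup>+x. ennreal (u x powr p) \<partial>N) = 0" using u by simp
    then have "AE x in N. ennreal (u x powr p) = 0" by (subst (asm) nn_integral_0_iff_AE) auto
    then have "AE x in N. u x = 0"
    proof eventually_elim
      fix x assume "ennreal (u x powr p) = 0"
      then have "u x powr p \<le> 0" by (simp add: ennreal_eq_0_iff)
      then show "u x = 0" using powr_ge_zero[of "u x" p] by (simp add: order_antisym_conv)
    qed
    then have "(\<integral>\<^sup>+x. ennreal ((u x + v x) powr p) \<partial>N) = (\<integral>\<^sup>+x. ennreal (v x powr p) \<partial>N)"
      by (intro nn_integral_cong_AE, eventually_elim) simp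
    then show ?thesis using v by simp
  qed
  consider "a = 0" | "b = 0" | "a > 0" "b > 0" using ab by fastforce
  then show ?thesis
  proof cases
    case 1 then show ?thesis using zero[of f g b] f g by simp
  next
    case 2 then show ?thesis using zero[of g f a] f g by (simp add: add.commute)
  next
    case 3
    define t where "t = a / (a + b)"
    have t: "0 \<le> t" "t \<le> 1" "1 - t = b / (a + b)" using 3 by (auto simp: t_def field_simps)
    define A where "A = (a + b) powr p * t / a powr p"
    define B where "B = (a + b) powr p * (1 - t) / b powr p"
    have AB: "A \<ge> 0" "B \<ge> 0" using t 3 by (auto simp: A_def B_def)
    have pt: "(f x + g x) powr p \<le> A * f x powr p + B * g x powr p" for x
    proof -
      have "f x + g x = (a + b) * (t * (f x / a) + (1 - t) * (g x / b))"
      proof -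
        have "t * (f x / a) + (1 - t) * (g x / b) = f x / (a + b) + g x / (a + b)"
          using 3 unfolding t(3) by (simp add: t_def)
        then show ?thesis using 3 by (simp add: add_divide_distrib[symmetric])
      qed
      then have "(f x + g x) powr p = (a + b) powr p * (t * (f x / a) + (1 - t) * (g x / b)) powr p"
        using 3 nn t by (simp only: powr_mult)
      also have "\<dots> \<le> (a + b) powr p * (t * (f x / a) powr p + (1 - t) * (g x / b) powr p)"
        using 3 nn t by (intro mult_left_mono powr_convex_nonneg p) auto
      also have "\<dots> = A * f x powr p + B * g x powr p"
        using 3 nn by (simp add: A_def B_def powr_divide algebra_simps)
      finally show ?thesis .
    qed
    have "(\<integral>\<^sup>+x. ennreal ((f x + g x) powr p) \<partial>N)
       \<le> (\<integral>\<^sup>+x. ennreal A * ennreal (f x powr p) + ennreal B * ennreal (g x powr p) \<partial>N)"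
    proof (intro nn_integral_mono)
      fix x
      have "ennreal ((f x + g x) powr p) \<le> ennreal (A * f x powr p + B * g x powr p)" by (rule ennreal_leI[OF pt])
      also have "\<dots> = ennreal A * ennreal (f x powr p) + ennreal B * ennreal (g x powr p)"
        using AB by (simp add: ennreal_mult)
      finally show "ennreal ((f x + g x) powr p) \<le> ennreal A * ennreal (f x powr p) + ennreal B * ennreal (g x powr p)" .
    qed
    also have "\<dots> = ennreal A * (\<integral>\<^sup>+x. ennreal (f x powr p) \<partial>N) + ennreal B * (\<integral>\<^sup>+x. ennreal (g x powr p) \<partial>N)"
      by (subst nn_integral_add) (auto simp: nn_integral_cmult)
    also have "\<dots> \<le> ennreal A * ennreal (a powr p) + ennreal B * ennreal (b powr p)"
      by (intro add_mono mult_left_mono f g) auto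
    also have "\<dots> = ennreal (A * a powr p + B * b powr p)"
      using AB by (simp add: ennreal_mult)
    also have "A * a powr p + B * b powr p = (a + b) powr p"
    proof -
      have "A * a powr p = (a + b) powr p * t" "B * b powr p = (a + b) powr p * (1 - t)"
        using 3 by (simp_all add: A_def B_def)
      then show ?thesis by (simp add: algebra_simps)
    qed
    finally show ?thesis .
  qed
qed

lemma nn_integral_powr_scale:
  fixes f :: "'b \<Rightarrow> real"
  assumes [measurable]: "f \<in> borel_measurable N" and nn: "\<And>x. f x \<ge> 0" "c \<ge> 0" "a \<ge> 0"
    and f: "(\<integral>\<^sup>+x. ennreal (f x powr p) \<partial>N) \<le> ennreal (a powr p)"
  shows "(\<integral>\<^sup>+x. ennreal ((c * f x) powr p) \<partial>N) \<le> ennreal ((c * a) powr p)"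
proof -
  have "(\<integral>\<^sup>+x. ennreal ((c * f x) powr p) \<partial>N) = (\<integral>\<^sup>+x. ennreal (c powr p) * ennreal (f x powr p) \<partial>N)"
    using nn by (intro nn_integral_cong) (simp add: powr_mult ennreal_mult)
  also have "\<dots> = ennreal (c powr p) * (\<integral>\<^sup>+x. ennreal (f x powr p) \<partial>N)"
    by (rule nn_integral_cmult) measurable
  also have "\<dots> \<le> ennreal (c powr p) * ennreal (a powr p)" by (intro mult_left_mono f) auto
  also have "\<dots> = ennreal ((c * a) powr p)" using nn by (simp add: powr_mult ennreal_mult)
  finally show ?thesis .
qed

lemma sum_power_le:
  fixes u w :: real
  assumes "u \<ge> 0" "w \<ge> 0"
  shows "(u + w) ^ k \<le> 2 ^ k * (u ^ k + w ^ k)"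
proof -
  have "(u + w) ^ k \<le> (2 * max u w) ^ k" using assms by (intro power_mono) auto
  also have "\<dots> = 2 ^ k * (max u w) ^ k" by (simp add: power_mult_distrib)
  also have "\<dots> \<le> 2 ^ k * (u ^ k + w ^ k)"
    using assms by (intro mult_left_mono) (auto simp: max_def)
  finally show ?thesis .
qed

context langevin
begin

text \<open>
Moments that are uniform in time and step size, obtained from the stationary chain and the distance to it.
\<close>

lemma joint_moment_bound:
  assumes \<Xi>: "\<Xi> \<ge> 0"
  obtains C where "C \<ge> 1"
    and "\<And>\<gamma> \<rho> n g. 0 < \<gamma> \<Longrightarrow> \<gamma> \<le> \<gamma>0 \<Longrightarrow> g = (\<lambda>s. fst (snd s)) \<or> g = (\<lambda>s. snd (snd s)) \<Longrightarrow>
      sets \<rho> = sets (borel \<Otimes>\<^sub>M borel) \<Longrightarrow> distr \<rho> borel snd = gibbs \<beta> U \<Longrightarrow>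
      AE q in \<rho>. fst q \<in> grad_dom U \<Longrightarrow>
      (\<integral>\<^sup>+q. ennreal ((1 + norm (fst q)) ^ (2 * Suc k)) \<partial>\<rho>) \<le> ennreal \<Xi> \<Longrightarrow>
      (\<integral>\<^sup>+s. ennreal ((1 + norm (g s)) ^ (2 * Suc k)) \<partial>joint \<gamma> \<rho> n) \<le> ennreal C"
proof -
  define N where "N = 2 * Suc k"
  obtain C0 where C0: "C0 > 0"
    and dist: "\<And>\<gamma> \<rho> n g. 0 < \<gamma> \<Longrightarrow> \<gamma> \<le> \<gamma>0 \<Longrightarrow> g = (\<lambda>s. fst (snd s)) \<or> g = (\<lambda>s. snd (snd s)) \<Longrightarrow>
      sets \<rho> = sets (borel \<Otimes>\<^sub>M borel) \<Longrightarrow> distr \<rho> borel snd = gibbs \<beta> U \<Longrightarrow>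
      AE q in \<rho>. fst q \<in> grad_dom U \<Longrightarrow>
      (\<integral>\<^sup>+s. ennreal (norm (fst s - g s) ^ N) \<partial>joint \<gamma> \<rho> n)
      \<le> (\<integral>\<^sup>+s. ennreal (norm (fst s - g s) ^ N) \<partial>joint \<gamma> \<rho> 0) + ennreal (C0 * noise \<gamma> ^ Suc k)"
    using joint_distance_moment[of k] unfolding N_def by blast
  define P where "P = enn2real (\<integral>\<^sup>+x. ennreal ((1 + norm x) ^ N) \<partial>gibbs \<beta> U)"
  have P: "(\<integral>\<^sup>+x. ennreal ((1 + norm x) ^ N) \<partial>gibbs \<beta> U) = ennreal P"
    using gibbs_moment[of N] by (simp add: P_def less_top)
  have P0: "P \<ge> 0" by (simp add: P_def)
  define D where "D = 2 ^ N * (P + \<Xi>) + C0 * noise0 ^ Suc k"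
  have D: "D \<ge> 0" using P0 \<Xi> C0 noise0_pos by (simp add: D_def)
  define C where "C = 2 ^ N * (P + D) + 1"
  show ?thesis
  proof (rule that[of C])
    show "C \<ge> 1" using P0 D by (simp add: C_def)
    fix \<gamma> :: real and \<rho> :: "('a \<times> 'a) measure" and n and g :: "'a \<times> 'a \<times> 'a \<Rightarrow> 'a"
    assume gam: "0 < \<gamma>" "\<gamma> \<le> \<gamma>0" and g: "g = (\<lambda>s. fst (snd s)) \<or> g = (\<lambda>s. snd (snd s))"
      and sets[measurable_cong]: "sets \<rho> = sets (borel \<Otimes>\<^sub>M borel)" and gibbs: "distr \<rho> borel snd = gibbs \<beta> U"
      and init: "AE q in \<rho>. fst q \<in> grad_dom U"
      and mom: "(\<integral>\<^sup>+q. ennreal ((1 + norm (fst q)) ^ (2 * Suc k)) \<partial>\<rho>) \<le> ennreal \<Xi>"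
    have [measurable]: "g \<in> borel_measurable borel3" using g by auto
    have Prho: "(\<integral>\<^sup>+q. ennreal ((1 + norm (snd q)) ^ N) \<partial>\<rho>) = ennreal P"
    proof -
      have "(\<integral>\<^sup>+q. ennreal ((1 + norm (snd q)) ^ N) \<partial>\<rho>) = (\<integral>\<^sup>+x. ennreal ((1 + norm x) ^ N) \<partial>distr \<rho> borel snd)"
        by (rule nn_integral_distr[symmetric]) measurable
      then show ?thesis by (simp only: gibbs P)
    qed
    have split: "(\<integral>\<^sup>+s. ennreal (2 ^ N * (u s ^ N + w s ^ N)) \<partial>M)
       = ennreal (2 ^ N) * ((\<integral>\<^sup>+s. ennreal (u s ^ N) \<partial>M) + (\<integral>\<^sup>+s. ennreal (w s ^ N) \<partial>M))"
      if [measurable]: "u \<in> borel_measurable M" "w \<in> borel_measurable M" and "\<And>s. u s \<ge> 0" "\<And>s. w s \<ge> 0"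
      for u w :: "'b \<Rightarrow> real" and M
    proof -
      have "(\<integral>\<^sup>+s. ennreal (2 ^ N * (u s ^ N + w s ^ N)) \<partial>M)
        = (\<integral>\<^sup>+s. ennreal (2 ^ N) * (ennreal (u s ^ N) + ennreal (w s ^ N)) \<partial>M)"
        using that by (intro nn_integral_cong) (simp add: ennreal_mult)
      then show ?thesis by (simp add: nn_integral_cmult nn_integral_add)
    qed
    have "(\<integral>\<^sup>+s. ennreal (norm (fst s - g s) ^ N) \<partial>joint \<gamma> \<rho> 0)
       \<le> (\<integral>\<^sup>+q. ennreal (2 ^ N * ((1 + norm (snd q)) ^ N + (1 + norm (fst q)) ^ N)) \<partial>\<rho>)"
    proof (subst nn_integral_joint_0)
      have "norm (snd q - g (snd q, snd q, fst q)) \<le> (1 + norm (snd q)) + (1 + norm (fst q))" for q :: "'a \<times> 'a"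
        using g norm_triangle_ineq4[of "snd q" "fst q"] by auto
      then have "norm (snd q - g (snd q, snd q, fst q)) ^ N \<le> 2 ^ N * ((1 + norm (snd q)) ^ N + (1 + norm (fst q)) ^ N)" for q :: "'a \<times> 'a"
        by (intro order_trans[OF power_mono sum_power_le]) auto
      then show "(\<integral>\<^sup>+q. ennreal (norm (fst (snd q, snd q, fst q) - g (snd q, snd q, fst q)) ^ N) \<partial>\<rho>)
         \<le> (\<integral>\<^sup>+q. ennreal (2 ^ N * ((1 + norm (snd q)) ^ N + (1 + norm (fst q)) ^ N)) \<partial>\<rho>)"
        by (intro nn_integral_mono ennreal_leI) simp
    qed (auto simp: sets)
    also have "\<dots> = ennreal (2 ^ N) * (ennreal P + (\<integral>\<^sup>+q. ennreal ((1 + norm (fst q)) ^ N) \<partial>\<rho>))"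
      by (subst split) (auto simp: Prho)
    also have "\<dots> \<le> ennreal (2 ^ N) * (ennreal P + ennreal \<Xi>)"
      using mom by (intro mult_left_mono add_mono) (auto simp: N_def)
    also have "\<dots> = ennreal (2 ^ N * (P + \<Xi>))" using P0 \<Xi> by (simp add: ennreal_mult)
    finally have "(\<integral>\<^sup>+s. ennreal (norm (fst s - g s) ^ N) \<partial>joint \<gamma> \<rho> 0) \<le> ennreal (2 ^ N * (P + \<Xi>))" .
    from order_trans[OF dist[OF gam g sets gibbs init] add_mono[OF this order_refl]]
    have "(\<integral>\<^sup>+s. ennreal (norm (fst s - g s) ^ N) \<partial>joint \<gamma> \<rho> n) \<le> ennreal (2 ^ N * (P + \<Xi>)) + ennreal (C0 * noise \<gamma> ^ Suc k)" .
    also have "\<dots> \<le> ennreal (2 ^ N * (P + \<Xi>)) + ennreal (C0 * noise0 ^ Suc k)"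
      using C0 noise_pos[OF gam(1)] noise_mono[OF gam(2)]
      by (intro add_mono ennreal_leI mult_left_mono power_mono) (auto simp: noise0_def)
    also have "\<dots> = ennreal D" using P0 \<Xi> C0 noise0_pos by (simp add: D_def)
    finally have dD: "(\<integral>\<^sup>+s. ennreal (norm (fst s - g s) ^ N) \<partial>joint \<gamma> \<rho> n) \<le> ennreal D" .
    have "(\<integral>\<^sup>+s. ennreal ((1 + norm (g s)) ^ N) \<partial>joint \<gamma> \<rho> n)
       \<le> (\<integral>\<^sup>+s. ennreal (2 ^ N * ((1 + norm (fst s)) ^ N + norm (fst s - g s) ^ N)) \<partial>joint \<gamma> \<rho> n)"
    proof (intro nn_integral_mono ennreal_leI)
      fix s
      have "1 + norm (g s) \<le> (1 + norm (fst s)) + norm (fst s - g s)"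
        using norm_triangle_ineq4[of "fst s" "fst s - g s"] by simp
      then show "(1 + norm (g s)) ^ N \<le> 2 ^ N * ((1 + norm (fst s)) ^ N + norm (fst s - g s) ^ N)"
        by (intro order_trans[OF power_mono sum_power_le]) auto
    qed
    also have "\<dots> = ennreal (2 ^ N) * ((\<integral>\<^sup>+s. ennreal ((1 + norm (fst s)) ^ N) \<partial>joint \<gamma> \<rho> n)
         + (\<integral>\<^sup>+s. ennreal (norm (fst s - g s) ^ N) \<partial>joint \<gamma> \<rho> n))"
      by (rule split) auto
    also have "(\<integral>\<^sup>+s. ennreal ((1 + norm (fst s)) ^ N) \<partial>joint \<gamma> \<rho> n) = ennreal P"
      unfolding P[symmetric] by (rule joint_fst_gibbs[OF _ sets gibbs]) measurable
    also have "ennreal (2 ^ N) * (ennreal P + (\<integral>\<^sup>+s. ennreal (norm (fst s - g s) ^ N) \<partial>joint \<gamma> \<rho> n))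
       \<le> ennreal (2 ^ N) * (ennreal P + ennreal D)"
      by (intro mult_left_mono add_mono dD) auto
    also have "\<dots> = ennreal (2 ^ N * (P + D))" using P0 D by (simp add: ennreal_mult)
    also have "\<dots> \<le> ennreal C" by (intro ennreal_leI) (simp add: C_def)
    finally show "(\<integral>\<^sup>+s. ennreal ((1 + norm (g s)) ^ (2 * Suc k)) \<partial>joint \<gamma> \<rho> n) \<le> ennreal C"
      unfolding N_def .
  qed
qed

definition sync_const :: real where
  "sync_const = (\<mu> + 2 * (m + L)\<^sup>2) / (2 * exp (- \<mu> * \<gamma>0))"

text \<open>
Smoothing at scale \<open>sqrt \<gamma>\<close> keeps the square root away from its singularity, so that an error of order
\<open>\<gamma>\<^sup>2\<close> in the squared distance costs only \<open>O(\<gamma> powr (3/2))\<close> in the distance itself. This gives a recursion in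
\<open>L^p\<close> also for \<open>p < 2\<close>.
\<close>

definition smooth_dist :: "real \<Rightarrow> 'a \<Rightarrow> 'a \<Rightarrow> real" where
  "smooth_dist \<gamma> x y = sqrt ((norm (x - y))\<^sup>2 + \<gamma>)"

lemma sync_const_pos: "sync_const > 0"
  using mu_pos by (simp add: sync_const_def add_pos_nonneg)

lemma measurable_smooth_dist [measurable (raw)]:
  assumes [measurable]: "f \<in> borel_measurable N" "g \<in> borel_measurable N"
  shows "(\<lambda>w. smooth_dist \<gamma> (f w) (g w)) \<in> borel_measurable N"
  unfolding smooth_dist_def by measurable

lemma smooth_dist_nonneg: "\<gamma> \<ge> 0 \<Longrightarrow> smooth_dist \<gamma> x y \<ge> 0"
  by (simp add: smooth_dist_def)

text \<open>
With common noise the new difference is \<open>d - \<gamma> h\<close>, where \<open>h\<close> is the difference of the gradients. Monotonicity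
gives the factor \<open>1 - 2 \<mu> \<gamma> \<le> exp (- \<mu> \<gamma>) ^ 2\<close> for its square; the term \<open>\<gamma>\<^sup>2 * norm h ^ 2\<close>, which does not vanish with
\<open>d\<close> as the gradient may jump, is the error.
\<close>

lemma smooth_dist_euler:
  assumes g: "0 < \<gamma>" "\<gamma> \<le> \<gamma>0" and dom: "x \<in> grad_dom U" "y \<in> grad_dom U"
  shows "smooth_dist \<gamma> (euler \<gamma> x z) (euler \<gamma> y z) \<le> exp (- \<mu> * \<gamma>) * smooth_dist \<gamma> x y
    + \<gamma> * sqrt \<gamma> * sync_const * ((1 + norm x)\<^sup>2 + (1 + norm y)\<^sup>2)"
proof -
  define lam where "lam = exp (- \<mu> * \<gamma>)"
  define d where "d = x - y"
  define h where "h = grad U x - grad U y"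
  define Q where "Q = (1 + norm x)\<^sup>2 + (1 + norm y)\<^sup>2"
  define F where "F = smooth_dist \<gamma> x y"
  define R where "R = (\<mu> + 2 * (m + L)\<^sup>2) * Q"
  have lam: "lam > 0" by (simp add: lam_def)
  have Q: "Q \<ge> 2"
  proof -
    have "1 \<le> (1 + norm x)\<^sup>2" "1 \<le> (1 + norm y)\<^sup>2" by (intro one_le_power; simp)+
    then show ?thesis unfolding Q_def by linarith
  qed
  have R: "R \<ge> 0" using Q mu_pos by (simp add: R_def)
  have F2: "F\<^sup>2 = (norm d)\<^sup>2 + \<gamma>" using g by (simp add: F_def smooth_dist_def d_def)
  have F: "F \<ge> sqrt \<gamma>" unfolding F_def smooth_dist_def by (intro real_sqrt_le_mono) auto
  have "norm h \<le> (m + L) * ((1 + norm x) + (1 + norm y))"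
  proof -
    have "norm h \<le> (m + L * norm x) + (m + L * norm y)"
      unfolding h_def by (intro order_trans[OF norm_triangle_ineq4] add_mono growth)
    also have "\<dots> \<le> (m + L) * ((1 + norm x) + (1 + norm y))"
      using m_pos L_pos by (simp add: algebra_simps)
    finally show ?thesis .
  qed
  then have "(norm h)\<^sup>2 \<le> ((m + L) * ((1 + norm x) + (1 + norm y)))\<^sup>2" by (intro power_mono) auto
  also have "\<dots> = (m + L)\<^sup>2 * ((1 + norm x) + (1 + norm y))\<^sup>2" by (simp add: power_mult_distrib)
  also have "\<dots> \<le> (m + L)\<^sup>2 * (2 * Q)"
  proof (intro mult_left_mono)
    have "0 \<le> ((1 + norm x) - (1 + norm y))\<^sup>2" by simp
    then show "((1 + norm x) + (1 + norm y))\<^sup>2 \<le> 2 * Q" by (simp only: Q_def power2_sum power2_diff) simp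
  qed simp
  finally have h2: "(norm h)\<^sup>2 \<le> (m + L)\<^sup>2 * (2 * Q)" .
  have "(norm h)\<^sup>2 + 2 * \<mu> \<le> R"
  proof -
    have "\<mu> * 2 \<le> \<mu> * Q" using Q mu_pos by (intro mult_left_mono) auto
    with h2 show ?thesis by (simp add: R_def algebra_simps)
  qed
  then have hR: "\<gamma>\<^sup>2 * (norm h)\<^sup>2 + 2 * \<mu> * \<gamma>\<^sup>2 \<le> \<gamma>\<^sup>2 * R"
    using mult_left_mono[of "(norm h)\<^sup>2 + 2 * \<mu>" R "\<gamma>\<^sup>2"] by (simp add: algebra_simps)
  have lam2: "1 - 2 * \<mu> * \<gamma> \<le> lam\<^sup>2"
    using exp_ge_add_one_self[of "- 2 * \<mu> * \<gamma>"] by (simp add: lam_def power2_eq_square exp_add[symmetric] mult_ac)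
  have eul: "euler \<gamma> x z - euler \<gamma> y z = d - \<gamma> *\<^sub>R h" by (simp add: euler_def d_def h_def algebra_simps)
  have "(norm (euler \<gamma> x z - euler \<gamma> y z))\<^sup>2 = (norm d)\<^sup>2 - 2 * \<gamma> * inner h d + \<gamma>\<^sup>2 * (norm h)\<^sup>2"
    unfolding eul power2_norm_eq_inner by (simp add: inner_diff inner_commute algebra_simps power2_eq_square)
  also have "\<dots> \<le> (norm d)\<^sup>2 - 2 * \<gamma> * (\<mu> * (norm d)\<^sup>2) + \<gamma>\<^sup>2 * (norm h)\<^sup>2"
    using mult_left_mono[OF grad_mono[OF dom], of "2 * \<gamma>"] g by (simp add: d_def h_def)
  also have "\<dots> = (1 - 2 * \<mu> * \<gamma>) * (norm d)\<^sup>2 + \<gamma>\<^sup>2 * (norm h)\<^sup>2" by (simp add: algebra_simps)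
  finally have "(norm (euler \<gamma> x z - euler \<gamma> y z))\<^sup>2 + \<gamma>
     \<le> (1 - 2 * \<mu> * \<gamma>) * F\<^sup>2 + (\<gamma>\<^sup>2 * (norm h)\<^sup>2 + 2 * \<mu> * \<gamma>\<^sup>2)"
    unfolding F2 by (simp add: algebra_simps power2_eq_square)
  also have "\<dots> \<le> lam\<^sup>2 * F\<^sup>2 + \<gamma>\<^sup>2 * R"
    by (intro add_mono hR mult_right_mono lam2) auto
  also have "\<dots> \<le> (lam * F + \<gamma> * sqrt \<gamma> * (R / (2 * lam)))\<^sup>2"
  proof -
    have "\<gamma>\<^sup>2 * R = 2 * (lam * sqrt \<gamma>) * (\<gamma> * sqrt \<gamma> * (R / (2 * lam)))"
      using lam g by (simp add: power2_eq_square field_simps)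
    also have "\<dots> \<le> 2 * (lam * F) * (\<gamma> * sqrt \<gamma> * (R / (2 * lam)))"
      using F lam g R by (intro mult_right_mono mult_left_mono) auto
    finally have "\<gamma>\<^sup>2 * R \<le> 2 * (lam * F) * (\<gamma> * sqrt \<gamma> * (R / (2 * lam)))" .
    moreover have "0 \<le> (\<gamma> * sqrt \<gamma> * (R / (2 * lam)))\<^sup>2" by simp
    ultimately show ?thesis by (simp only: power2_sum power_mult_distrib)
  qed
  finally have "smooth_dist \<gamma> (euler \<gamma> x z) (euler \<gamma> y z) \<le> lam * F + \<gamma> * sqrt \<gamma> * (R / (2 * lam))"
    unfolding smooth_dist_def using lam g R F order_trans[OF real_sqrt_ge_zero F]
    by (intro real_le_lsqrt add_nonneg_nonneg mult_nonneg_nonneg) auto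
  also have "\<gamma> * sqrt \<gamma> * (R / (2 * lam)) \<le> \<gamma> * sqrt \<gamma> * (sync_const * Q)"
  proof (intro mult_left_mono)
    have "exp (- \<mu> * \<gamma>0) \<le> lam" using mult_left_mono[OF g(2), of \<mu>] mu_pos by (simp add: lam_def)
    then have "R / (2 * lam) \<le> R / (2 * exp (- \<mu> * \<gamma>0))"
      using lam R by (intro divide_left_mono) auto
    then show "R / (2 * lam) \<le> sync_const * Q" by (simp add: R_def sync_const_def)
  qed (use g in auto)
  finally show ?thesis by (simp add: lam_def F_def Q_def mult.assoc)
qed

text \<open>
Each step adds an error of order \<open>\<gamma> powr (3/2)\<close> in \<open>L^p\<close>; summed against the geometric weights this
is of order \<open>sqrt \<gamma>\<close>, since \<open>1 - exp (- \<mu> \<gamma>)\<close> is of order \<open>\<gamma>\<close>.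
\<close>

lemma joint_smooth_contraction:
  assumes gam: "0 < \<gamma>" "\<gamma> \<le> \<gamma>0"
    and sets[measurable_cong]: "sets \<rho> = sets (borel \<Otimes>\<^sub>M borel)" and gibbs: "distr \<rho> borel snd = gibbs \<beta> U"
    and init: "AE q in \<rho>. fst q \<in> grad_dom U" and pr: "prob_space \<rho>"
    and p: "1 \<le> p" "p \<le> real (Suc k)" and C: "C \<ge> 1"
    and mom: "\<And>g n. g = (\<lambda>s. fst (snd s)) \<or> g = (\<lambda>s. snd (snd s)) \<Longrightarrow>
        (\<integral>\<^sup>+s. ennreal ((1 + norm (g s)) ^ (2 * Suc k)) \<partial>joint \<gamma> \<rho> n) \<le> ennreal C"
    and a: "a \<ge> 0" "(\<integral>\<^sup>+q. ennreal (norm (fst q - snd q) powr p) \<partial>\<rho>) \<le> ennreal (a powr p)"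
  shows "(\<integral>\<^sup>+s. ennreal (smooth_dist \<gamma> (fst (snd s)) (snd (snd s)) powr p) \<partial>joint \<gamma> \<rho> n)
     \<le> ennreal ((exp (- \<mu> * \<gamma>) ^ n * (a + sqrt \<gamma>) + sqrt \<gamma> * (2 * sync_const * C * (1 + \<mu> * \<gamma>0) / \<mu>)) powr p)"
proof -
  define lam where "lam = exp (- \<mu> * \<gamma>)"
  define K where "K = 2 * sync_const * C * (1 + \<mu> * \<gamma>0) / \<mu>"
  define e where "e = \<gamma> * sqrt \<gamma> * sync_const"
  have lam: "lam > 0" by (simp add: lam_def)
  have K: "K \<ge> 0" using sync_const_pos C mu_pos gamma0_pos by (simp add: K_def)
  have e: "e > 0" using gam sync_const_pos by (simp add: e_def)
  have "1 - lam \<ge> \<mu> * \<gamma> / (1 + \<mu> * \<gamma>0)"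
  proof -
    have "lam \<le> 1 / (1 + \<mu> * \<gamma>)"
      using exp_ge_add_one_self[of "\<mu> * \<gamma>"] gam mu_pos by (simp add: lam_def exp_minus divide_simps add_pos_pos)
    then have "1 - lam \<ge> 1 - 1 / (1 + \<mu> * \<gamma>)" by simp
    also have "1 - 1 / (1 + \<mu> * \<gamma>) = \<mu> * \<gamma> / (1 + \<mu> * \<gamma>)"
    proof -
      have "1 + \<mu> * \<gamma> > 0" using gam mu_pos by (intro add_pos_pos) auto
      then show ?thesis by (simp add: field_simps)
    qed
    also have "\<dots> \<ge> \<mu> * \<gamma> / (1 + \<mu> * \<gamma>0)"
      using gam mu_pos gamma0_pos by (intro divide_left_mono) (auto simp: add_pos_pos)
    finally show ?thesis .
  qed
  then have "sqrt \<gamma> * K * (\<mu> * \<gamma> / (1 + \<mu> * \<gamma>0)) \<le> sqrt \<gamma> * K * (1 - lam)"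
    using gam K by (intro mult_left_mono) auto
  moreover have "sqrt \<gamma> * K * (\<mu> * \<gamma> / (1 + \<mu> * \<gamma>0)) = 2 * (e * C)"
  proof -
    have "1 + \<mu> * \<gamma>0 \<noteq> 0" using add_pos_pos[OF zero_less_one mult_pos_pos[OF mu_pos gamma0_pos]] by simp
    then show ?thesis using mu_pos by (simp add: K_def e_def)
  qed
  ultimately have absorb: "2 * (e * C) \<le> sqrt \<gamma> * K * (1 - lam)" by simp
  define A where "A n = lam ^ n * (a + sqrt \<gamma>) + sqrt \<gamma> * K" for n
  have A: "A n \<ge> 0" for n using lam a gam K by (simp add: A_def)
  have mp: "(\<integral>\<^sup>+s. ennreal ((e * (1 + norm (g s))\<^sup>2) powr p) \<partial>joint \<gamma> \<rho> n) \<le> ennreal ((e * C) powr p)"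
    if g: "g = (\<lambda>s. fst (snd s)) \<or> g = (\<lambda>s. snd (snd s))" for g n
  proof (rule nn_integral_powr_scale)
    have "(\<integral>\<^sup>+s. ennreal ((1 + norm (g s))\<^sup>2 powr p) \<partial>joint \<gamma> \<rho> n)
       \<le> (\<integral>\<^sup>+s. ennreal ((1 + norm (g s)) ^ (2 * Suc k)) \<partial>joint \<gamma> \<rho> n)"
    proof (intro nn_integral_mono ennreal_leI)
      fix s
      have "(1 + norm (g s))\<^sup>2 powr p \<le> (1 + norm (g s))\<^sup>2 powr real (Suc k)"
        using p by (intro powr_mono) (auto intro: one_le_power)
      also have "\<dots> = ((1 + norm (g s))\<^sup>2) ^ Suc k"
        by (rule powr_realpow) (rule zero_less_power, rule add_pos_nonneg, auto)
      finally show "(1 + norm (g s))\<^sup>2 powr p \<le> (1 + norm (g s)) ^ (2 * Suc k)" by (simp only: power_mult)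
    qed
    also have "\<dots> \<le> ennreal C" by (rule mom[OF g])
    also have "\<dots> \<le> ennreal (C powr p)"
      using powr_mono[of 1 p C] p C by (intro ennreal_leI) auto
    finally show "(\<integral>\<^sup>+s. ennreal ((1 + norm (g s))\<^sup>2 powr p) \<partial>joint \<gamma> \<rho> n) \<le> ennreal (C powr p)" .
    show "(\<lambda>s. (1 + norm (g s))\<^sup>2) \<in> borel_measurable (joint \<gamma> \<rho> n)" using g by auto
  qed (use e C in auto)
  have "(\<integral>\<^sup>+s. ennreal (smooth_dist \<gamma> (fst (snd s)) (snd (snd s)) powr p) \<partial>joint \<gamma> \<rho> n) \<le> ennreal (A n powr p)"
  proof (induction n)
    case 0
    have "(\<integral>\<^sup>+s. ennreal (smooth_dist \<gamma> (fst (snd s)) (snd (snd s)) powr p) \<partial>joint \<gamma> \<rho> 0)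
      = (\<integral>\<^sup>+q. ennreal (smooth_dist \<gamma> (snd q) (fst q) powr p) \<partial>\<rho>)"
      by (subst nn_integral_joint_0) (auto simp: sets)
    also have "\<dots> \<le> (\<integral>\<^sup>+q. ennreal ((norm (fst q - snd q) + sqrt \<gamma>) powr p) \<partial>\<rho>)"
    proof (intro nn_integral_mono ennreal_leI powr_mono2)
      fix q :: "'a \<times> 'a"
      show "smooth_dist \<gamma> (snd q) (fst q) \<le> norm (fst q - snd q) + sqrt \<gamma>"
        unfolding smooth_dist_def
        by (intro order_trans[OF sqrt_add_le_add_sqrt]) (use gam in \<open>auto simp: norm_minus_commute\<close>)
    qed (use p gam smooth_dist_nonneg in auto)
    also have "\<dots> \<le> ennreal ((a + sqrt \<gamma>) powr p)"
      using gam a p by (intro nn_integral_powr_Minkowski) (auto simp: prob_space.emeasure_space_1[OF pr])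
    also have "\<dots> \<le> ennreal (A 0 powr p)"
      using K gam a p by (intro ennreal_leI powr_mono2) (auto simp: A_def)
    finally show ?case .
  next
    case (Suc n)
    let ?y = "\<lambda>s::'a \<times> 'a \<times> 'a. fst (snd s)" and ?x = "\<lambda>s::'a \<times> 'a \<times> 'a. snd (snd s)"
    have "(\<integral>\<^sup>+s. ennreal (smooth_dist \<gamma> (?y s) (?x s) powr p) \<partial>joint \<gamma> \<rho> (Suc n))
      = (\<integral>\<^sup>+s. (\<integral>\<^sup>+z. ennreal (smooth_dist \<gamma> (euler \<gamma> (?y s) z) (euler \<gamma> (?x s) z) powr p) \<partial>std_gaussian) \<partial>joint \<gamma> \<rho> n)"
      using joint_euler_Suc[of "\<lambda>q. ennreal (smooth_dist \<gamma> (fst q) (snd q) powr p)" \<gamma> \<rho> n] by simp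
    also have "\<dots> \<le> (\<integral>\<^sup>+s. (\<integral>\<^sup>+z. ennreal ((lam * smooth_dist \<gamma> (?y s) (?x s) + (e * (1 + norm (?y s))\<^sup>2 + e * (1 + norm (?x s))\<^sup>2)) powr p) \<partial>(std_gaussian :: 'a measure)) \<partial>joint \<gamma> \<rho> n)"
    proof (intro nn_integral_mono_AE)
      have "AE s in joint \<gamma> \<rho> n. ?y s \<in> grad_dom U" "AE s in joint \<gamma> \<rho> n. ?x s \<in> grad_dom U"
        by (rule joint_AE_dom[OF _ gam(1) sets gibbs init]; simp)+
      then show "AE s in joint \<gamma> \<rho> n. (\<integral>\<^sup>+z. ennreal (smooth_dist \<gamma> (euler \<gamma> (?y s) z) (euler \<gamma> (?x s) z) powr p) \<partial>std_gaussian)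
         \<le> (\<integral>\<^sup>+z. ennreal ((lam * smooth_dist \<gamma> (?y s) (?x s) + (e * (1 + norm (?y s))\<^sup>2 + e * (1 + norm (?x s))\<^sup>2)) powr p) \<partial>(std_gaussian :: 'a measure))"
      proof eventually_elim
        case (elim s)
        show ?case
        proof (intro nn_integral_mono ennreal_leI powr_mono2)
          fix z :: 'a
          show "smooth_dist \<gamma> (euler \<gamma> (?y s) z) (euler \<gamma> (?x s) z)
             \<le> lam * smooth_dist \<gamma> (?y s) (?x s) + (e * (1 + norm (?y s))\<^sup>2 + e * (1 + norm (?x s))\<^sup>2)"
            using smooth_dist_euler[OF gam elim, of z] by (simp add: lam_def e_def distrib_left)
        qed (use p gam smooth_dist_nonneg in auto)
      qed
    qed
    also have "\<dots> = (\<integral>\<^sup>+s. ennreal ((lam * smooth_dist \<gamma> (?y s) (?x s) + (e * (1 + norm (?y s))\<^sup>2 + e * (1 + norm (?x s))\<^sup>2)) powr p) \<partial>joint \<gamma> \<rho> n)"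
      using std_gaussian.emeasure_space_1[where 'a='a] by simp
    also have "\<dots> \<le> ennreal ((lam * A n + (e * C + e * C)) powr p)"
    proof (rule nn_integral_powr_Minkowski)
      show "(\<integral>\<^sup>+s. ennreal ((lam * smooth_dist \<gamma> (?y s) (?x s)) powr p) \<partial>joint \<gamma> \<rho> n)
         \<le> ennreal ((lam * A n) powr p)"
        using lam A gam Suc smooth_dist_nonneg by (intro nn_integral_powr_scale) auto
      show "(\<integral>\<^sup>+s. ennreal ((e * (1 + norm (?y s))\<^sup>2 + e * (1 + norm (?x s))\<^sup>2) powr p) \<partial>joint \<gamma> \<rho> n)
         \<le> ennreal ((e * C + e * C) powr p)"
        using mp[of ?y n] mp[of ?x n] e C p by (intro nn_integral_powr_Minkowski) auto
    qed (use lam e C A p gam smooth_dist_nonneg in auto)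
    also have "\<dots> \<le> ennreal (A (Suc n) powr p)"
    proof (intro ennreal_leI powr_mono2)
      show "lam * A n + (e * C + e * C) \<le> A (Suc n)"
        using absorb by (simp add: A_def algebra_simps)
    qed (use p lam A e C in auto)
    finally show ?case .
  qed
  then show ?thesis by (simp only: A_def lam_def K_def)
qed

end

section \<open>The Wasserstein bound\<close>

text \<open>
The \<open>n\<close>-th iterate is a function of the initial value and the first \<open>n\<close> noise variables, realised on
the space of their paths; independence of the next noise variable follows from this.
\<close>

lemma ula_restrict:
  assumes "n \<le> k"
  shows "ula U \<beta> \<gamma> \<xi> z n \<omega> = ula U \<beta> \<gamma> (\<lambda>x. x 0) (\<lambda>i x. x i) n
      (restrict (\<lambda>i. if i = 0 then \<xi> \<omega> else z i \<omega>) {0..k})"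
  using assms by (induction n) auto

lemma ennreal_powr_le:
  assumes "x \<le> ennreal (t powr p)" "t \<ge> 0" "p > 0"
  shows "ennreal_powr x (1 / p) \<le> ennreal t"
proof -
  have x: "x \<noteq> \<top>" using assms(1) by (auto simp: top_unique)
  have "enn2real x \<le> t powr p"
    using enn2real_mono[OF assms(1)] by simp
  then have "enn2real x powr (1 / p) \<le> (t powr p) powr (1 / p)"
    using assms by (intro powr_mono2) auto
  also have "\<dots> = t" using assms by (simp add: powr_powr)
  finally show ?thesis using x by (simp add: ennreal_powr_def ennreal_leI)
qed

text \<open>
In the extended nonnegative reals, where the infimum may be infinite, the affine map is moved across
the infimum by inverting it.
\<close>

lemma le_INF_mult_addI:
  fixes w :: ennreal
  assumes "\<And>i. i \<in> I \<Longrightarrow> w \<le> f i * ennreal (exp t) + ennreal d"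
  shows "w \<le> (INF i\<in>I. f i) * ennreal (exp t) + ennreal d"
proof -
  have inv: "ennreal (exp t) * ennreal (exp (- t)) = 1"
    by (simp add: ennreal_mult'[symmetric] exp_add[symmetric])
  have "(w - ennreal d) * ennreal (exp (- t)) \<le> (INF i\<in>I. f i)"
  proof (rule INF_greatest)
    fix i assume "i \<in> I"
    then have "w - ennreal d \<le> f i * ennreal (exp t)"
      using assms by (subst ennreal_minus_le_iff) (auto simp: add.commute)
    then have "(w - ennreal d) * ennreal (exp (- t)) \<le> f i * ennreal (exp t) * ennreal (exp (- t))"
      by (rule mult_right_mono) simp
    then show "(w - ennreal d) * ennreal (exp (- t)) \<le> f i"
      by (simp only: mult.assoc inv mult_1_right)
  qed
  then have "(w - ennreal d) * ennreal (exp (- t)) * ennreal (exp t) \<le> (INF i\<in>I. f i) * ennreal (exp t)"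
    by (rule mult_right_mono) simp
  then have "w - ennreal d \<le> (INF i\<in>I. f i) * ennreal (exp t)"
    using inv by (simp only: mult.assoc mult.commute[of "ennreal (exp (- t))"] mult_1_right)
  then show ?thesis
    by (subst (asm) ennreal_minus_le_iff) (auto simp: add.commute)
qed

context langevin
begin

text \<open>
The next noise variable is independent of the current iterate, so their joint law is a product.
\<close>

lemma ula_step_law:
  fixes M :: "'w measure"
  assumes M: "prob_space M" and z: "gaussian_noise M \<xi> z" and F[measurable]: "F \<in> borel_measurable borel"
  shows "(\<integral>\<^sup>+\<omega>. F (ula U \<beta> \<gamma> \<xi> z (Suc n) \<omega>) \<partial>M)
     = (\<integral>\<^sup>+\<omega>. (\<integral>\<^sup>+w. F (euler \<gamma> (ula U \<beta> \<gamma> \<xi> z n \<omega>) w) \<partial>std_gaussian) \<partial>M)"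
    and "ula U \<beta> \<gamma> \<xi> z n \<in> borel_measurable M"
proof -
  interpret prob_space M by (rule M)
  define X where "X i = (if i = 0 then \<xi> else z i)" for i :: nat
  define path where "path k = (ula U \<beta> \<gamma> (\<lambda>x. x 0) (\<lambda>i x. x i) k :: (nat \<Rightarrow> 'a) \<Rightarrow> 'a)" for k
  have ind: "indep_vars (\<lambda>_. borel) X UNIV"
    using z unfolding gaussian_noise_def X_def by blast
  have zlaw: "distributed M lborel (z (Suc n)) std_gaussian_density"
    using z unfolding gaussian_noise_def by auto
  have meas_path: "path j \<in> PiM {0..k} (\<lambda>_. borel) \<rightarrow>\<^sub>M borel" if "j \<le> k" for j k
    using that
  proof (induction j)
    case 0
    then show ?case unfolding path_def by simp
  next
    case (Suc j)
    then have [measurable]: "path j \<in> PiM {0..k} (\<lambda>_. borel) \<rightarrow>\<^sub>M borel" by simp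
    have [measurable]: "(\<lambda>x::nat \<Rightarrow> 'a. x (Suc j)) \<in> PiM {0..k} (\<lambda>_. borel) \<rightarrow>\<^sub>M borel"
      using Suc.prems by (intro measurable_component_singleton) auto
    have "path (Suc j) = (\<lambda>x. path j x - \<gamma> *\<^sub>R grad U (path j x) + sqrt (2 * \<gamma> / \<beta>) *\<^sub>R x (Suc j))"
      by (simp add: path_def fun_eq_iff)
    then show ?case by simp
  qed
  have eq: "path n \<circ> (\<lambda>\<omega>. restrict (\<lambda>i. X i \<omega>) {0..n}) = ula U \<beta> \<gamma> \<xi> z n"
    unfolding path_def X_def fun_eq_iff comp_def
    by (subst (2) ula_restrict[OF order_refl]) (simp add: if_distrib[of "\<lambda>h. h _"] cong: if_cong)
  have "indep_var (PiM {0..n} (\<lambda>_. borel)) (\<lambda>\<omega>. restrict (\<lambda>i. X i \<omega>) {0..n})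
          (PiM {Suc n} (\<lambda>_. borel)) (\<lambda>\<omega>. restrict (\<lambda>i. X i \<omega>) {Suc n})"
    by (rule indep_var_restrict[OF ind]) auto
  from indep_var_compose[OF this meas_path[OF order_refl], of "\<lambda>x. x (Suc n)" borel]
  have "indep_var borel (ula U \<beta> \<gamma> \<xi> z n) borel ((\<lambda>x. x (Suc n)) \<circ> (\<lambda>\<omega>. restrict (\<lambda>i. X i \<omega>) {Suc n}))"
    unfolding eq by simp
  moreover have "(\<lambda>x. x (Suc n)) \<circ> (\<lambda>\<omega>. restrict (\<lambda>i. X i \<omega>) {Suc n}) = z (Suc n)"
    by (simp add: X_def fun_eq_iff)
  ultimately have iv: "indep_var borel (ula U \<beta> \<gamma> \<xi> z n) borel (z (Suc n))" by simp
  then have [measurable]: "ula U \<beta> \<gamma> \<xi> z n \<in> borel_measurable M" "z (Suc n) \<in> borel_measurable M"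
    and prod: "distr M borel (ula U \<beta> \<gamma> \<xi> z n) \<Otimes>\<^sub>M distr M borel (z (Suc n))
      = distr M (borel \<Otimes>\<^sub>M borel) (\<lambda>\<omega>. (ula U \<beta> \<gamma> \<xi> z n \<omega>, z (Suc n) \<omega>))"
    by (auto simp: indep_var_distribution_eq)
  show "ula U \<beta> \<gamma> \<xi> z n \<in> borel_measurable M" by measurable
  have "distr M borel (z (Suc n)) = distr M lborel (z (Suc n))" by (intro distr_cong) auto
  also have "\<dots> = std_gaussian" unfolding std_gaussian_def by (rule distributed_distr_eq_density[OF zlaw])
  finally have G: "distr M borel (z (Suc n)) = std_gaussian" .
  have "(\<integral>\<^sup>+\<omega>. F (ula U \<beta> \<gamma> \<xi> z (Suc n) \<omega>) \<partial>M)
     = (\<integral>\<^sup>+\<omega>. F (euler \<gamma> (fst (ula U \<beta> \<gamma> \<xi> z n \<omega>, z (Suc n) \<omega>)) (snd (ula U \<beta> \<gamma> \<xi> z n \<omega>, z (Suc n) \<omega>))) \<partial>M)"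
    by (simp add: euler_def noise_def)
  also have "\<dots> = (\<integral>\<^sup>+q. F (euler \<gamma> (fst q) (snd q)) \<partial>(distr M borel (ula U \<beta> \<gamma> \<xi> z n) \<Otimes>\<^sub>M std_gaussian))"
    unfolding G[symmetric] prod by (rule nn_integral_distr[symmetric]) measurable
  also have "\<dots> = (\<integral>\<^sup>+y. (\<integral>\<^sup>+w. F (euler \<gamma> y w) \<partial>std_gaussian) \<partial>distr M borel (ula U \<beta> \<gamma> \<xi> z n))"
  proof -
    have "(\<lambda>q. F (euler \<gamma> (fst q) (snd q))) \<in> borel_measurable (distr M borel (ula U \<beta> \<gamma> \<xi> z n) \<Otimes>\<^sub>M std_gaussian)"
      by measurable
    from std_gaussian.nn_integral_fst[OF this] show ?thesis by simp
  qed
  also have "\<dots> = (\<integral>\<^sup>+\<omega>. (\<integral>\<^sup>+w. F (euler \<gamma> (ula U \<beta> \<gamma> \<xi> z n \<omega>) w) \<partial>std_gaussian) \<partial>M)"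
    by (rule nn_integral_distr) measurable
  finally show "(\<integral>\<^sup>+\<omega>. F (ula U \<beta> \<gamma> \<xi> z (Suc n) \<omega>) \<partial>M)
     = (\<integral>\<^sup>+\<omega>. (\<integral>\<^sup>+w. F (euler \<gamma> (ula U \<beta> \<gamma> \<xi> z n \<omega>) w) \<partial>std_gaussian) \<partial>M)" .
qed

text \<open>
The third component has the law of the given algorithm, although it lives on another probability space.
\<close>

lemma joint_ula_law:
  fixes M :: "'w measure"
  assumes M: "prob_space M" and \<xi>[measurable]: "\<xi> \<in> borel_measurable M" and z: "gaussian_noise M \<xi> z"
    and sets[measurable_cong]: "sets \<rho> = sets (borel \<Otimes>\<^sub>M borel)" and init: "distr \<rho> borel fst = distr M borel \<xi>"
    and "F \<in> borel_measurable borel"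
  shows "(\<integral>\<^sup>+s. F (snd (snd s)) \<partial>joint \<gamma> \<rho> n) = (\<integral>\<^sup>+\<omega>. F (ula U \<beta> \<gamma> \<xi> z n \<omega>) \<partial>M)"
  using assms(6)
proof (induction n arbitrary: F)
  case 0
  note [measurable] = 0
  have "(\<integral>\<^sup>+s. F (snd (snd s)) \<partial>joint \<gamma> \<rho> 0) = (\<integral>\<^sup>+q. F (fst q) \<partial>\<rho>)"
    by (subst nn_integral_joint_0) (auto simp: sets)
  also have "\<dots> = (\<integral>\<^sup>+x. F x \<partial>distr \<rho> borel fst)" by (rule nn_integral_distr[symmetric]) measurable
  also have "\<dots> = (\<integral>\<^sup>+\<omega>. F (\<xi> \<omega>) \<partial>M)" unfolding init by (rule nn_integral_distr) measurable
  finally show ?case by simp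
next
  case (Suc n)
  note [measurable] = Suc.prems
  have "(\<integral>\<^sup>+s. F (snd (snd s)) \<partial>joint \<gamma> \<rho> (Suc n))
     = (\<integral>\<^sup>+s. (\<integral>\<^sup>+w. F (euler \<gamma> (snd (snd s)) w) \<partial>std_gaussian) \<partial>joint \<gamma> \<rho> n)"
    using joint_euler_Suc[of "\<lambda>q. F (snd q)" \<gamma> \<rho> n] by simp
  also have "\<dots> = (\<integral>\<^sup>+\<omega>. (\<integral>\<^sup>+w. F (euler \<gamma> (ula U \<beta> \<gamma> \<xi> z n \<omega>) w) \<partial>std_gaussian) \<partial>M)"
    by (rule Suc.IH) measurable
  also have "\<dots> = (\<integral>\<^sup>+\<omega>. F (ula U \<beta> \<gamma> \<xi> z (Suc n) \<omega>) \<partial>M)"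
    by (rule ula_step_law(1)[OF M z Suc.prems, symmetric])
  finally show ?case .
qed

lemma joint_coupling:
  fixes M :: "'w measure"
  assumes M: "prob_space M" and \<xi>[measurable]: "\<xi> \<in> borel_measurable M" and z: "gaussian_noise M \<xi> z"
    and \<rho>: "\<rho> \<in> couplings (distr M borel \<xi>) (gibbs \<beta> U)"
  shows "distr (joint \<gamma> \<rho> n) (borel \<Otimes>\<^sub>M borel) (\<lambda>s. (fst s, snd (snd s)))
     \<in> couplings (gibbs \<beta> U) (distr M borel (ula U \<beta> \<gamma> \<xi> z n))"
proof -
  have sets[measurable_cong]: "sets \<rho> = sets (borel \<Otimes>\<^sub>M borel)" and pr: "prob_space \<rho>"
    and fst: "distr \<rho> borel fst = distr M borel \<xi>" and snd: "distr \<rho> borel snd = gibbs \<beta> U"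
    using \<rho> by (auto simp: couplings_def)
  note [measurable] = ula_step_law(2)[OF M z borel_measurable_const, of \<gamma> n]
  let ?\<rho>' = "distr (joint \<gamma> \<rho> n) (borel \<Otimes>\<^sub>M borel) (\<lambda>s. (fst s, snd (snd s)))"
  have "prob_space ?\<rho>'"
    by (rule prob_space.prob_space_distr[OF prob_space_joint[OF pr sets]]) measurable
  moreover have "distr ?\<rho>' borel fst = gibbs \<beta> U"
  proof (rule measure_eqI)
    fix A assume "A \<in> sets (distr ?\<rho>' borel fst)"
    then have [measurable]: "A \<in> sets borel" by simp
    have "emeasure (distr ?\<rho>' borel fst) A = (\<integral>\<^sup>+s. indicator A (fst s) \<partial>joint \<gamma> \<rho> n)"
      by (simp add: nn_integral_distr flip: nn_integral_indicator)
    also have "\<dots> = (\<integral>\<^sup>+x. indicator A x \<partial>gibbs \<beta> U)"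
      by (rule joint_fst_gibbs[OF _ sets snd]) measurable
    finally show "emeasure (distr ?\<rho>' borel fst) A = emeasure (gibbs \<beta> U) A" by simp
  qed simp
  moreover have "distr ?\<rho>' borel snd = distr M borel (ula U \<beta> \<gamma> \<xi> z n)"
  proof (rule measure_eqI)
    fix A assume "A \<in> sets (distr ?\<rho>' borel snd)"
    then have [measurable]: "A \<in> sets borel" by simp
    have "emeasure (distr ?\<rho>' borel snd) A = (\<integral>\<^sup>+s. indicator A (snd (snd s)) \<partial>joint \<gamma> \<rho> n)"
      by (simp add: nn_integral_distr flip: nn_integral_indicator)
    also have "\<dots> = (\<integral>\<^sup>+\<omega>. indicator A (ula U \<beta> \<gamma> \<xi> z n \<omega>) \<partial>M)"
      by (rule joint_ula_law[OF M \<xi> z sets fst]) measurable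
    also have "\<dots> = emeasure (distr M borel (ula U \<beta> \<gamma> \<xi> z n)) A"
      by (simp add: nn_integral_distr flip: nn_integral_indicator)
    finally show "emeasure (distr ?\<rho>' borel snd) A = emeasure (distr M borel (ula U \<beta> \<gamma> \<xi> z n)) A" .
  qed simp
  ultimately show ?thesis by (simp add: couplings_def)
qed

text \<open>
The two processes start at the same point, so only the accumulated error is left. A real exponent \<open>p\<close> is reduced to
an even one by comparing the distance with the scale \<open>\<gamma> powr (1/4)\<close>.
\<close>

lemma stationary_ula_distance:
  assumes p: "1 \<le> p" "p \<le> real (Suc k)"
  obtains B where "B \<ge> 1"
    and "\<And>\<gamma> \<rho> n. 0 < \<gamma> \<Longrightarrow> \<gamma> \<le> \<gamma>0 \<Longrightarrow> prob_space \<rho> \<Longrightarrow>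
      sets \<rho> = sets (borel \<Otimes>\<^sub>M borel) \<Longrightarrow> distr \<rho> borel snd = gibbs \<beta> U \<Longrightarrow>
      AE q in \<rho>. fst q \<in> grad_dom U \<Longrightarrow>
      (\<integral>\<^sup>+s. ennreal (norm (fst s - fst (snd s)) powr p) \<partial>joint \<gamma> \<rho> n) \<le> ennreal ((B * \<gamma> powr (1/4)) powr p)"
proof -
  obtain C0 where C0: "C0 > 0"
    and dist: "\<And>\<gamma> \<rho> n g. 0 < \<gamma> \<Longrightarrow> \<gamma> \<le> \<gamma>0 \<Longrightarrow> g = (\<lambda>s. fst (snd s)) \<or> g = (\<lambda>s. snd (snd s)) \<Longrightarrow>
      sets \<rho> = sets (borel \<Otimes>\<^sub>M borel) \<Longrightarrow> distr \<rho> borel snd = gibbs \<beta> U \<Longrightarrow>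
      AE q in \<rho>. fst q \<in> grad_dom U \<Longrightarrow>
      (\<integral>\<^sup>+s. ennreal (norm (fst s - g s) ^ (2 * Suc k)) \<partial>joint \<gamma> \<rho> n)
      \<le> (\<integral>\<^sup>+s. ennreal (norm (fst s - g s) ^ (2 * Suc k)) \<partial>joint \<gamma> \<rho> 0) + ennreal (C0 * noise \<gamma> ^ Suc k)"
    using joint_distance_moment[of k] by blast
  define B where "B = 1 + C0 * sqrt (2 / \<beta>) ^ Suc k"
  have B: "B \<ge> 1" using C0 beta_pos by (simp add: B_def)
  show ?thesis
  proof (rule that[OF B])
    fix \<gamma> :: real and \<rho> :: "('a \<times> 'a) measure" and n
    assume gam: "0 < \<gamma>" "\<gamma> \<le> \<gamma>0" and pr: "prob_space \<rho>" and sets: "sets \<rho> = sets (borel \<Otimes>\<^sub>M borel)"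
      and gibbs: "distr \<rho> borel snd = gibbs \<beta> U" and init: "AE q in \<rho>. fst q \<in> grad_dom U"
    interpret J: prob_space "joint \<gamma> \<rho> n" by (rule prob_space_joint[OF pr sets])
    define s where "s = \<gamma> powr (1/4)"
    have s: "s > 0" using gam by (simp add: s_def)
    have s2: "s\<^sup>2 = sqrt \<gamma>"
      using gam by (simp add: s_def power2_eq_square powr_add[symmetric] powr_half_sqrt)
    have noise: "noise \<gamma> = sqrt (2 / \<beta>) * s\<^sup>2"
      unfolding s2 noise_def by (simp add: real_sqrt_mult[symmetric])
    define T where "T = (\<lambda>q::'a \<times> 'a \<times> 'a. norm (fst q - fst (snd q)))"
    have [measurable]: "T \<in> borel_measurable borel3" unfolding T_def by measurable
    have "(\<integral>\<^sup>+q. ennreal (T q ^ (2 * Suc k)) \<partial>joint \<gamma> \<rho> 0) = 0"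
      by (subst nn_integral_joint_0) (auto simp: sets T_def)
    then have TT: "(\<integral>\<^sup>+q. ennreal (T q ^ (2 * Suc k)) \<partial>joint \<gamma> \<rho> n) \<le> ennreal (C0 * noise \<gamma> ^ Suc k)"
      using dist[OF gam _ sets gibbs init, of "\<lambda>s. fst (snd s)" n] by (simp only: T_def) simp
    have pt: "u powr p \<le> s powr p * (1 + (1 / s ^ (2 * Suc k)) * u ^ (2 * Suc k))" if u: "u \<ge> 0" for u
    proof (cases "u \<le> s")
      case True
      then have "u powr p \<le> s powr p * 1" using u p by (simp add: powr_mono2)
      also have "\<dots> \<le> s powr p * (1 + (1 / s ^ (2 * Suc k)) * u ^ (2 * Suc k))"
        using u s by (intro mult_left_mono) auto
      finally show ?thesis .
    next
      case False
      then have us: "u / s \<ge> 1" using s by simp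
      have "u powr p = s powr p * (u / s) powr p" using u s by (simp add: powr_divide)
      also have "(u / s) powr p \<le> (u / s) powr real (2 * Suc k)"
        using us p by (intro powr_mono) auto
      also have "\<dots> = (u / s) ^ (2 * Suc k)" using us by (intro powr_realpow) auto
      also have "\<dots> \<le> 1 + (1 / s ^ (2 * Suc k)) * u ^ (2 * Suc k)" by (simp add: power_divide)
      finally show ?thesis using s by (simp add: mult_left_mono)
    qed
    have split: "ennreal (S * (1 + R * W)) = ennreal S * (1 + ennreal R * ennreal W)"
      if "S \<ge> 0" "R \<ge> 0" "W \<ge> 0" for S R W :: real
      using that by (simp add: ennreal_mult)
    have "(\<integral>\<^sup>+q. ennreal (T q powr p) \<partial>joint \<gamma> \<rho> n)
      \<le> (\<integral>\<^sup>+q. ennreal (s powr p) * (1 + ennreal (1 / s ^ (2 * Suc k)) * ennreal (T q ^ (2 * Suc k))) \<partial>joint \<gamma> \<rho> n)"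
    proof (intro nn_integral_mono)
      fix q
      have T0: "T q \<ge> 0" by (simp add: T_def)
      have "ennreal (T q powr p) \<le> ennreal (s powr p * (1 + (1 / s ^ (2 * Suc k)) * T q ^ (2 * Suc k)))"
        by (rule ennreal_leI[OF pt[OF T0]])
      also have "\<dots> = ennreal (s powr p) * (1 + ennreal (1 / s ^ (2 * Suc k)) * ennreal (T q ^ (2 * Suc k)))"
        using s T0 by (intro split) auto
      finally show "ennreal (T q powr p) \<le> ennreal (s powr p) * (1 + ennreal (1 / s ^ (2 * Suc k)) * ennreal (T q ^ (2 * Suc k)))" .
    qed
    also have "\<dots> = ennreal (s powr p) * (1 + ennreal (1 / s ^ (2 * Suc k)) * (\<integral>\<^sup>+q. ennreal (T q ^ (2 * Suc k)) \<partial>joint \<gamma> \<rho> n))"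
      using J.emeasure_space_1 by (simp add: nn_integral_cmult nn_integral_add del: power_Suc mult_Suc_right)
    also have "\<dots> \<le> ennreal (s powr p) * (1 + ennreal (1 / s ^ (2 * Suc k)) * ennreal (C0 * noise \<gamma> ^ Suc k))"
      by (intro mult_left_mono add_mono TT) auto
    also have "\<dots> = ennreal (s powr p * (1 + (1 / s ^ (2 * Suc k)) * (C0 * noise \<gamma> ^ Suc k)))"
      using s C0 noise_pos[OF gam(1)] by (intro split[symmetric]) auto
    also have "(1 / s ^ (2 * Suc k)) * (C0 * noise \<gamma> ^ Suc k) = C0 * sqrt (2 / \<beta>) ^ Suc k"
      unfolding noise power_mult_distrib power_mult using s by simp
    also have "s powr p * (1 + C0 * sqrt (2 / \<beta>) ^ Suc k) \<le> (B * s) powr p"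
      unfolding B_def[symmetric]
      using powr_mono[of 1 p B] B p s by (simp add: powr_mult mult.commute[of _ "s powr p"])
    finally show "(\<integral>\<^sup>+s. ennreal (norm (fst s - fst (snd s)) powr p) \<partial>joint \<gamma> \<rho> n) \<le> ennreal ((B * \<gamma> powr (1/4)) powr p)"
      using ennreal_leI order_trans unfolding T_def s_def by blast
  qed
qed

text \<open>
The distance between the invariant chain and the algorithm is split at the copy that starts from \<open>\<pi>\<close>. The terms
of order \<open>sqrt \<gamma>\<close> are absorbed into \<open>\<gamma> powr (1/4)\<close> since \<open>\<gamma> < \<gamma>0\<close>. All constants are fixed before the
initial coupling \<open>\<rho>\<close> is chosen, so that the infimum over \<open>\<rho>\<close> may be taken at the end.
\<close>

lemma ula_wasserstein_bound:
  fixes M :: "'w measure"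
  assumes M: "prob_space M" and \<xi>[measurable]: "\<xi> \<in> borel_measurable M"
    and dom: "AE \<omega> in M. \<xi> \<omega> \<in> grad_dom U"
    and mom: "\<And>q::real. q > 0 \<Longrightarrow> integrable M (\<lambda>\<omega>. norm (\<xi> \<omega>) powr q)"
    and p: "p \<ge> 1"
  shows "\<exists>c>0. \<forall>\<gamma>. 0 < \<gamma> \<and> \<gamma> < \<gamma>0 \<longrightarrow>
           (\<forall>z. gaussian_noise M \<xi> z \<longrightarrow>
             (\<forall>n. wasserstein p (gibbs \<beta> U) (distr M borel (ula U \<beta> \<gamma> \<xi> z n))
                \<le> wasserstein p (distr M borel \<xi>) (gibbs \<beta> U) * ennreal (exp (- \<mu> * \<gamma> * real n))
                   + ennreal (c * \<gamma> powr (1 / 4))))"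
proof -
  interpret M: prob_space M by (rule M)
  obtain k :: nat where "p \<le> real k" using real_arch_simple by blast
  then have pk: "p \<le> real (Suc k)" by simp
  define N where "N = 2 * Suc k"
  define \<Xi> where "\<Xi> = 2 ^ N * (1 + (\<integral>\<omega>. norm (\<xi> \<omega>) powr real N \<partial>M))"
  have \<Xi>0: "\<Xi> \<ge> 0" by (auto simp: \<Xi>_def intro!: add_nonneg_nonneg integral_nonneg_AE)
  have \<Xi>: "(\<integral>\<^sup>+\<omega>. ennreal ((1 + norm (\<xi> \<omega>)) ^ N) \<partial>M) \<le> ennreal \<Xi>"
  proof -
    have int: "integrable M (\<lambda>\<omega>. norm (\<xi> \<omega>) powr real N)" by (rule mom) (simp add: N_def)
    have "(\<integral>\<^sup>+\<omega>. ennreal ((1 + norm (\<xi> \<omega>)) ^ N) \<partial>M) \<le> (\<integral>\<^sup>+\<omega>. ennreal (2 ^ N * (1 + norm (\<xi> \<omega>) powr real N)) \<partial>M)"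
    proof (intro nn_integral_mono ennreal_leI)
      fix \<omega>
      have "norm (\<xi> \<omega>) ^ N = norm (\<xi> \<omega>) powr real N"
        by (cases "\<xi> \<omega> = 0") (simp add: N_def, simp add: powr_realpow)
      then show "(1 + norm (\<xi> \<omega>)) ^ N \<le> 2 ^ N * (1 + norm (\<xi> \<omega>) powr real N)"
        using sum_power_le[of 1 "norm (\<xi> \<omega>)" N] by simp
    qed
    also have "\<dots> = ennreal (\<integral>\<omega>. 2 ^ N * (1 + norm (\<xi> \<omega>) powr real N) \<partial>M)"
      using int by (intro nn_integral_eq_integral) auto
    also have "(\<integral>\<omega>. 2 ^ N * (1 + norm (\<xi> \<omega>) powr real N) \<partial>M) = \<Xi>"
      using int by (simp add: \<Xi>_def M.prob_space)
    finally show ?thesis .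
  qed
  obtain C where C: "C \<ge> 1"
    and mbound: "\<And>\<gamma> \<rho> n g. 0 < \<gamma> \<Longrightarrow> \<gamma> \<le> \<gamma>0 \<Longrightarrow> g = (\<lambda>s. fst (snd s)) \<or> g = (\<lambda>s. snd (snd s)) \<Longrightarrow>
      sets \<rho> = sets (borel \<Otimes>\<^sub>M borel) \<Longrightarrow> distr \<rho> borel snd = gibbs \<beta> U \<Longrightarrow>
      AE q in \<rho>. fst q \<in> grad_dom U \<Longrightarrow>
      (\<integral>\<^sup>+q. ennreal ((1 + norm (fst q)) ^ N) \<partial>\<rho>) \<le> ennreal \<Xi> \<Longrightarrow>
      (\<integral>\<^sup>+s. ennreal ((1 + norm (g s)) ^ N) \<partial>joint \<gamma> \<rho> n) \<le> ennreal C"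
    using joint_moment_bound[OF \<Xi>0, of k] unfolding N_def by blast
  obtain B where B: "B \<ge> 1"
    and sbound: "\<And>\<gamma> \<rho> n. 0 < \<gamma> \<Longrightarrow> \<gamma> \<le> \<gamma>0 \<Longrightarrow> prob_space \<rho> \<Longrightarrow>
      sets \<rho> = sets (borel \<Otimes>\<^sub>M borel) \<Longrightarrow> distr \<rho> borel snd = gibbs \<beta> U \<Longrightarrow>
      AE q in \<rho>. fst q \<in> grad_dom U \<Longrightarrow>
      (\<integral>\<^sup>+s. ennreal (norm (fst s - fst (snd s)) powr p) \<partial>joint \<gamma> \<rho> n) \<le> ennreal ((B * \<gamma> powr (1/4)) powr p)"
    using stationary_ula_distance[OF p pk] by blast
  define K where "K = 2 * sync_const * C * (1 + \<mu> * \<gamma>0) / \<mu>"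
  have K: "K \<ge> 0" using sync_const_pos C mu_pos gamma0_pos by (simp add: K_def)
  define c where "c = B + \<gamma>0 powr (1/4) * (1 + K)"
  have c: "c > 0" using B K by (simp add: c_def add_pos_nonneg)
  have "wasserstein p (gibbs \<beta> U) (distr M borel (ula U \<beta> \<gamma> \<xi> z n))
      \<le> wasserstein p (distr M borel \<xi>) (gibbs \<beta> U) * ennreal (exp (- \<mu> * \<gamma> * real n)) + ennreal (c * \<gamma> powr (1 / 4))"
    if gam: "0 < \<gamma>" "\<gamma> < \<gamma>0" and z: "gaussian_noise M \<xi> z" for \<gamma> z n
    unfolding wasserstein_def[of p "distr M borel \<xi>"]
  proof (rule le_INF_mult_addI)
    fix \<rho> assume \<rho>: "\<rho> \<in> couplings (distr M borel \<xi>) (gibbs \<beta> U)"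
    have gam': "\<gamma> \<le> \<gamma>0" using gam by simp
    have sets[measurable_cong]: "sets \<rho> = sets (borel \<Otimes>\<^sub>M borel)" and pr: "prob_space \<rho>"
      and fst: "distr \<rho> borel fst = distr M borel \<xi>" and gibbs: "distr \<rho> borel snd = gibbs \<beta> U"
      using \<rho> by (auto simp: couplings_def)
    have "AE x in distr \<rho> borel fst. x \<in> grad_dom U"
      unfolding fst using dom by (subst AE_distr_iff) auto
    then have init: "AE q in \<rho>. fst q \<in> grad_dom U"
      by (subst (asm) AE_distr_iff) auto
    have "(\<integral>\<^sup>+q. ennreal ((1 + norm (fst q)) ^ N) \<partial>\<rho>) = (\<integral>\<^sup>+x. ennreal ((1 + norm x) ^ N) \<partial>distr \<rho> borel fst)"
      by (rule nn_integral_distr[symmetric]) measurable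
    also have "\<dots> = (\<integral>\<^sup>+\<omega>. ennreal ((1 + norm (\<xi> \<omega>)) ^ N) \<partial>M)"
      unfolding fst by (rule nn_integral_distr) measurable
    finally have momrho: "(\<integral>\<^sup>+q. ennreal ((1 + norm (fst q)) ^ N) \<partial>\<rho>) \<le> ennreal \<Xi>" using \<Xi> by simp
    define cost where "cost = (\<integral>\<^sup>+ w. ennreal (dist (fst w) (snd w) powr p) \<partial>\<rho>)"
    define lam where "lam = exp (- \<mu> * \<gamma>) ^ n"
    have lam: "0 < lam" "lam \<le> 1"
      using mu_pos gam by (auto simp: lam_def intro!: power_le_one)
    have lam_eq: "lam = exp (- \<mu> * \<gamma> * real n)" using exp_of_nat_mult[of n "- \<mu> * \<gamma>"] by (simp add: lam_def mult_ac)
    show "wasserstein p (gibbs \<beta> U) (distr M borel (ula U \<beta> \<gamma> \<xi> z n))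
       \<le> ennreal_powr (\<integral>\<^sup>+ w. ennreal (dist (fst w) (snd w) powr p) \<partial>\<rho>) (1 / p) * ennreal (exp (- \<mu> * \<gamma> * real n))
         + ennreal (c * \<gamma> powr (1 / 4))"
    proof (cases "cost = \<top>")
      case True
      then have "ennreal_powr (\<integral>\<^sup>+ w. ennreal (dist (fst w) (snd w) powr p) \<partial>\<rho>) (1 / p) = \<top>"
        by (simp add: cost_def[symmetric] ennreal_powr_def)
      then show ?thesis by (simp add: ennreal_top_mult)
    next
      case False
      define a where "a = enn2real cost powr (1 / p)"
      have a: "a \<ge> 0" by (simp add: a_def)
      have ap: "ennreal (a powr p) = cost"
        using False p by (simp add: a_def powr_powr less_top)
      define s where "s = \<gamma> powr (1/4)"
      have s: "s > 0" "s \<le> \<gamma>0 powr (1/4)" using gam by (auto simp: s_def intro!: powr_mono2)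
      have s2: "sqrt \<gamma> = s * s"
        using gam by (simp add: s_def powr_add[symmetric] powr_half_sqrt)
      define E where "E = lam * (a + sqrt \<gamma>) + sqrt \<gamma> * K"
      have E: "E \<ge> 0" using lam a gam K by (simp add: E_def)
      have 1: "(\<integral>\<^sup>+q. ennreal (smooth_dist \<gamma> (fst (snd q)) (snd (snd q)) powr p) \<partial>joint \<gamma> \<rho> n) \<le> ennreal (E powr p)"
        unfolding E_def lam_def K_def
      proof (rule joint_smooth_contraction[OF gam(1) gam' sets gibbs init pr p pk C])
        show "(\<integral>\<^sup>+s. ennreal ((1 + norm (g s)) ^ (2 * Suc k)) \<partial>joint \<gamma> \<rho> n) \<le> ennreal C"
          if "g = (\<lambda>s. fst (snd s)) \<or> g = (\<lambda>s. snd (snd s))" for g n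
          using mbound[OF gam(1) gam' that sets gibbs init momrho, of n] by (simp only: N_def)
        show "(\<integral>\<^sup>+q. ennreal (norm (fst q - snd q) powr p) \<partial>\<rho>) \<le> ennreal (a powr p)"
          unfolding ap cost_def by (simp add: dist_norm)
      qed (rule a)
      have 2: "(\<integral>\<^sup>+q. ennreal (norm (fst q - fst (snd q)) powr p) \<partial>joint \<gamma> \<rho> n) \<le> ennreal ((B * s) powr p)"
        using sbound[OF gam(1) gam' pr sets gibbs init, of n] by (simp only: s_def)
      let ?\<rho>' = "distr (joint \<gamma> \<rho> n) (borel \<Otimes>\<^sub>M borel) (\<lambda>s. (fst s, snd (snd s)))"
      have "(\<integral>\<^sup>+w. ennreal (dist (fst w) (snd w) powr p) \<partial>?\<rho>')
         = (\<integral>\<^sup>+q. ennreal (norm (fst q - snd (snd q)) powr p) \<partial>joint \<gamma> \<rho> n)"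
        by (subst nn_integral_distr) (auto simp: dist_norm)
      also have "\<dots> \<le> (\<integral>\<^sup>+q. ennreal ((norm (fst q - fst (snd q)) + smooth_dist \<gamma> (fst (snd q)) (snd (snd q))) powr p) \<partial>joint \<gamma> \<rho> n)"
      proof (intro nn_integral_mono ennreal_leI powr_mono2)
        fix q :: "'a \<times> 'a \<times> 'a"
        have "norm (fst (snd q) - snd (snd q)) \<le> smooth_dist \<gamma> (fst (snd q)) (snd (snd q))"
          unfolding smooth_dist_def using gam by (intro real_le_rsqrt) auto
        then show "norm (fst q - snd (snd q)) \<le> norm (fst q - fst (snd q)) + smooth_dist \<gamma> (fst (snd q)) (snd (snd q))"
          using norm_triangle_ineq[of "fst q - fst (snd q)" "fst (snd q) - snd (snd q)"] by simp
      qed (use p in auto)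
      also have "\<dots> \<le> ennreal ((B * s + E) powr p)"
        by (rule nn_integral_powr_Minkowski[OF _ _ _ _ p _ E 2 1])
           (use B s gam smooth_dist_nonneg in auto)
      finally have le: "(\<integral>\<^sup>+w. ennreal (dist (fst w) (snd w) powr p) \<partial>?\<rho>') \<le> ennreal ((B * s + E) powr p)" .
      have "wasserstein p (gibbs \<beta> U) (distr M borel (ula U \<beta> \<gamma> \<xi> z n))
         \<le> ennreal_powr (\<integral>\<^sup>+w. ennreal (dist (fst w) (snd w) powr p) \<partial>?\<rho>') (1 / p)"
        unfolding wasserstein_def by (rule INF_lower[OF joint_coupling[OF M \<xi> z \<rho>]])
      also have "\<dots> \<le> ennreal (B * s + E)"
        using B s E p by (intro ennreal_powr_le[OF le]) auto
      also have "\<dots> \<le> ennreal (a * lam + c * s)"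
      proof (rule ennreal_leI)
        have "lam * sqrt \<gamma> \<le> 1 * (s * \<gamma>0 powr (1/4))" unfolding s2 using lam s by (intro mult_mono) auto
        moreover have "sqrt \<gamma> * K \<le> s * \<gamma>0 powr (1/4) * K"
          unfolding s2 using s K by (intro mult_right_mono mult_left_mono) auto
        ultimately show "B * s + E \<le> a * lam + c * s"
          by (simp add: E_def c_def algebra_simps)
      qed
      also have "\<dots> = ennreal a * ennreal lam + ennreal (c * s)"
        using a lam c s by (simp add: ennreal_mult)
      also have "ennreal a = ennreal_powr cost (1 / p)"
        using False by (simp add: a_def ennreal_powr_def)
      finally show ?thesis by (simp only: cost_def lam_eq s_def)
    qed
  qed
  then show ?thesis using c by blast
qed

end

theorem theorem2:
  fixes U :: "'a::euclidean_space \<Rightarrow> real"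
    and M :: "'w measure"
    and \<xi> :: "'w \<Rightarrow> 'a"
    and L m \<mu> p \<beta> \<gamma>0 :: real
  assumes "strongly_convex U"
    and "AE x in lebesgue. x \<in> grad_dom U"
    and "L > 0" and "m > 0"
    and "\<And>x. x \<in> grad_dom U \<Longrightarrow> norm (grad U x) \<le> m + L * norm x"
    and "\<mu> > 0"
    and "\<And>x y. x \<in> grad_dom U \<Longrightarrow> y \<in> grad_dom U \<Longrightarrow>
           inner (grad U x - grad U y) (x - y) \<ge> \<mu> * (norm (x - y))\<^sup>2"
    and "prob_space M"
    and "\<xi> \<in> borel_measurable M"
    and "AE \<omega> in M. \<xi> \<omega> \<in> grad_dom U"
    and "\<And>q::real. q > 0 \<Longrightarrow> integrable M (\<lambda>\<omega>. norm (\<xi> \<omega>) powr q)"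
    and "p \<ge> 1" and "\<beta> > 0"
    and "0 < \<gamma>0" and "\<gamma>0 < \<mu> / (2 * L\<^sup>2)"
  shows "\<exists>c>0. \<forall>\<gamma>. 0 < \<gamma> \<and> \<gamma> < \<gamma>0 \<longrightarrow>
           (\<forall>z. gaussian_noise M \<xi> z \<longrightarrow>
             (\<forall>n. wasserstein p (gibbs \<beta> U) (distr M borel (ula U \<beta> \<gamma> \<xi> z n))
                \<le> wasserstein p (distr M borel \<xi>) (gibbs \<beta> U) * ennreal (exp (- \<mu> * \<gamma> * real n))
                   + ennreal (c * \<gamma> powr (1 / 4))))"
proof -
  have "\<gamma>0 * L\<^sup>2 \<le> \<mu> / 2"
    using assms(3) less_imp_le[OF assms(15)] by (simp add: field_simps)
  then interpret langevin U L m \<mu> \<beta> \<gamma>0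
    using assms strongly_convex_imp_convex_on[OF assms(1)] by unfold_locales auto
  show ?thesis
    by (rule ula_wasserstein_bound[OF assms(8-12)])
qed

end
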